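(* The assignment $Y\mapsto\Lambda(Y)$ to spans of spans preserves horizontal composition strictly, up to the isomorphisms $\beta$ weakly preserving composition of the source and target morphisms: let $X_1,X_2$ be spans of essentially finite groupoids from $A_1$ to $A_2$, let $X_1',X_2'$ be spans of essentially finite groupoids from $A_2$ to $A_3$, and let $Y:X_1\to X_2$ and $Y':X_1'\to X_2'$ be (strictly commuting) spans of span maps, with horizontal composite $Y'\circ Y:X_1'\circ X_1\to X_2'\circ X_2$. Then $$\Lambda(Y'\circ Y)=\beta_{X_2,X_2'}^{-1}\cdot\bigl(\Lambda(Y')\circ\Lambda(Y)\bigr)\cdot\beta_{X_1,X_1'}$$ as natural transformations $\Lambda(X_1'\circ X_1)\Rightarrow\Lambda(X_2'\circ X_2)$, where $\cdot$ is vertical composition of natural transformations (applied right to left), $\Lambda(Y')\circ\Lambda(Y):\Lambda(X_1')\circ\Lambda(X_1)\Rightarrow\Lambda(X_2')\circ\Lambda(X_2)$ is the horizontal composite, and $\beta_{X_i,X_i'}:\Lambda(X_i'\circ X_i)\to\Lambda(X_i')\circ\Lambda(X_i)$ is the comparison isomorphism.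
   Context: Vect is the category of finite-dimensional complex vector spaces; a groupoid is essentially finite if it is equivalent to a finite groupoid; $[A,\mathrm{Vect}]$ is the category of functors $A\to\mathrm{Vect}$. All groupoids are essentially finite. For a functor $f:B\to A$, $f^*F=F\circ f$, and $f_*:[B,\mathrm{Vect}]\to[A,\mathrm{Vect}]$ is the colimit of $G$ over the comma category $(f\downarrow a)$; explicitly $$(f_*G)(a)=\bigoplus_{[b]\,:\,f(b)\cong a}\mathbb{C}[\hom(f(b),a)]\otimes_{\mathbb{C}[\mathrm{Aut}(b)]}G(b),$$ the sum over isomorphism classes of $b\in B$ with $f(b)\cong a$ (choosing an isomorphism $f(b)\cong a$ turns $\mathbb{C}[\hom(f(b),a)]$ into $\mathbb{C}[\mathrm{Aut}(a)]$). The functor $f_*$ is both left and right adjoint to $f^*$. The left counit $\epsilon_{L,f}:f_*f^*\Rightarrow\mathrm{Id}$ is $\bigoplus_{[b]}g_b\otimes v_b\mapsto\sum_{[b]}F(g_b)(v_b)$, and the right unit $\eta_{R,f}:\mathrm{Id}\Rightarrow f_*f^*$ is $$\eta_{R,f}(F)(a):v\mapsto\bigoplus_{[b]:f(b)\cong a}\frac{1}{\#\mathrm{Aut}(b)}\sum_{g\in\hom(a,f(b))}g^{-1}\otimes F(g)(v).$$ Canonically $(fg)^*=g^*f^*$ and $(fg)_*\cong f_*g_*$. A span $A_1\xleftarrow{s}X\xrightarrow{t}A_2$ has $\Lambda(X)=t_*\circ s^*$. Its composite with $A_2\xleftarrow{s'}X'\xrightarrow{t'}A_3$ is $A_1\xleftarrow{s\circ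 S}X'\circ X\xrightarrow{t'\circ T}A_3$, where $X'\circ X$ is the weak pullback: objects $(x,g,x')$ with $g:t(x)\to s'(x')$ in $A_2$, morphisms pairs $(h,k)$ with $s'(k)g_1=g_2t(h)$, and $S,T$ the projections to $X,X'$. The comparison isomorphism $$\beta_{X,X'}:\Lambda(X'\circ X)=(t'T)_*(sS)^*\to(t')_*(s')^*t_*s^*=\Lambda(X')\circ\Lambda(X)$$ is $(t')_*\gamma s^*$, where $\gamma:T_*S^*\to(s')^*t_*$ is given, for $F:X\to\mathrm{Vect}$ and $x'\in X'$, on the summand of the class of $(x,g,x')$ by $k\otimes v\mapsto s'(k)g\otimes v$ for $k\in\mathrm{Aut}(x')$, $v\in F(x)$. A strictly commuting span of span maps $Y:X_1\to X_2$, where $A_1\xleftarrow{s_i}X_i\xrightarrow{t_i}A_2$, is a span $X_1\xleftarrow{s}Y\xrightarrow{t}X_2$ with $s_1s=s_2t$ and $t_1s=t_2t$. Then $$\Lambda(Y)=\epsilon_{L,t}\circ\eta_{R,s}:(t_1)_*s_1^*\Rightarrow(t_1)_*s_*s^*s_1^*\cong(t_2)_*t_*t^*s_2^*\Rightarrow(t_2)_*s_2^*.$$ Given also a strictly commuting $X_1'\xleftarrow{s'}Y'\xrightarrow{t'}X_2'$, where $A_2\xleftarrow{s_i'}X_i'\xrightarrow{t_i'}A_3$, put $\tau=t_1s=t_2t:Y\to A_2$ and $\sigma'=s_1's'=s_2't':Y'\to A_2$. The horizontal composite $Y'\circ Y$ has as groupoid the weak pullback of $\tau$ and $\sigma'$,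 with objects $(y,f,y')$, $f:\tau(y)\to\sigma'(y')$ in $A_2$; its legs to $X_1'\circ X_1$ and $X_2'\circ X_2$ are $(y,f,y')\mapsto(s(y),f,s'(y'))$ and $(y,f,y')\mapsto(t(y),f,t'(y'))$. *)

theory Defs
  imports "HOL-Algebra.AbelCoset" "Jordan_Normal_Form.VS_Connect"
begin

section \<open>Groupoids and functors\<close>

text \<open>Composition is written in the order of application: \<open>Cmp C g f\<close> is \<open>g\<close> after \<open>f\<close>.
  Every arrow determines its domain and codomain, so distinct hom-sets are disjoint.\<close>

record ('o, 'm) cat =
  Obj :: "'o set"
  Arr :: "'m set"
  Dom :: "'m \<Rightarrow> 'o"
  Cod :: "'m \<Rightarrow> 'o"
  Idm :: "'o \<Rightarrow> 'm"
  Cmp :: "'m \<Rightarrow> 'm \<Rightarrow> 'm"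

definition Hom :: "('o, 'm) cat \<Rightarrow> 'o \<Rightarrow> 'o \<Rightarrow> 'm set" where
  "Hom C a b = {f \<in> Arr C. Dom C f = a \<and> Cod C f = b}"

locale category =
  fixes C :: "('o, 'm) cat"
  assumes Dom_Obj: "f \<in> Arr C \<Longrightarrow> Dom C f \<in> Obj C"
    and Cod_Obj: "f \<in> Arr C \<Longrightarrow> Cod C f \<in> Obj C"
    and Idm_Hom: "a \<in> Obj C \<Longrightarrow> Idm C a \<in> Hom C a a"
    and Cmp_Hom: "f \<in> Hom C a b \<Longrightarrow> g \<in> Hom C b c \<Longrightarrow> Cmp C g f \<in> Hom C a c"
    and Idm_left: "f \<in> Hom C a b \<Longrightarrow> Cmp C (Idm C b) f = f"
    and Idm_right: "f \<in> Hom C a b \<Longrightarrow> Cmp C f (Idm C a) = f"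
    and Cmp_assoc: "f \<in> Hom C a b \<Longrightarrow> g \<in> Hom C b c \<Longrightarrow> h \<in> Hom C c d \<Longrightarrow>
      Cmp C h (Cmp C g f) = Cmp C (Cmp C h g) f"

definition is_inverse :: "('o, 'm) cat \<Rightarrow> 'm \<Rightarrow> 'm \<Rightarrow> bool" where
  "is_inverse C f g \<longleftrightarrow> f \<in> Arr C \<and> g \<in> Hom C (Cod C f) (Dom C f) \<and>
     Cmp C g f = Idm C (Dom C f) \<and> Cmp C f g = Idm C (Cod C f)"

definition invertible_arr :: "('o, 'm) cat \<Rightarrow> 'm \<Rightarrow> bool" where
  "invertible_arr C f \<longleftrightarrow> (\<exists>g. is_inverse C f g)"

definition inv_arr :: "('o, 'm) cat \<Rightarrow> 'm \<Rightarrow> 'm" where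
  "inv_arr C f = (THE g. is_inverse C f g)"

definition isomorphic :: "('o, 'm) cat \<Rightarrow> 'o \<Rightarrow> 'o \<Rightarrow> bool" where
  "isomorphic C a b \<longleftrightarrow> a \<in> Obj C \<and> b \<in> Obj C \<and> (\<exists>f \<in> Hom C a b. invertible_arr C f)"

definition iso_classes :: "('o, 'm) cat \<Rightarrow> 'o set set" where
  "iso_classes C = Obj C // {(a, b). isomorphic C a b}"

locale groupoid = category +
  assumes all_invertible: "f \<in> Arr C \<Longrightarrow> invertible_arr C f"

record ('o, 'm, 'p, 'n) fctr =
  fdom :: "('o, 'm) cat"
  fcod :: "('p, 'n) cat"
  fob :: "'o \<Rightarrow> 'p"
  far :: "'m \<Rightarrow> 'n"

definition is_functor :: "('o, 'm, 'p, 'n) fctr \<Rightarrow> bool" where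
  "is_functor F \<longleftrightarrow> category (fdom F) \<and> category (fcod F) \<and>
     (\<forall>a \<in> Obj (fdom F). fob F a \<in> Obj (fcod F)) \<and>
     (\<forall>a b. \<forall>f \<in> Hom (fdom F) a b. far F f \<in> Hom (fcod F) (fob F a) (fob F b)) \<and>
     (\<forall>a \<in> Obj (fdom F). far F (Idm (fdom F) a) = Idm (fcod F) (fob F a)) \<and>
     (\<forall>a b c. \<forall>f \<in> Hom (fdom F) a b. \<forall>g \<in> Hom (fdom F) b c.
        far F (Cmp (fdom F) g f) = Cmp (fcod F) (far F g) (far F f))"

definition fid :: "('o, 'm) cat \<Rightarrow> ('o, 'm, 'o, 'm) fctr" where
  "fid C = \<lparr>fdom = C, fcod = C, fob = (\<lambda>a. a), far = (\<lambda>f. f)\<rparr>"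

definition fcomp :: "('p, 'n, 'q, 'l) fctr \<Rightarrow> ('o, 'm, 'p, 'n) fctr \<Rightarrow> ('o, 'm, 'q, 'l) fctr"
    (infixl \<open>\<circ>\<^sub>F\<close> 75) where
  "G \<circ>\<^sub>F F = \<lparr>fdom = fdom F, fcod = fcod G,
     fob = (\<lambda>a. fob G (fob F a)), far = (\<lambda>f. far G (far F f))\<rparr>"

text \<open>Strict equality of functors; values outside the domain category are immaterial.\<close>

definition functor_eq :: "('o, 'm, 'p, 'n) fctr \<Rightarrow> ('o, 'm, 'p, 'n) fctr \<Rightarrow> bool" where
  "functor_eq F G \<longleftrightarrow> fdom F = fdom G \<and> fcod F = fcod G \<and>
     (\<forall>a \<in> Obj (fdom F). fob F a = fob G a) \<and> (\<forall>f \<in> Arr (fdom F). far F f = far G f)"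

definition naturally_isomorphic :: "('o, 'm, 'p, 'n) fctr \<Rightarrow> ('o, 'm, 'p, 'n) fctr \<Rightarrow> bool" where
  "naturally_isomorphic F G \<longleftrightarrow> fdom F = fdom G \<and> fcod F = fcod G \<and>
     (\<exists>\<theta>. (\<forall>a \<in> Obj (fdom F). \<theta> a \<in> Hom (fcod F) (fob F a) (fob G a) \<and>
              invertible_arr (fcod F) (\<theta> a)) \<and>
          (\<forall>a b. \<forall>f \<in> Hom (fdom F) a b.
              Cmp (fcod F) (\<theta> b) (far F f) = Cmp (fcod F) (far G f) (\<theta> a)))"

definition equivalent :: "('o, 'm) cat \<Rightarrow> ('p, 'n) cat \<Rightarrow> bool" where
  "equivalent C D \<longleftrightarrow> (\<exists>F G. is_functor F \<and> is_functor G \<and>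
     fdom F = C \<and> fcod F = D \<and> fdom G = D \<and> fcod G = C \<and>
     naturally_isomorphic (G \<circ>\<^sub>F F) (fid C) \<and> naturally_isomorphic (F \<circ>\<^sub>F G) (fid D))"

text \<open>Every finite groupoid is isomorphic to one whose objects and arrows are natural numbers,
  so fixing these types in the existential quantifier loses nothing.\<close>

definition ess_finite_groupoid :: "('o, 'm) cat \<Rightarrow> bool" where
  "ess_finite_groupoid C \<longleftrightarrow> groupoid C \<and>
     (\<exists>D :: (nat, nat) cat. groupoid D \<and> finite (Obj D) \<and> finite (Arr D) \<and> equivalent C D)"

section \<open>Vector spaces and their colimits\<close>

definition fd_vectorspace :: "(complex, 'v) module \<Rightarrow> bool" where
  "fd_vectorspace V \<longleftrightarrow> vectorspace class_ring V \<and> vectorspace.fin_dim class_ring V"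

text \<open>Functors from \<open>vdom F\<close> to vector spaces. Linear maps are HOL functions whose values matter
  only on the carrier of their source.\<close>

record ('o, 'm, 'v) vfunctor =
  vdom :: "('o, 'm) cat"
  vob :: "'o \<Rightarrow> (complex, 'v) module"
  var :: "'m \<Rightarrow> 'v \<Rightarrow> 'v"

definition is_vfunctor :: "('o, 'm, 'v) vfunctor \<Rightarrow> bool" where
  "is_vfunctor F \<longleftrightarrow> category (vdom F) \<and>
     (\<forall>a \<in> Obj (vdom F). fd_vectorspace (vob F a)) \<and>
     (\<forall>a b. \<forall>f \<in> Hom (vdom F) a b. var F f \<in> LinearCombinations.module_hom class_ring (vob F a) (vob F b)) \<and>
     (\<forall>a \<in> Obj (vdom F). \<forall>v \<in> carrier (vob F a). var F (Idm (vdom F) a) v = v) \<and>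
     (\<forall>a b c. \<forall>f \<in> Hom (vdom F) a b. \<forall>g \<in> Hom (vdom F) b c. \<forall>v \<in> carrier (vob F a).
        var F (Cmp (vdom F) g f) v = var F g (var F f v))"

text \<open>\<open>[A, Vect]\<close>, with carriers in a given type.\<close>

definition vfunctors :: "('o, 'm) cat \<Rightarrow> ('o, 'm, 'v) vfunctor set" where
  "vfunctors A = {F. is_vfunctor F \<and> vdom F = A}"

text \<open>The direct sum of a family of modules, realised by the finitely supported families. The ring
  components \<open>mult\<close> and \<open>one\<close> of a module record carry no meaning.\<close>

definition dsum :: "'i set \<Rightarrow> ('i \<Rightarrow> (complex, 'v) module) \<Rightarrow> (complex, 'i \<Rightarrow> 'v) module" where
  "dsum I V = \<lparr>
     carrier = {\<phi> \<in> (\<Pi>\<^sub>E i \<in> I. carrier (V i)). finite {i \<in> I. \<phi> i \<noteq> \<zero>\<^bsub>V i\<^esub>}},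
     mult = (\<lambda>\<phi> \<psi>. \<lambda>i \<in> I. \<zero>\<^bsub>V i\<^esub>),
     one = (\<lambda>i \<in> I. \<zero>\<^bsub>V i\<^esub>),
     zero = (\<lambda>i \<in> I. \<zero>\<^bsub>V i\<^esub>),
     add = (\<lambda>\<phi> \<psi>. \<lambda>i \<in> I. \<phi> i \<oplus>\<^bsub>V i\<^esub> \<psi> i),
     smult = (\<lambda>c \<phi>. \<lambda>i \<in> I. c \<odot>\<^bsub>V i\<^esub> \<phi> i)\<rparr>"

definition dsum_in :: "'i set \<Rightarrow> ('i \<Rightarrow> (complex, 'v) module) \<Rightarrow> 'i \<Rightarrow> 'v \<Rightarrow> 'i \<Rightarrow> 'v" where
  "dsum_in I V i v = (\<lambda>j \<in> I. if j = i then v else \<zero>\<^bsub>V j\<^esub>)"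

definition quot_module :: "(complex, 'v) module \<Rightarrow> 'v set \<Rightarrow> (complex, 'v set) module" where
  "quot_module M N = \<lparr>
     carrier = a_rcosets\<^bsub>M\<^esub> N,
     mult = (\<lambda>X Y. N),
     one = N,
     zero = N,
     add = (\<lambda>X Y. X <+>\<^bsub>M\<^esub> Y),
     smult = (\<lambda>c X. \<Union>x \<in> X. N +>\<^bsub>M\<^esub> (c \<odot>\<^bsub>M\<^esub> x))\<rparr>"

text \<open>The colimit of a diagram \<open>D\<close>: the direct sum of all \<open>D j\<close> modulo the span of the
  elements \<open>v - D h v\<close> for \<open>h : i \<rightarrow> j\<close> and \<open>v\<close> in \<open>D i\<close>.\<close>

definition colim_rel :: "('o, 'm, 'v) vfunctor \<Rightarrow> ('o \<Rightarrow> 'v) set" where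
  "colim_rel D = LinearCombinations.module.span class_ring (dsum (Obj (vdom D)) (vob D))
     {dsum_in (Obj (vdom D)) (vob D) (Dom (vdom D) h) v
        \<ominus>\<^bsub>dsum (Obj (vdom D)) (vob D)\<^esub>
      dsum_in (Obj (vdom D)) (vob D) (Cod (vdom D) h) (var D h v)
      | h v. h \<in> Arr (vdom D) \<and> v \<in> carrier (vob D (Dom (vdom D) h))}"

definition colim :: "('o, 'm, 'v) vfunctor \<Rightarrow> (complex, ('o \<Rightarrow> 'v) set) module" where
  "colim D = quot_module (dsum (Obj (vdom D)) (vob D)) (colim_rel D)"

definition colim_in :: "('o, 'm, 'v) vfunctor \<Rightarrow> 'o \<Rightarrow> 'v \<Rightarrow> ('o \<Rightarrow> 'v) set" where
  "colim_in D j v =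
     colim_rel D +>\<^bsub>dsum (Obj (vdom D)) (vob D)\<^esub> dsum_in (Obj (vdom D)) (vob D) j v"

text \<open>The linear map \<open>colim D \<rightarrow> W\<close> induced by a cocone \<open>u\<close>, that is, the one sending
  \<open>colim_in D j v\<close> to \<open>u j v\<close>. For a cocone the choice of \<open>\<phi>\<close> in the coset is immaterial.\<close>

definition colim_desc ::
    "('o, 'm, 'v) vfunctor \<Rightarrow> (complex, 'w) module \<Rightarrow> ('o \<Rightarrow> 'v \<Rightarrow> 'w) \<Rightarrow> ('o \<Rightarrow> 'v) set \<Rightarrow> 'w" where
  "colim_desc D W u X = (let \<phi> = (SOME \<phi>. \<phi> \<in> X) in
     finsum W (\<lambda>j. u j (\<phi> j)) {j \<in> Obj (vdom D). \<phi> j \<noteq> \<zero>\<^bsub>vob D j\<^esub>})"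

section \<open>Pullback and pushforward along a functor\<close>

definition pull :: "('b, 'n, 'a, 'm) fctr \<Rightarrow> ('a, 'm, 'v) vfunctor \<Rightarrow> ('b, 'n, 'v) vfunctor" where
  "pull f F = \<lparr>vdom = fdom f, vob = (\<lambda>b. vob F (fob f b)), var = (\<lambda>h. var F (far f h))\<rparr>"

text \<open>The comma category of \<open>f : B \<rightarrow> A\<close> over \<open>a\<close>. An arrow \<open>h\<close> of \<open>B\<close> is tagged with its
  source and target in the comma category, which \<open>h\<close> alone does not determine.\<close>

definition comma :: "('b, 'n, 'a, 'm) fctr \<Rightarrow> 'a \<Rightarrow> ('b \<times> 'm, ('b \<times> 'm) \<times> 'n \<times> ('b \<times> 'm)) cat" where
  "comma f a = \<lparr>
     Obj = {(b, g). b \<in> Obj (fdom f) \<and> g \<in> Hom (fcod f) (fob f b) a},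
     Arr = {((b, g), h, (b', g')) | b g h b' g'.
              b \<in> Obj (fdom f) \<and> g \<in> Hom (fcod f) (fob f b) a \<and>
              b' \<in> Obj (fdom f) \<and> g' \<in> Hom (fcod f) (fob f b') a \<and>
              h \<in> Hom (fdom f) b b' \<and> Cmp (fcod f) g' (far f h) = g},
     Dom = (\<lambda>(p, h, q). p),
     Cod = (\<lambda>(p, h, q). q),
     Idm = (\<lambda>(b, g). ((b, g), Idm (fdom f) b, (b, g))),
     Cmp = (\<lambda>(q, h', r) (p, h, q'). (p, Cmp (fdom f) h' h, r))\<rparr>"

definition comma_proj ::
    "('b, 'n, 'a, 'm) fctr \<Rightarrow> 'a \<Rightarrow> ('b \<times> 'm, ('b \<times> 'm) \<times> 'n \<times> ('b \<times> 'm), 'b, 'n) fctr" where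
  "comma_proj f a = \<lparr>fdom = comma f a, fcod = fdom f,
     fob = (\<lambda>(b, g). b), far = (\<lambda>(p, h, q). h)\<rparr>"

abbreviation diag ::
    "('b, 'n, 'a, 'm) fctr \<Rightarrow> ('b, 'n, 'v) vfunctor \<Rightarrow> 'a \<Rightarrow>
     ('b \<times> 'm, ('b \<times> 'm) \<times> 'n \<times> ('b \<times> 'm), 'v) vfunctor" where
  "diag f G a \<equiv> pull (comma_proj f a) G"

text \<open>\<open>gen f G a (b, k) v\<close>, with \<open>k : f b \<rightarrow> a\<close>, is the element \<open>k \<otimes> v\<close> of the
  summand of \<open>(f\<^sub>* G) a\<close> belonging to the isomorphism class of \<open>b\<close>: the relations of the colimit
  are \<open>k' f(h) \<otimes> v = k' \<otimes> G(h) v\<close> for \<open>h : b \<rightarrow> b'\<close>. These identify the contributions of all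
  objects isomorphic to \<open>b\<close> and balance the tensor product over \<open>Aut(b)\<close>.\<close>

abbreviation gen ::
    "('b, 'n, 'a, 'm) fctr \<Rightarrow> ('b, 'n, 'v) vfunctor \<Rightarrow> 'a \<Rightarrow> 'b \<times> 'm \<Rightarrow> 'v \<Rightarrow> ('b \<times> 'm \<Rightarrow> 'v) set" where
  "gen f G a \<equiv> colim_in (diag f G a)"

definition push :: "('b, 'n, 'a, 'm) fctr \<Rightarrow> ('b, 'n, 'v) vfunctor \<Rightarrow>
    ('a, 'm, ('b \<times> 'm \<Rightarrow> 'v) set) vfunctor" where
  "push f G = \<lparr>
     vdom = fcod f,
     vob = (\<lambda>a. colim (diag f G a)),
     var = (\<lambda>u. colim_desc (diag f G (Dom (fcod f) u)) (colim (diag f G (Cod (fcod f) u)))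
                  (\<lambda>(b, k) v. gen f G (Cod (fcod f) u) (b, Cmp (fcod f) u k) v))\<rparr>"

text \<open>A natural transformation is given by its components \<open>\<alpha> a\<close>; the following is
  \<open>f\<^sub>* \<alpha> : f\<^sub>* G \<Rightarrow> f\<^sub>* G'\<close>.\<close>

definition push_map :: "('b, 'n, 'a, 'm) fctr \<Rightarrow> ('b, 'n, 'v) vfunctor \<Rightarrow> ('b, 'n, 'w) vfunctor \<Rightarrow>
    ('b \<Rightarrow> 'v \<Rightarrow> 'w) \<Rightarrow> 'a \<Rightarrow> ('b \<times> 'm \<Rightarrow> 'v) set \<Rightarrow> ('b \<times> 'm \<Rightarrow> 'w) set" where
  "push_map f G G' \<alpha> = (\<lambda>a. colim_desc (diag f G a) (vob (push f G') a)
     (\<lambda>(b, k) v. gen f G' a (b, k) (\<alpha> b v)))"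

definition counit_L ::
    "('b, 'n, 'a, 'm) fctr \<Rightarrow> ('a, 'm, 'v) vfunctor \<Rightarrow> 'a \<Rightarrow> ('b \<times> 'm \<Rightarrow> 'v) set \<Rightarrow> 'v" where
  "counit_L f F = (\<lambda>a. colim_desc (diag f (pull f F) a) (vob F a) (\<lambda>(b, k) v. var F k v))"

text \<open>The sum runs over isomorphism classes \<open>c\<close>, each represented by an arbitrary \<open>b \<in> c\<close>.\<close>

definition unit_R ::
    "('b, 'n, 'a, 'm) fctr \<Rightarrow> ('a, 'm, 'v) vfunctor \<Rightarrow> 'a \<Rightarrow> 'v \<Rightarrow> ('b \<times> 'm \<Rightarrow> 'v) set" where
  "unit_R f F = (\<lambda>a v. finsum (vob (push f (pull f F)) a)
     (\<lambda>c. let b = (SOME b. b \<in> c) in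
        (1 / of_nat (card (Hom (fdom f) b b))) \<odot>\<^bsub>vob (push f (pull f F)) a\<^esub>
        finsum (vob (push f (pull f F)) a)
          (\<lambda>g. gen f (pull f F) a (b, inv_arr (fcod f) g) (var F g v))
          (Hom (fcod f) a (fob f b)))
     {c \<in> iso_classes (fdom f). isomorphic (fcod f) (fob f (SOME b. b \<in> c)) a})"

text \<open>The canonical isomorphisms \<open>f\<^sub>* g\<^sub>* G \<cong> (f g)\<^sub>* G\<close>, \<open>k \<otimes> (h \<otimes> v) \<mapsto> k f(h) \<otimes> v\<close>, and its
  inverse \<open>k \<otimes> v \<mapsto> k \<otimes> (1 \<otimes> v)\<close>.\<close>

definition push_merge :: "('b, 'n, 'a, 'm) fctr \<Rightarrow> ('c, 'l, 'b, 'n) fctr \<Rightarrow> ('c, 'l, 'v) vfunctor \<Rightarrow>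
    'a \<Rightarrow> ('b \<times> 'm \<Rightarrow> ('c \<times> 'n \<Rightarrow> 'v) set) set \<Rightarrow> ('c \<times> 'm \<Rightarrow> 'v) set" where
  "push_merge f g G = (\<lambda>a. colim_desc (diag f (push g G) a) (vob (push (f \<circ>\<^sub>F g) G) a)
     (\<lambda>(b, k). colim_desc (diag g G b) (vob (push (f \<circ>\<^sub>F g) G) a)
        (\<lambda>(c, h) v. gen (f \<circ>\<^sub>F g) G a (c, Cmp (fcod f) k (far f h)) v)))"

definition push_split :: "('b, 'n, 'a, 'm) fctr \<Rightarrow> ('c, 'l, 'b, 'n) fctr \<Rightarrow> ('c, 'l, 'v) vfunctor \<Rightarrow>
    'a \<Rightarrow> ('c \<times> 'm \<Rightarrow> 'v) set \<Rightarrow> ('b \<times> 'm \<Rightarrow> ('c \<times> 'n \<Rightarrow> 'v) set) set" where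
  "push_split f g G = (\<lambda>a. colim_desc (diag (f \<circ>\<^sub>F g) G a) (vob (push f (push g G)) a)
     (\<lambda>(c, k) v. gen f (push g G) a (fob g c, k)
        (gen g G (fob g c) (c, Idm (fcod g) (fob g c)) v)))"

section \<open>Operations on natural transformations\<close>

definition vcomp :: "('a \<Rightarrow> 'w \<Rightarrow> 'x) \<Rightarrow> ('a \<Rightarrow> 'v \<Rightarrow> 'w) \<Rightarrow> 'a \<Rightarrow> 'v \<Rightarrow> 'x" (infixr \<open>\<cdot>\<^sub>v\<close> 70) where
  "\<alpha> \<cdot>\<^sub>v \<beta> = (\<lambda>a v. \<alpha> a (\<beta> a v))"

text \<open>The inverse of a natural isomorphism with source \<open>P\<close>.\<close>

definition nat_inv :: "('a, 'm, 'v) vfunctor \<Rightarrow> ('a \<Rightarrow> 'v \<Rightarrow> 'w) \<Rightarrow> 'a \<Rightarrow> 'w \<Rightarrow> 'v" where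
  "nat_inv P \<alpha> = (\<lambda>a. inv_into (carrier (vob P a)) (\<alpha> a))"

text \<open>Equality as natural transformations with source \<open>P\<close>: components are compared on carriers only.\<close>

definition nat_eq :: "('a, 'm, 'v) vfunctor \<Rightarrow> ('a \<Rightarrow> 'v \<Rightarrow> 'w) \<Rightarrow> ('a \<Rightarrow> 'v \<Rightarrow> 'w) \<Rightarrow> bool" where
  "nat_eq P \<alpha> \<beta> \<longleftrightarrow> (\<forall>a \<in> Obj (vdom P). \<forall>v \<in> carrier (vob P a). \<alpha> a v = \<beta> a v)"

text \<open>The horizontal composite of \<open>\<alpha> : P \<Rightarrow> Q\<close> and \<open>\<alpha>' : P' \<Rightarrow> Q'\<close>, where \<open>P, Q\<close> are functors
  between functor categories and \<open>P'map G G'\<close> is the action of \<open>P'\<close> on transformations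
  \<open>G \<Rightarrow> G'\<close>. Its component at \<open>F\<close> is \<open>\<alpha>'\<close> at \<open>Q F\<close> after \<open>P'\<close> applied to \<open>\<alpha>\<close> at \<open>F\<close>.\<close>

definition hcomp :: "('h \<Rightarrow> 'a \<Rightarrow> 'w \<Rightarrow> 'x) \<Rightarrow> ('g \<Rightarrow> 'h \<Rightarrow> 't \<Rightarrow> 'a \<Rightarrow> 'v \<Rightarrow> 'w) \<Rightarrow>
    ('f \<Rightarrow> 'g) \<Rightarrow> ('f \<Rightarrow> 'h) \<Rightarrow> ('f \<Rightarrow> 't) \<Rightarrow> 'f \<Rightarrow> 'a \<Rightarrow> 'v \<Rightarrow> 'x" where
  "hcomp \<alpha>' P'map P Q \<alpha> F = \<alpha>' (Q F) \<cdot>\<^sub>v P'map (P F) (Q F) (\<alpha> F)"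

section \<open>Spans and their linearization\<close>

record ('x, 'xm, 'a, 'am, 'b, 'bm) span =
  lleg :: "('x, 'xm, 'a, 'am) fctr"
  rleg :: "('x, 'xm, 'b, 'bm) fctr"

definition apex :: "('x, 'xm, 'a, 'am, 'b, 'bm) span \<Rightarrow> ('x, 'xm) cat" where
  "apex X = fdom (lleg X)"

definition is_span ::
    "('a, 'am) cat \<Rightarrow> ('b, 'bm) cat \<Rightarrow> ('x, 'xm, 'a, 'am, 'b, 'bm) span \<Rightarrow> bool" where
  "is_span A B X \<longleftrightarrow> is_functor (lleg X) \<and> is_functor (rleg X) \<and>
     fdom (rleg X) = apex X \<and> fcod (lleg X) = A \<and> fcod (rleg X) = B \<and>
     ess_finite_groupoid A \<and> ess_finite_groupoid B \<and> ess_finite_groupoid (apex X)"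

text \<open>A strictly commuting span of span maps from \<open>X\<^sub>1\<close> to \<open>X\<^sub>2\<close>.\<close>

definition is_span_map :: "('x, 'xm, 'a, 'am, 'b, 'bm) span \<Rightarrow> ('z, 'zm, 'a, 'am, 'b, 'bm) span \<Rightarrow>
    ('y, 'ym, 'x, 'xm, 'z, 'zm) span \<Rightarrow> bool" where
  "is_span_map X1 X2 Y \<longleftrightarrow> is_span (apex X1) (apex X2) Y \<and>
     functor_eq (lleg X1 \<circ>\<^sub>F lleg Y) (lleg X2 \<circ>\<^sub>F rleg Y) \<and>
     functor_eq (rleg X1 \<circ>\<^sub>F lleg Y) (rleg X2 \<circ>\<^sub>F rleg Y)"

text \<open>The weak pullback of \<open>f : X \<rightarrow> A\<close> and \<open>f' : X' \<rightarrow> A\<close>. As for comma categories, an arrow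
  \<open>(h, k)\<close> is tagged with its source and target.\<close>

type_synonym ('x, 'xm, 'am, 'z, 'zm) wpb_arr =
  "('x \<times> 'am \<times> 'z) \<times> ('xm \<times> 'zm) \<times> ('x \<times> 'am \<times> 'z)"

definition wpb :: "('x, 'xm, 'a, 'am) fctr \<Rightarrow> ('z, 'zm, 'a, 'am) fctr \<Rightarrow>
    ('x \<times> 'am \<times> 'z, ('x, 'xm, 'am, 'z, 'zm) wpb_arr) cat" where
  "wpb f f' = \<lparr>
     Obj = {(x, g, x'). x \<in> Obj (fdom f) \<and> x' \<in> Obj (fdom f') \<and>
              g \<in> Hom (fcod f) (fob f x) (fob f' x')},
     Arr = {((x\<^sub>1, g\<^sub>1, x\<^sub>1'), (h, k), (x\<^sub>2, g\<^sub>2, x\<^sub>2')) | x\<^sub>1 g\<^sub>1 x\<^sub>1' h k x\<^sub>2 g\<^sub>2 x\<^sub>2'.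
              g\<^sub>1 \<in> Hom (fcod f) (fob f x\<^sub>1) (fob f' x\<^sub>1') \<and>
              g\<^sub>2 \<in> Hom (fcod f) (fob f x\<^sub>2) (fob f' x\<^sub>2') \<and>
              h \<in> Hom (fdom f) x\<^sub>1 x\<^sub>2 \<and> k \<in> Hom (fdom f') x\<^sub>1' x\<^sub>2' \<and>
              Cmp (fcod f) (far f' k) g\<^sub>1 = Cmp (fcod f) g\<^sub>2 (far f h)},
     Dom = (\<lambda>(p, hk, q). p),
     Cod = (\<lambda>(p, hk, q). q),
     Idm = (\<lambda>(x, g, x'). ((x, g, x'), (Idm (fdom f) x, Idm (fdom f') x'), (x, g, x'))),
     Cmp = (\<lambda>(q, (h', k'), r) (p, (h, k), q').
              (p, (Cmp (fdom f) h' h, Cmp (fdom f') k' k), r))\<rparr>"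

definition wpb_left :: "('x, 'xm, 'a, 'am) fctr \<Rightarrow> ('z, 'zm, 'a, 'am) fctr \<Rightarrow>
    ('x \<times> 'am \<times> 'z, ('x, 'xm, 'am, 'z, 'zm) wpb_arr, 'x, 'xm) fctr" where
  "wpb_left f f' = \<lparr>fdom = wpb f f', fcod = fdom f,
     fob = (\<lambda>(x, g, x'). x), far = (\<lambda>(p, (h, k), q). h)\<rparr>"

definition wpb_right :: "('x, 'xm, 'a, 'am) fctr \<Rightarrow> ('z, 'zm, 'a, 'am) fctr \<Rightarrow>
    ('x \<times> 'am \<times> 'z, ('x, 'xm, 'am, 'z, 'zm) wpb_arr, 'z, 'zm) fctr" where
  "wpb_right f f' = \<lparr>fdom = wpb f f', fcod = fdom f',
     fob = (\<lambda>(x, g, x'). x'), far = (\<lambda>(p, (h, k), q). k)\<rparr>"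

definition span_comp :: "('z, 'zm, 'b, 'bm, 'c, 'cm) span \<Rightarrow> ('x, 'xm, 'a, 'am, 'b, 'bm) span \<Rightarrow>
    ('x \<times> 'bm \<times> 'z, ('x, 'xm, 'bm, 'z, 'zm) wpb_arr, 'a, 'am, 'c, 'cm) span"
    (infixl \<open>\<circ>\<^sub>S\<close> 75) where
  "X' \<circ>\<^sub>S X = \<lparr>lleg = lleg X \<circ>\<^sub>F wpb_left (rleg X) (lleg X'),
              rleg = rleg X' \<circ>\<^sub>F wpb_right (rleg X) (lleg X')\<rparr>"

definition wpb_map :: "('y \<times> 'am \<times> 'u, ('y, 'ym, 'am, 'u, 'um) wpb_arr) cat \<Rightarrow>
    ('x \<times> 'am \<times> 'z, ('x, 'xm, 'am, 'z, 'zm) wpb_arr) cat \<Rightarrow>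
    ('y, 'ym, 'x, 'xm) fctr \<Rightarrow> ('u, 'um, 'z, 'zm) fctr \<Rightarrow>
    ('y \<times> 'am \<times> 'u, ('y, 'ym, 'am, 'u, 'um) wpb_arr,
     'x \<times> 'am \<times> 'z, ('x, 'xm, 'am, 'z, 'zm) wpb_arr) fctr" where
  "wpb_map W W' p p' = \<lparr>fdom = W, fcod = W',
     fob = (\<lambda>(y, f, y'). (fob p y, f, fob p' y')),
     far = (\<lambda>((y\<^sub>1, f\<^sub>1, y\<^sub>1'), (h, k), (y\<^sub>2, f\<^sub>2, y\<^sub>2')).
              ((fob p y\<^sub>1, f\<^sub>1, fob p' y\<^sub>1'), (far p h, far p' k), (fob p y\<^sub>2, f\<^sub>2, fob p' y\<^sub>2')))\<rparr>"

text \<open>The apex is formed with \<open>\<tau> = t\<^sub>1 s\<close> and \<open>\<sigma>' = s\<^sub>1' s'\<close>, which by strict commutativity agree with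
  \<open>t\<^sub>2 t\<close> and \<open>s\<^sub>2' t'\<close>, so the right leg lands in \<open>X\<^sub>2' \<circ> X\<^sub>2\<close>.\<close>

definition span_map_hcomp ::
    "('x1, 'xm1, 'a, 'am, 'b, 'bm) span \<Rightarrow> ('x2, 'xm2, 'a, 'am, 'b, 'bm) span \<Rightarrow>
     ('z1, 'zm1, 'b, 'bm, 'c, 'cm) span \<Rightarrow> ('z2, 'zm2, 'b, 'bm, 'c, 'cm) span \<Rightarrow>
     ('u, 'um, 'z1, 'zm1, 'z2, 'zm2) span \<Rightarrow> ('y, 'ym, 'x1, 'xm1, 'x2, 'xm2) span \<Rightarrow>
     ('y \<times> 'bm \<times> 'u, ('y, 'ym, 'bm, 'u, 'um) wpb_arr,
      'x1 \<times> 'bm \<times> 'z1, ('x1, 'xm1, 'bm, 'z1, 'zm1) wpb_arr,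
      'x2 \<times> 'bm \<times> 'z2, ('x2, 'xm2, 'bm, 'z2, 'zm2) wpb_arr) span" where
  "span_map_hcomp X1 X2 X1' X2' Y' Y =
     (let W = wpb (rleg X1 \<circ>\<^sub>F lleg Y) (lleg X1' \<circ>\<^sub>F lleg Y') in
      \<lparr>lleg = wpb_map W (apex (X1' \<circ>\<^sub>S X1)) (lleg Y) (lleg Y'),
       rleg = wpb_map W (apex (X2' \<circ>\<^sub>S X2)) (rleg Y) (rleg Y')\<rparr>)"

text \<open>\<open>\<Lambda>(X)\<close> on objects and on morphisms of the functor category.\<close>

definition Lam :: "('x, 'xm, 'a, 'am, 'b, 'bm) span \<Rightarrow> ('a, 'am, 'v) vfunctor \<Rightarrow>
    ('b, 'bm, ('x \<times> 'bm \<Rightarrow> 'v) set) vfunctor" where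
  "Lam X F = push (rleg X) (pull (lleg X) F)"

definition Lam_map :: "('x, 'xm, 'a, 'am, 'b, 'bm) span \<Rightarrow>
    ('a, 'am, 'v) vfunctor \<Rightarrow> ('a, 'am, 'w) vfunctor \<Rightarrow> ('a \<Rightarrow> 'v \<Rightarrow> 'w) \<Rightarrow>
    'b \<Rightarrow> ('x \<times> 'bm \<Rightarrow> 'v) set \<Rightarrow> ('x \<times> 'bm \<Rightarrow> 'w) set" where
  "Lam_map X F F' \<alpha> = push_map (rleg X) (pull (lleg X) F) (pull (lleg X) F') (\<lambda>x. \<alpha> (fob (lleg X) x))"

text \<open>\<open>\<Lambda>(Y) : \<Lambda>(X\<^sub>1) \<Rightarrow> \<Lambda>(X\<^sub>2)\<close> at \<open>F\<close>. With \<open>s, t\<close> the legs of \<open>Y\<close>, the two middle factors are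
  \<open>(t\<^sub>1)\<^sub>* s\<^sub>* \<cong> (t\<^sub>1 s)\<^sub>* = (t\<^sub>2 t)\<^sub>* \<cong> (t\<^sub>2)\<^sub>* t\<^sub>*\<close>, applied to \<open>s\<^sup>* s\<^sub>1\<^sup>* F = t\<^sup>* s\<^sub>2\<^sup>* F\<close>.\<close>

definition Lam2 :: "('x1, 'xm1, 'a, 'am, 'b, 'bm) span \<Rightarrow> ('x2, 'xm2, 'a, 'am, 'b, 'bm) span \<Rightarrow>
    ('y, 'ym, 'x1, 'xm1, 'x2, 'xm2) span \<Rightarrow> ('a, 'am, 'v) vfunctor \<Rightarrow>
    'b \<Rightarrow> ('x1 \<times> 'bm \<Rightarrow> 'v) set \<Rightarrow> ('x2 \<times> 'bm \<Rightarrow> 'v) set" where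
  "Lam2 X1 X2 Y F =
     (let s = lleg Y; t = rleg Y; F1 = pull (lleg X1) F; F2 = pull (lleg X2) F in
        push_map (rleg X2) (push t (pull t F2)) F2 (counit_L t F2)
     \<cdot>\<^sub>v push_split (rleg X2) t (pull t F2)
     \<cdot>\<^sub>v push_merge (rleg X1) s (pull s F1)
     \<cdot>\<^sub>v push_map (rleg X1) F1 (push s (pull s F1)) (unit_R s F1))"

text \<open>\<open>\<gamma> : T\<^sub>* S\<^sup>* G \<Rightarrow> f'\<^sup>* f\<^sub>* G\<close> for the weak pullback of \<open>f\<close> and \<open>f'\<close> with projections \<open>S, T\<close>:
  \<open>k \<otimes> v \<mapsto> f'(k) g \<otimes> v\<close> on the contribution of \<open>(x, g, x'')\<close> at \<open>x'\<close>, for any \<open>k : x'' \<rightarrow> x'\<close>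
  (not only for \<open>x'' = x'\<close>, to which all others are identified in the colimit).\<close>

definition gamma :: "('x, 'xm, 'a, 'am) fctr \<Rightarrow> ('z, 'zm, 'a, 'am) fctr \<Rightarrow> ('x, 'xm, 'v) vfunctor \<Rightarrow>
    'z \<Rightarrow> (('x \<times> 'am \<times> 'z) \<times> 'zm \<Rightarrow> 'v) set \<Rightarrow> ('x \<times> 'am \<Rightarrow> 'v) set" where
  "gamma f f' G = (\<lambda>x'. colim_desc (diag (wpb_right f f') (pull (wpb_left f f') G) x')
     (vob (push f G) (fob f' x'))
     (\<lambda>((x, g, x''), k) v. gen f G (fob f' x') (x, Cmp (fcod f) (far f' k) g) v))"

text \<open>\<open>\<beta> : \<Lambda>(X' \<circ> X) \<rightarrow> \<Lambda>(X') \<circ> \<Lambda>(X)\<close> at \<open>F\<close>, including the canonical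
  \<open>(t' T)\<^sub>* \<cong> t'\<^sub>* T\<^sub>*\<close>.\<close>

definition beta :: "('x, 'xm, 'a, 'am, 'b, 'bm) span \<Rightarrow> ('z, 'zm, 'b, 'bm, 'c, 'cm) span \<Rightarrow>
    ('a, 'am, 'v) vfunctor \<Rightarrow> 'c \<Rightarrow> (('x \<times> 'bm \<times> 'z) \<times> 'cm \<Rightarrow> 'v) set \<Rightarrow>
    ('z \<times> 'cm \<Rightarrow> ('x \<times> 'bm \<Rightarrow> 'v) set) set" where
  "beta X X' F =
     (let S = wpb_left (rleg X) (lleg X'); T = wpb_right (rleg X) (lleg X');
          G = pull (lleg X) F in
        push_map (rleg X') (push T (pull S G)) (pull (lleg X') (push (rleg X) G))
          (gamma (rleg X) (lleg X') G)
     \<cdot>\<^sub>v push_split (rleg X') T (pull S G))"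

end

theory Submission
  imports Defs
begin

text \<open>All maps involved are linear on colimits, so both sides are compared on the generators
  \<open>k \<otimes> v\<close> of \<open>\<Lambda>(X\<^sub>1' \<circ> X\<^sub>1)(F)\<close>, after applying \<open>\<beta>\<close> of \<open>X\<^sub>2, X\<^sub>2'\<close>, which is injective.
  On generators, \<open>\<Lambda>(Y)\<close> is the groupoid sum over \<open>y\<close>, weighted by \<open>1 / #Aut(y)\<close>, of
  \<open>k \<otimes> v \<mapsto> \<Sum>g : x \<rightarrow> s(y). k t\<^sub>1(g)\<inverse> \<otimes> F(s\<^sub>1(g)) v\<close> at \<open>t(y)\<close>. The interchange law thereby becomes
  a Fubini theorem for sums over the weak pullback of \<open>Y\<close> and \<open>Y'\<close>. To avoid counting orbits and
  stabilizers, an isomorphism-invariant function is summed over any finite family \<open>S\<close> of objects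
  meeting all isomorphism classes, weighting \<open>b\<close> by the reciprocal of the number of arrows from \<open>b\<close>
  into \<open>S\<close>: families \<open>S, S'\<close> for \<open>Y, Y'\<close> induce the family of all \<open>(y, q, y')\<close> with \<open>y \<in> S\<close>,
  \<open>y' \<in> S'\<close>, and its weights are products, because arrows \<open>y \<rightarrow> y\<^sub>1\<close> and \<open>y' \<rightarrow> y\<^sub>1'\<close> determine the
  middle arrow of their target.\<close>

section \<open>Modules over the complex numbers and colimits\<close>

text \<open>The unit sums over isomorphism classes with arbitrarily chosen representatives, and this
  choice is the obstacle: representatives of \<open>Y\<close> and \<open>Y'\<close> do not combine
  into representatives of the weak pullback, whose classes over a fixed pair of representatives
  \<open>y\<close>, \<open>y'\<close> are the orbits of Aut(y) and Aut(y') acting on the hom-set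
  from \<tau>(y) to \<sigma>'(y'). The weights come from groupoid cardinality: if a family meets a
  class in n objects, each of them has n #Aut arrows into the family, and n summands of weight 1 /
  (n #Aut) restore 1 / #Aut whatever n is. Hence the unit may be computed with any covering family,
  in particular with the induced one for the composite. The canonical isomorphism between the
  pushforwards along \<open>t1 s\<close> and \<open>t2 t\<close> never has to be carried along:
  colimits are explicit quotients that depend only on the values of the functors on their domain, so
  strict commutativity makes the two pushforwards equal.\<close>

abbreviation cmod :: "(complex, 'v) module \<Rightarrow> bool" where
  "cmod V \<equiv> Module.module class_ring V"

abbreviation lmap :: "(complex, 'v) module \<Rightarrow> (complex, 'w) module \<Rightarrow> ('v \<Rightarrow> 'w) set" where
  "lmap V W \<equiv> LinearCombinations.module_hom class_ring V W"

lemma cring_complex: "cring (class_ring :: complex ring)"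
proof -
  interpret f: Ring.field "class_ring :: complex ring" by (rule class_field)
  show ?thesis ..
qed

lemma cmod_abelian_group: "cmod V \<Longrightarrow> abelian_group V"
  by (simp add: Module.module_def)

lemma lmapI:
  assumes "\<And>v. v \<in> carrier V \<Longrightarrow> f v \<in> carrier W"
    and "\<And>v w. v \<in> carrier V \<Longrightarrow> w \<in> carrier V \<Longrightarrow> f (v \<oplus>\<^bsub>V\<^esub> w) = f v \<oplus>\<^bsub>W\<^esub> f w"
    and "\<And>c v. v \<in> carrier V \<Longrightarrow> f (c \<odot>\<^bsub>V\<^esub> v) = c \<odot>\<^bsub>W\<^esub> f v"
  shows "f \<in> lmap V W"
  using assms by (auto simp: LinearCombinations.module_hom_def)

lemma lmap_closed: "f \<in> lmap V W \<Longrightarrow> v \<in> carrier V \<Longrightarrow> f v \<in> carrier W"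
  by (auto simp: LinearCombinations.module_hom_def)

lemma lmap_add: "f \<in> lmap V W \<Longrightarrow> v \<in> carrier V \<Longrightarrow> w \<in> carrier V \<Longrightarrow> f (v \<oplus>\<^bsub>V\<^esub> w) = f v \<oplus>\<^bsub>W\<^esub> f w"
  by (auto simp: LinearCombinations.module_hom_def)

lemma lmap_smult: "f \<in> lmap V W \<Longrightarrow> v \<in> carrier V \<Longrightarrow> f (c \<odot>\<^bsub>V\<^esub> v) = c \<odot>\<^bsub>W\<^esub> f v"
  by (auto simp: LinearCombinations.module_hom_def)

lemma lmap_comp: "f \<in> lmap U V \<Longrightarrow> g \<in> lmap V W \<Longrightarrow> (\<lambda>x. g (f x)) \<in> lmap U W"
  by (auto simp: LinearCombinations.module_hom_def Pi_iff)

text \<open>Linear maps are total functions that matter only on carriers, so a map such as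
  \<open>unit_R\<close> is shown linear by comparison with a formula valid on the carrier.\<close>

lemma lmap_cong:
  assumes "cmod V" and f: "f \<in> lmap V W" and eq: "\<And>v. v \<in> carrier V \<Longrightarrow> g v = f v"
  shows "g \<in> lmap V W"
proof -
  interpret V: Module.module "class_ring :: complex ring" V by fact
  show ?thesis
    by (rule lmapI)
      (use lmap_closed[OF f] lmap_add[OF f] lmap_smult[OF f] V.smult_closed in \<open>simp_all add: eq\<close>)
qed

text \<open>Infinite index sets are included: there \<open>finsum\<close> is zero by convention, and
  linear maps preserve zero.\<close>

lemma lmap_finsum:
  assumes "cmod V" "cmod W" "f \<in> lmap V W" "\<And>i. i \<in> I \<Longrightarrow> x i \<in> carrier V"
  shows "f (finsum V x I) = finsum W (\<lambda>i. f (x i)) I"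
proof -
  interpret V: Module.module "class_ring :: complex ring" V by fact
  interpret W: Module.module "class_ring :: complex ring" W by fact
  have zero: "f \<zero>\<^bsub>V\<^esub> = \<zero>\<^bsub>W\<^esub>"
    using lmap_smult[OF assms(3) V.zero_closed, of 0] lmap_closed[OF assms(3) V.zero_closed]
      V.smult_l_null[of "\<zero>\<^bsub>V\<^esub>"] W.smult_l_null[of "f \<zero>\<^bsub>V\<^esub>"] by simp
  show ?thesis using assms(4)
  proof (induction I rule: infinite_finite_induct)
    case (insert i I)
    then show ?case
      by (simp add: Pi_def lmap_add[OF assms(3)] lmap_closed[OF assms(3)])
  qed (simp_all add: zero)
qed

lemma lmap_zero: "cmod V \<Longrightarrow> cmod W \<Longrightarrow> f \<in> lmap V W \<Longrightarrow> f \<zero>\<^bsub>V\<^esub> = \<zero>\<^bsub>W\<^esub>"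
  using lmap_finsum[of V W f "{}"] abelian_monoid.finsum_empty
  by (metis abelian_group.axioms(1) cmod_abelian_group empty_iff)

text \<open>Apart from the existence of negatives the module axioms are equations, so they pass to
  the image of a surjection that respects the operations. It is applied to the coset map, whose
  target is not yet known to be a module.\<close>

lemma cmod_surj_image:
  assumes "cmod M" and carr: "carrier Q = q ` carrier M"
    and add: "\<And>x y. x \<in> carrier M \<Longrightarrow> y \<in> carrier M \<Longrightarrow> q x \<oplus>\<^bsub>Q\<^esub> q y = q (x \<oplus>\<^bsub>M\<^esub> y)"
    and smult: "\<And>c x. x \<in> carrier M \<Longrightarrow> c \<odot>\<^bsub>Q\<^esub> q x = q (c \<odot>\<^bsub>M\<^esub> x)"
    and zero: "\<zero>\<^bsub>Q\<^esub> = q \<zero>\<^bsub>M\<^esub>"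
  shows "cmod Q"
proof -
  interpret M: Module.module "class_ring :: complex ring" M by fact
  show ?thesis
  proof (rule moduleI[OF cring_complex])
    show "abelian_group Q"
    proof (rule abelian_groupI)
      fix x assume "x \<in> carrier Q"
      then obtain u where u: "u \<in> carrier M" "x = q u" by (auto simp: carr)
      then have "q (\<ominus>\<^bsub>M\<^esub> u) \<oplus>\<^bsub>Q\<^esub> x = \<zero>\<^bsub>Q\<^esub>" by (simp add: add zero M.l_neg)
      then show "\<exists>y\<in>carrier Q. y \<oplus>\<^bsub>Q\<^esub> x = \<zero>\<^bsub>Q\<^esub>" using u carr by blast
    qed (auto simp: carr add zero M.a_ac)
  qed (auto simp: carr add smult M.smult_l_distr[simplified] M.smult_r_distr
       M.smult_assoc1[simplified] M.smult_one[simplified] M.smult_closed[simplified])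
qed

section \<open>Direct sums and their universal property\<close>

context
  fixes I :: "'i set" and V :: "'i \<Rightarrow> (complex, 'v) module"
  assumes V: "\<And>i. i \<in> I \<Longrightarrow> cmod (V i)"
begin

private lemma V_group: "i \<in> I \<Longrightarrow> abelian_group (V i)"
  using V cmod_abelian_group by blast

private lemma V_monoid: "i \<in> I \<Longrightarrow> abelian_monoid (V i)"
  using V_group by (simp add: abelian_group_def)

private lemma V_smult_zero: "i \<in> I \<Longrightarrow> c \<odot>\<^bsub>V i\<^esub> \<zero>\<^bsub>V i\<^esub> = \<zero>\<^bsub>V i\<^esub>"
  using Module.module.smult_r_null[OF V] by simp

private lemma V_smult: "i \<in> I \<Longrightarrow> v \<in> carrier (V i) \<Longrightarrow> c \<odot>\<^bsub>V i\<^esub> v \<in> carrier (V i)"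
  using Module.module.smult_closed[OF V] by simp

lemma dsum_cmod: "cmod (dsum I V)"
proof -
  have fin_add: "finite {i \<in> I. (if i \<in> I then \<phi> i \<oplus>\<^bsub>V i\<^esub> \<psi> i else undefined) \<noteq> \<zero>\<^bsub>V i\<^esub>}"
    if "finite {i \<in> I. \<phi> i \<noteq> \<zero>\<^bsub>V i\<^esub>}" "finite {i \<in> I. \<psi> i \<noteq> \<zero>\<^bsub>V i\<^esub>}" for \<phi> \<psi>
    by (rule finite_subset[OF _ finite_UnI[OF that]])
      (auto simp: abelian_monoid.l_zero[OF V_monoid] abelian_monoid.zero_closed[OF V_monoid])
  have fin_smult: "finite {i \<in> I. (if i \<in> I then c \<odot>\<^bsub>V i\<^esub> \<phi> i else undefined) \<noteq> \<zero>\<^bsub>V i\<^esub>}"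
    if "finite {i \<in> I. \<phi> i \<noteq> \<zero>\<^bsub>V i\<^esub>}" for \<phi> c
    by (rule finite_subset[OF _ that]) (auto simp: V_smult_zero)
  have neg_zero: "\<ominus>\<^bsub>V i\<^esub> \<zero>\<^bsub>V i\<^esub> = \<zero>\<^bsub>V i\<^esub>" if "i \<in> I" for i
    proof -
    interpret abelian_group "V i" using V_group that .
    show ?thesis by simp
  qed
  have group: "abelian_group (dsum I V)"
  proof (rule abelian_groupI)
    fix \<phi> assume \<phi>: "\<phi> \<in> carrier (dsum I V)"
    let ?\<psi> = "\<lambda>i\<in>I. \<ominus>\<^bsub>V i\<^esub> \<phi> i"
    have "?\<psi> \<in> carrier (dsum I V)"
      using \<phi> by (auto simp: dsum_def PiE_iff abelian_group.a_inv_closed[OF V_group]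
          elim!: rev_finite_subset)
        (simp add: neg_zero)
    moreover have "?\<psi> \<oplus>\<^bsub>dsum I V\<^esub> \<phi> = \<zero>\<^bsub>dsum I V\<^esub>"
      using \<phi> by (auto simp: dsum_def PiE_iff abelian_group.l_neg[OF V_group])
    ultimately show "\<exists>\<psi>\<in>carrier (dsum I V). \<psi> \<oplus>\<^bsub>dsum I V\<^esub> \<phi> = \<zero>\<^bsub>dsum I V\<^esub>" by blast
  qed (auto simp: dsum_def PiE_iff extensional_def fin_add restrict_def fun_eq_iff
      abelian_monoid.a_closed[OF V_monoid] abelian_monoid.a_assoc[OF V_monoid]
      abelian_monoid.a_comm[OF V_monoid] abelian_monoid.a_lcomm[OF V_monoid]
      abelian_monoid.l_zero[OF V_monoid] abelian_monoid.r_zero[OF V_monoid]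
      abelian_monoid.zero_closed[OF V_monoid])
  show ?thesis
    by (rule moduleI[OF cring_complex group])
      (auto simp: dsum_def PiE_iff extensional_def fin_smult restrict_def fun_eq_iff V_smult
      Module.module.smult_l_distr[OF V, simplified] Module.module.smult_r_distr[OF V]
      Module.module.smult_assoc1[OF V, simplified] Module.module.smult_one[OF V, simplified])
qed

lemma dsum_proj_lmap: "i \<in> I \<Longrightarrow> (\<lambda>\<phi>. \<phi> i) \<in> lmap (dsum I V) (V i)"
  by (rule lmapI) (auto simp: dsum_def)

lemma dsum_in_lmap: "i \<in> I \<Longrightarrow> dsum_in I V i \<in> lmap (V i) (dsum I V)"
proof (rule lmapI)
  fix v assume i: "i \<in> I" "v \<in> carrier (V i)"
  have "{j \<in> I. dsum_in I V i v j \<noteq> \<zero>\<^bsub>V j\<^esub>} \<subseteq> {i}" by (auto simp: dsum_in_def)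
  then have "finite {j \<in> I. dsum_in I V i v j \<noteq> \<zero>\<^bsub>V j\<^esub>}" by (rule finite_subset) simp
  then show "dsum_in I V i v \<in> carrier (dsum I V)"
    using i by (auto simp: dsum_def dsum_in_def abelian_monoid.zero_closed[OF V_monoid])
qed (auto simp: dsum_def dsum_in_def restrict_def fun_eq_iff V_smult_zero
    abelian_monoid.l_zero[OF V_monoid] abelian_monoid.zero_closed[OF V_monoid])

text \<open>Coordinate \<open>j\<close> of the sum receives a contribution only from the summand of
  index \<open>j\<close>; if \<open>\<phi> j\<close> vanishes there is no such summand and both
  sides are zero.\<close>

lemma dsum_finsum:
  assumes \<phi>: "\<phi> \<in> carrier (dsum I V)"
  shows "\<phi> = finsum (dsum I V) (\<lambda>i. dsum_in I V i (\<phi> i)) {i \<in> I. \<phi> i \<noteq> \<zero>\<^bsub>V i\<^esub>}"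
    (is "\<phi> = finsum ?S ?f ?K")
proof (rule PiE_ext)
  have fin: "finite ?K" and cl: "\<And>i. i \<in> I \<Longrightarrow> \<phi> i \<in> carrier (V i)"
    using \<phi> by (auto simp: dsum_def)
  have f: "\<And>i. i \<in> ?K \<Longrightarrow> ?f i \<in> carrier ?S"
    using lmap_closed[OF dsum_in_lmap] cl by simp
  show "\<phi> \<in> (\<Pi>\<^sub>E i\<in>I. carrier (V i))" using \<phi> by (simp add: dsum_def)
  have "finsum ?S ?f ?K \<in> carrier ?S"
    using f cmod_abelian_group[OF dsum_cmod] abelian_monoid.finsum_closed
    by (metis (no_types, lifting) Pi_I abelian_group_def)
  then show "finsum ?S ?f ?K \<in> (\<Pi>\<^sub>E i\<in>I. carrier (V i))" by (simp add: dsum_def)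
  fix j assume j: "j \<in> I"
  interpret Vj: abelian_group "V j" using V_group j by blast
  have "finsum ?S ?f ?K j = finsum (V j) (\<lambda>i. ?f i j) ?K"
    using lmap_finsum[OF dsum_cmod V[OF j] dsum_proj_lmap[OF j], of ?K ?f] f by simp
  also have "\<dots> = finsum (V j) (\<lambda>i. if j = i then \<phi> j else \<zero>\<^bsub>V j\<^esub>) ?K"
    by (rule Vj.finsum_cong') (auto simp: dsum_in_def j cl)
  also have "\<dots> = \<phi> j"
  proof (cases "j \<in> ?K")
    case True
    show ?thesis
      by (rule Vj.add.finprod_singleton[OF True fin, of "\<lambda>_. \<phi> j"]) (simp add: cl j)
  next
    case False
    then have "finsum (V j) (\<lambda>i. if j = i then \<phi> j else \<zero>\<^bsub>V j\<^esub>) ?K = \<zero>\<^bsub>V j\<^esub>"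
      by (intro Vj.add.finprod_one_eqI) auto
    then show ?thesis using False j by auto
  qed
  finally show "\<phi> j = finsum ?S ?f ?K j" by simp
qed

lemma dsum_lift:
  assumes "cmod W" and u: "\<And>i. i \<in> I \<Longrightarrow> u i \<in> lmap (V i) W"
  defines "L \<equiv> \<lambda>\<phi>. finsum W (\<lambda>j. u j (\<phi> j)) {j \<in> I. \<phi> j \<noteq> \<zero>\<^bsub>V j\<^esub>}"
  shows "L \<in> lmap (dsum I V) W"
    and "\<And>i v. i \<in> I \<Longrightarrow> v \<in> carrier (V i) \<Longrightarrow> L (dsum_in I V i v) = u i v"
proof -
  interpret W: Module.module "class_ring :: complex ring" W by fact
  have u0: "u j \<zero>\<^bsub>V j\<^esub> = \<zero>\<^bsub>W\<^esub>" if "j \<in> I" for j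
    using lmap_zero[OF V[OF that] assms(1) u[OF that]] .
  \<comment> \<open>The support varies with \<open>\<phi>\<close>. Any finite superset may replace
    it, since the added terms \<open>u j 0\<close> vanish; additivity is then checked over the union
    of two supports.\<close>
  have L_K: "L \<phi> = finsum W (\<lambda>j. u j (\<phi> j)) K"
    if "\<phi> \<in> carrier (dsum I V)" "finite K" "K \<subseteq> I" "{j \<in> I. \<phi> j \<noteq> \<zero>\<^bsub>V j\<^esub>} \<subseteq> K" for \<phi> K
    unfolding L_def
    by (rule W.add.finprod_mono_neutral_cong_left)
      (use that u0 lmap_closed[OF u] in \<open>auto simp: dsum_def subset_eq PiE_iff\<close>)
  show "L \<in> lmap (dsum I V) W"
  proof (rule lmapI)
    fix \<phi> assume \<phi>: "\<phi> \<in> carrier (dsum I V)"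
    then have cl: "\<phi> j \<in> carrier (V j)" if "j \<in> I" for j using that by (auto simp: dsum_def)
    show "L \<phi> \<in> carrier W"
      unfolding L_def by (rule W.finsum_closed) (use lmap_closed[OF u] cl in auto)
    show "L (c \<odot>\<^bsub>dsum I V\<^esub> \<phi>) = c \<odot>\<^bsub>W\<^esub> L \<phi>" for c
    proof -
      let ?K = "{j \<in> I. \<phi> j \<noteq> \<zero>\<^bsub>V j\<^esub>}"
      have fin: "finite ?K" using \<phi> by (simp add: dsum_def)
      have "c \<odot>\<^bsub>dsum I V\<^esub> \<phi> \<in> carrier (dsum I V)"
        using Module.module.smult_closed[OF dsum_cmod] \<phi> by simp
      then have "L (c \<odot>\<^bsub>dsum I V\<^esub> \<phi>) = finsum W (\<lambda>j. u j ((c \<odot>\<^bsub>dsum I V\<^esub> \<phi>) j)) ?K"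
        by (rule L_K) (use fin in \<open>auto simp: dsum_def V_smult_zero\<close>)
      also have "\<dots> = finsum W (\<lambda>j. c \<odot>\<^bsub>W\<^esub> u j (\<phi> j)) ?K"
        by (rule W.finsum_cong')
          (auto simp: dsum_def lmap_smult[OF u] cl lmap_closed[OF u])
      also have "\<dots> = c \<odot>\<^bsub>W\<^esub> L \<phi>"
        unfolding L_def using fin cl lmap_closed[OF u]
        by (subst W.finsum_smult_ldistr) auto
      finally show ?thesis .
    qed
    fix \<psi> assume \<psi>: "\<psi> \<in> carrier (dsum I V)"
    then have cl': "\<psi> j \<in> carrier (V j)" if "j \<in> I" for j using that by (auto simp: dsum_def)
    let ?K = "{j \<in> I. \<phi> j \<noteq> \<zero>\<^bsub>V j\<^esub>} \<union> {j \<in> I. \<psi> j \<noteq> \<zero>\<^bsub>V j\<^esub>}"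
    have fin: "finite ?K" using \<phi> \<psi> by (simp add: dsum_def)
    have "\<phi> \<oplus>\<^bsub>dsum I V\<^esub> \<psi> \<in> carrier (dsum I V)"
      using abelian_monoid.a_closed[OF abelian_group.axioms(1)[OF cmod_abelian_group[OF dsum_cmod]]]
        \<phi> \<psi> by blast
    then have "L (\<phi> \<oplus>\<^bsub>dsum I V\<^esub> \<psi>) = finsum W (\<lambda>j. u j ((\<phi> \<oplus>\<^bsub>dsum I V\<^esub> \<psi>) j)) ?K"
      by (rule L_K)
        (use fin in \<open>auto simp: dsum_def abelian_monoid.l_zero[OF V_monoid]
          abelian_monoid.zero_closed[OF V_monoid]\<close>)
    also have "\<dots> = finsum W (\<lambda>j. u j (\<phi> j) \<oplus>\<^bsub>W\<^esub> u j (\<psi> j)) ?K"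
      by (rule W.finsum_cong')
        (auto simp: dsum_def lmap_add[OF u] cl cl' lmap_closed[OF u])
    also have "\<dots> = finsum W (\<lambda>j. u j (\<phi> j)) ?K \<oplus>\<^bsub>W\<^esub> finsum W (\<lambda>j. u j (\<psi> j)) ?K"
      by (rule W.finsum_addf) (use lmap_closed[OF u] cl cl' in auto)
    also have "\<dots> = L \<phi> \<oplus>\<^bsub>W\<^esub> L \<psi>"
      using L_K[OF \<phi> fin] L_K[OF \<psi> fin] by auto
    finally show "L (\<phi> \<oplus>\<^bsub>dsum I V\<^esub> \<psi>) = L \<phi> \<oplus>\<^bsub>W\<^esub> L \<psi>" .
  qed
  fix i v assume i: "i \<in> I" "v \<in> carrier (V i)"
  have "L (dsum_in I V i v) = finsum W (\<lambda>j. u j (dsum_in I V i v j)) {i}"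
    by (rule L_K) (use i lmap_closed[OF dsum_in_lmap] in \<open>auto simp: dsum_in_def\<close>)
  also have "\<dots> = u i v"
    using i lmap_closed[OF u] by (simp add: dsum_in_def)
  finally show "L (dsum_in I V i v) = u i v" .
qed

end

section \<open>Quotients by submodules\<close>

lemma quot_module_cmod_lmap:
  assumes "cmod M" and N: "LinearCombinations.submodule class_ring N M"
  shows "cmod (quot_module M N)" (is "cmod ?Q")
    and "(\<lambda>x. N +>\<^bsub>M\<^esub> x) \<in> lmap M (quot_module M N)"
    and "carrier (quot_module M N) = (\<lambda>x. N +>\<^bsub>M\<^esub> x) ` carrier M"
    and "\<And>x y. x \<in> carrier M \<Longrightarrow> y \<in> carrier M \<Longrightarrow> x \<ominus>\<^bsub>M\<^esub> y \<in> N \<Longrightarrow> N +>\<^bsub>M\<^esub> x = N +>\<^bsub>M\<^esub> y"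
    and "\<And>x y. x \<in> carrier M \<Longrightarrow> y \<in> N +>\<^bsub>M\<^esub> x \<Longrightarrow> y \<in> carrier M \<and> y \<ominus>\<^bsub>M\<^esub> x \<in> N"
    and "\<And>x. x \<in> carrier M \<Longrightarrow> x \<in> N +>\<^bsub>M\<^esub> x"
proof -
  interpret M: Module.module "class_ring :: complex ring" M by fact
  note NS = LinearCombinations.submodule.subset[OF N] LinearCombinations.submodule.m_closed[OF N]
    LinearCombinations.submodule.zero_closed[OF N] LinearCombinations.submodule.smult_closed[OF N]
  have neg: "\<ominus>\<^bsub>M\<^esub> x \<in> N" if "x \<in> N" for x
  proof -
    have "\<ominus>\<^bsub>M\<^esub> x = (-1) \<odot>\<^bsub>M\<^esub> x"
      using M.smult_l_minus[of 1 x] that NS(1) M.smult_one[of x]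
      by (auto simp: class_ring_simps)
    then show ?thesis using NS(4) that by simp
  qed
  have "subgroup N (add_monoid M)"
    by (rule group.subgroupI[OF M.a_group])
      (use NS neg in \<open>auto simp: a_inv_def[symmetric]\<close>)
  then interpret N: abelian_subgroup N M
    by (intro abelian_subgroupI3 additive_subgroupI M.abelian_group_axioms)
  show eqI: "N +>\<^bsub>M\<^esub> x = N +>\<^bsub>M\<^esub> y" if "x \<in> carrier M" "y \<in> carrier M" "x \<ominus>\<^bsub>M\<^esub> y \<in> N" for x y
    using N.a_rcos_module[of y x] that N.a_repr_independence'[of x y]
    by (metis M.minus_eq N.a_subgroup M.a_repr_independence)
  show mem: "y \<in> carrier M \<and> y \<ominus>\<^bsub>M\<^esub> x \<in> N" if "x \<in> carrier M" "y \<in> N +>\<^bsub>M\<^esub> x" for x y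
    using N.a_rcos_module_imp[of x y] that M.a_r_coset_subset_G[of N x] NS(1)
    by (auto simp: M.minus_eq)
  show self: "x \<in> N +>\<^bsub>M\<^esub> x" if "x \<in> carrier M" for x
    using N.a_rcos_self that .
  show carr: "carrier ?Q = (\<lambda>x. N +>\<^bsub>M\<^esub> x) ` carrier M"
    by (auto simp: quot_module_def A_RCOSETS_def')
  have add: "(N +>\<^bsub>M\<^esub> x) \<oplus>\<^bsub>?Q\<^esub> (N +>\<^bsub>M\<^esub> y) = N +>\<^bsub>M\<^esub> (x \<oplus>\<^bsub>M\<^esub> y)"
    if "x \<in> carrier M" "y \<in> carrier M" for x y
    using N.a_rcos_sum that by (simp add: quot_module_def)
  \<comment> \<open>Scalar multiplication in \<open>quot_module\<close> is a union of cosets over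
    all representatives \<open>y\<close>; these cosets coincide because
    \<open>c y - c x = c (y - x)\<close> lies in \<open>N\<close>.\<close>
  have smult: "c \<odot>\<^bsub>?Q\<^esub> (N +>\<^bsub>M\<^esub> x) = N +>\<^bsub>M\<^esub> (c \<odot>\<^bsub>M\<^esub> x)" if x: "x \<in> carrier M" for c x
  proof -
    have "N +>\<^bsub>M\<^esub> (c \<odot>\<^bsub>M\<^esub> y) = N +>\<^bsub>M\<^esub> (c \<odot>\<^bsub>M\<^esub> x)" if "y \<in> N +>\<^bsub>M\<^esub> x" for y
    proof (rule eqI)
      have y: "y \<in> carrier M" "y \<ominus>\<^bsub>M\<^esub> x \<in> N" using mem[OF x that] by auto
      show "c \<odot>\<^bsub>M\<^esub> y \<in> carrier M" "c \<odot>\<^bsub>M\<^esub> x \<in> carrier M"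
        using x y M.smult_closed[of c] by auto
      have "c \<odot>\<^bsub>M\<^esub> y \<ominus>\<^bsub>M\<^esub> c \<odot>\<^bsub>M\<^esub> x = c \<odot>\<^bsub>M\<^esub> (y \<ominus>\<^bsub>M\<^esub> x)"
        using x y by (simp add: M.minus_eq M.smult_r_distr M.smult_r_minus)
      then show "c \<odot>\<^bsub>M\<^esub> y \<ominus>\<^bsub>M\<^esub> c \<odot>\<^bsub>M\<^esub> x \<in> N" using y NS(4) by simp
    qed
    then have "(\<Union>y\<in>N +>\<^bsub>M\<^esub> x. N +>\<^bsub>M\<^esub> (c \<odot>\<^bsub>M\<^esub> y)) = (\<Union>y\<in>N +>\<^bsub>M\<^esub> x. N +>\<^bsub>M\<^esub> (c \<odot>\<^bsub>M\<^esub> x))"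
      by (rule SUP_cong[OF refl])
    also have "\<dots> = N +>\<^bsub>M\<^esub> (c \<odot>\<^bsub>M\<^esub> x)" using self[OF x] by blast
    finally show ?thesis by (simp add: quot_module_def)
  qed
  show "cmod ?Q"
    by (rule cmod_surj_image[OF assms(1) carr add smult])
      (use M.a_coset_add_zero[OF NS(1)] in \<open>simp_all only: quot_module_def ring.simps M.zero_closed\<close>)
  show "(\<lambda>x. N +>\<^bsub>M\<^esub> x) \<in> lmap M ?Q"
    by (rule lmapI) (simp_all add: carr add smult)
qed

text \<open>A diagram over a graph: each relation in \<open>colim_rel\<close> concerns a single
  arrow, so linearity of the arrow maps is what the universal property rests on, and comma
  categories enter merely as graphs.\<close>

definition diagram :: "('o, 'm, 'v) vfunctor \<Rightarrow> bool" where
  "diagram D \<longleftrightarrow> (\<forall>j \<in> Obj (vdom D). cmod (vob D j)) \<and>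
     (\<forall>h \<in> Arr (vdom D). Dom (vdom D) h \<in> Obj (vdom D) \<and> Cod (vdom D) h \<in> Obj (vdom D) \<and>
        var D h \<in> lmap (vob D (Dom (vdom D) h)) (vob D (Cod (vdom D) h)))"

section \<open>The universal property of colimits\<close>

context
  fixes D :: "('o, 'm, 'v) vfunctor"
  assumes D: "diagram D"
begin

private abbreviation (input) "S \<equiv> dsum (Obj (vdom D)) (vob D)"

private abbreviation (input) "rels \<equiv> {dsum_in (Obj (vdom D)) (vob D) (Dom (vdom D) h) v
        \<ominus>\<^bsub>S\<^esub> dsum_in (Obj (vdom D)) (vob D) (Cod (vdom D) h) (var D h v)
      | h v. h \<in> Arr (vdom D) \<and> v \<in> carrier (vob D (Dom (vdom D) h))}"

private lemma obs: "j \<in> Obj (vdom D) \<Longrightarrow> cmod (vob D j)"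
  using D by (simp add: diagram_def)

private lemma arrs:
  assumes "h \<in> Arr (vdom D)"
  shows "Dom (vdom D) h \<in> Obj (vdom D)" "Cod (vdom D) h \<in> Obj (vdom D)"
    "v \<in> carrier (vob D (Dom (vdom D) h)) \<Longrightarrow> var D h v \<in> carrier (vob D (Cod (vdom D) h))"
  using D assms by (auto simp: diagram_def LinearCombinations.module_hom_def)

private lemma S_cmod: "cmod S"
  by (rule dsum_cmod[OF obs])

private lemma in_S: "j \<in> Obj (vdom D) \<Longrightarrow> dsum_in (Obj (vdom D)) (vob D) j \<in> lmap (vob D j) S"
  by (rule dsum_in_lmap[OF obs])

private lemma rels_S: "rels \<subseteq> carrier S"
proof -
  interpret S: abelian_group S using cmod_abelian_group S_cmod .
  show ?thesis
    using S.minus_closed[OF lmap_closed[OF in_S[OF arrs(1)]] lmap_closed[OF in_S[OF arrs(2)] arrs(3)]]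
    by blast
qed

private lemma rel_submodule: "LinearCombinations.submodule class_ring (colim_rel D) S"
  unfolding colim_rel_def by (rule module.span_is_submodule[OF S_cmod rels_S])

private lemmas Q = quot_module_cmod_lmap[OF S_cmod rel_submodule, folded colim_def]

lemma colim_cmod: "cmod (colim D)"
  using Q(1) .

lemma colim_in_lmap:
  assumes "j \<in> Obj (vdom D)" shows "colim_in D j \<in> lmap (vob D j) (colim D)"
proof -
  have "colim_in D j = (\<lambda>v. colim_rel D +>\<^bsub>S\<^esub> dsum_in (Obj (vdom D)) (vob D) j v)"
    by (simp add: colim_in_def fun_eq_iff)
  then show ?thesis using lmap_comp[OF in_S[OF assms] Q(2)] by simp
qed

lemma colim_in_rel:
  assumes h: "h \<in> Arr (vdom D)" and v: "v \<in> carrier (vob D (Dom (vdom D) h))"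
  shows "colim_in D (Dom (vdom D) h) v = colim_in D (Cod (vdom D) h) (var D h v)"
  unfolding colim_in_def
proof (rule Q(4))
  show "dsum_in (Obj (vdom D)) (vob D) (Dom (vdom D) h) v \<in> carrier S"
    "dsum_in (Obj (vdom D)) (vob D) (Cod (vdom D) h) (var D h v) \<in> carrier S"
    by (rule lmap_closed[OF in_S[OF arrs(1)[OF h]] v],
        rule lmap_closed[OF in_S[OF arrs(2)[OF h]] arrs(3)[OF h v]])
  show "dsum_in (Obj (vdom D)) (vob D) (Dom (vdom D) h) v
        \<ominus>\<^bsub>S\<^esub> dsum_in (Obj (vdom D)) (vob D) (Cod (vdom D) h) (var D h v) \<in> colim_rel D"
    unfolding colim_rel_def using module.in_own_span[OF S_cmod rels_S] h v by blast
qed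

text \<open>Every coset is represented by a finitely supported family, hence is a finite sum of
  generators. All identities between maps out of a pushforward are reduced to generators through
  this.\<close>

lemma colim_ext:
  assumes "cmod W" "f \<in> lmap (colim D) W" "g \<in> lmap (colim D) W"
    and eq: "\<And>j v. j \<in> Obj (vdom D) \<Longrightarrow> v \<in> carrier (vob D j) \<Longrightarrow>
      f (colim_in D j v) = g (colim_in D j v)"
    and x: "x \<in> carrier (colim D)"
  shows "f x = g x"
proof -
  let ?q = "\<lambda>\<phi>. colim_rel D +>\<^bsub>S\<^esub> \<phi>"
  obtain \<phi> where \<phi>: "\<phi> \<in> carrier S" "x = ?q \<phi>"
    using x Q(3) by auto
  let ?K = "{i \<in> Obj (vdom D). \<phi> i \<noteq> \<zero>\<^bsub>vob D i\<^esub>}"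
  let ?f = "\<lambda>i. dsum_in (Obj (vdom D)) (vob D) i (\<phi> i)"
  have \<phi>_cl: "\<phi> i \<in> carrier (vob D i)" if "i \<in> Obj (vdom D)" for i
    using \<phi> that by (auto simp: dsum_def)
  have f_cl: "?f i \<in> carrier S" if "i \<in> ?K" for i
    using lmap_closed[OF in_S] \<phi>_cl that by auto
  have sum: "F x = finsum W (\<lambda>i. F (colim_in D i (\<phi> i))) ?K" if "F \<in> lmap (colim D) W" for F
  proof -
    have "x = ?q (finsum S ?f ?K)"
      using dsum_finsum[OF obs \<phi>(1)] \<phi>(2) by simp
    then show ?thesis
      using lmap_finsum[OF S_cmod assms(1) lmap_comp[OF Q(2) that], of ?K ?f] f_cl
      by (simp add: colim_in_def)
  qed
  interpret W: Module.module "class_ring :: complex ring" W by fact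
  have "finsum W (\<lambda>i. f (colim_in D i (\<phi> i))) ?K = finsum W (\<lambda>i. g (colim_in D i (\<phi> i))) ?K"
    by (rule W.finsum_cong')
      (use eq \<phi>_cl in \<open>auto intro!: lmap_closed[OF assms(3)] lmap_closed[OF colim_in_lmap]\<close>)
  then show ?thesis using sum assms(2,3) by simp
qed

text \<open>The extension \<open>L\<close> of the cocone to the direct sum annihilates each relation
  and therefore their span \<open>colim_rel D\<close>, so every representative that
  \<open>SOME\<close> could pick gives the same value.\<close>

lemma colim_desc_lmap:
  assumes W: "cmod W" and u: "\<And>j. j \<in> Obj (vdom D) \<Longrightarrow> u j \<in> lmap (vob D j) W"
    and cocone: "\<And>h v. h \<in> Arr (vdom D) \<Longrightarrow> v \<in> carrier (vob D (Dom (vdom D) h)) \<Longrightarrow>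
      u (Cod (vdom D) h) (var D h v) = u (Dom (vdom D) h) v"
  shows "colim_desc D W u \<in> lmap (colim D) W"
    and "\<And>j v. j \<in> Obj (vdom D) \<Longrightarrow> v \<in> carrier (vob D j) \<Longrightarrow>
      colim_desc D W u (colim_in D j v) = u j v"
proof -
  interpret W: Module.module "class_ring :: complex ring" W by fact
  define L where "L = (\<lambda>\<phi>. finsum W (\<lambda>j. u j (\<phi> j)) {j \<in> Obj (vdom D). \<phi> j \<noteq> \<zero>\<^bsub>vob D j\<^esub>})"
  have L: "L \<in> lmap S W"
    using dsum_lift(1)[of "Obj (vdom D)" "vob D" W u, OF obs W u] by (simp add: L_def)
  have L_in: "L (dsum_in (Obj (vdom D)) (vob D) j v) = u j v"
    if "j \<in> Obj (vdom D)" "v \<in> carrier (vob D j)" for j v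
    using dsum_lift(2)[of "Obj (vdom D)" "vob D" W u, OF obs W u that] by (simp add: L_def)
  interpret L: mod_hom "class_ring :: complex ring" S W L
    using S_cmod W L by (simp add: mod_hom_def mod_hom_axioms_def)
  have "rels \<subseteq> L.ker"
  proof
    fix r assume "r \<in> rels"
    then obtain h v where h: "h \<in> Arr (vdom D)" "v \<in> carrier (vob D (Dom (vdom D) h))"
      and r: "r = dsum_in (Obj (vdom D)) (vob D) (Dom (vdom D) h) v
        \<ominus>\<^bsub>S\<^esub> dsum_in (Obj (vdom D)) (vob D) (Cod (vdom D) h) (var D h v)" by blast
    have obj: "Dom (vdom D) h \<in> Obj (vdom D)" "Cod (vdom D) h \<in> Obj (vdom D)"
      and v': "var D h v \<in> carrier (vob D (Cod (vdom D) h))"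
      using arrs h by auto
    have "L r = u (Dom (vdom D) h) v \<ominus>\<^bsub>W\<^esub> u (Cod (vdom D) h) (var D h v)"
      unfolding r using h obj v' L_in lmap_closed[OF in_S] by simp
    also have "\<dots> = \<zero>\<^bsub>W\<^esub>"
      using cocone[OF h] lmap_closed[OF u[OF obj(1)] h(2)] by (simp add: W.r_neg W.minus_eq)
    finally show "r \<in> L.ker" using \<open>r \<in> rels\<close> rels_S by (auto simp: L.ker_def)
  qed
  then have ker: "colim_rel D \<subseteq> L.ker"
    unfolding colim_rel_def by (rule module.span_is_subset[OF S_cmod _ L.ker_is_submodule])
  have desc: "colim_desc D W u (colim_rel D +>\<^bsub>S\<^esub> \<phi>) = L \<phi>" if \<phi>: "\<phi> \<in> carrier S" for \<phi>
  proof -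
    let ?\<psi> = "SOME \<psi>. \<psi> \<in> colim_rel D +>\<^bsub>S\<^esub> \<phi>"
    have "?\<psi> \<in> colim_rel D +>\<^bsub>S\<^esub> \<phi>" using Q(6)[OF \<phi>] by (simp only: some_in_eq) blast
    then have \<psi>: "?\<psi> \<in> carrier S" "?\<psi> \<ominus>\<^bsub>S\<^esub> \<phi> \<in> colim_rel D"
      using Q(5)[OF \<phi>] by auto
    have "L ?\<psi> \<ominus>\<^bsub>W\<^esub> L \<phi> = \<zero>\<^bsub>W\<^esub>"
      using \<psi> \<phi> ker L.f_minus[of ?\<psi> \<phi>] by (auto simp: L.ker_def)
    then have "L ?\<psi> = L \<phi>"
      using \<psi> \<phi> by (simp add: W.minus_other_side lmap_closed[OF L])
    then show ?thesis by (simp add: colim_desc_def L_def)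
  qed
  show "colim_desc D W u \<in> lmap (colim D) W"
  proof (rule lmapI)
    fix X assume "X \<in> carrier (colim D)"
    then obtain \<phi> where \<phi>: "\<phi> \<in> carrier S" "X = colim_rel D +>\<^bsub>S\<^esub> \<phi>" using Q(3) by auto
    then show "colim_desc D W u X \<in> carrier W" using desc lmap_closed[OF L] by simp
    show "colim_desc D W u (c \<odot>\<^bsub>colim D\<^esub> X) = c \<odot>\<^bsub>W\<^esub> colim_desc D W u X" for c
      using \<phi> desc lmap_smult[OF Q(2), symmetric] lmap_smult[OF L]
        Module.module.smult_closed[OF S_cmod, of c] by simp
    fix Z assume "Z \<in> carrier (colim D)"
    then obtain \<psi> where \<psi>: "\<psi> \<in> carrier S" "Z = colim_rel D +>\<^bsub>S\<^esub> \<psi>" using Q(3) by auto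
    show "colim_desc D W u (X \<oplus>\<^bsub>colim D\<^esub> Z) = colim_desc D W u X \<oplus>\<^bsub>W\<^esub> colim_desc D W u Z"
      using \<phi> \<psi> desc lmap_add[OF Q(2), symmetric] lmap_add[OF L] by simp
  qed
  show "colim_desc D W u (colim_in D j v) = u j v"
    if "j \<in> Obj (vdom D)" "v \<in> carrier (vob D j)" for j v
    using that desc L_in lmap_closed[OF in_S] by (simp add: colim_in_def)
qed

end

section \<open>Pushforward\<close>

lemma HomD:
  assumes "f \<in> Hom C a b" shows "f \<in> Arr C" "Dom C f = a" "Cod C f = b"
  using assms by (auto simp: Hom_def)

lemma (in category) Hom_Obj: "f \<in> Hom C a b \<Longrightarrow> a \<in> Obj C \<and> b \<in> Obj C"
  using Dom_Obj Cod_Obj by (auto simp: Hom_def)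

lemma is_functorD:
  assumes "is_functor F"
  shows "category (fdom F)" "category (fcod F)"
    "a \<in> Obj (fdom F) \<Longrightarrow> fob F a \<in> Obj (fcod F)"
    "f \<in> Hom (fdom F) a b \<Longrightarrow> far F f \<in> Hom (fcod F) (fob F a) (fob F b)"
    "a \<in> Obj (fdom F) \<Longrightarrow> far F (Idm (fdom F) a) = Idm (fcod F) (fob F a)"
    "f \<in> Hom (fdom F) a b \<Longrightarrow> g \<in> Hom (fdom F) b c \<Longrightarrow>
      far F (Cmp (fdom F) g f) = Cmp (fcod F) (far F g) (far F f)"
  using assms by (auto simp: is_functor_def)

lemma fcomp_simps [simp]:
  "fdom (G \<circ>\<^sub>F F) = fdom F" "fcod (G \<circ>\<^sub>F F) = fcod G"
  "fob (G \<circ>\<^sub>F F) a = fob G (fob F a)" "far (G \<circ>\<^sub>F F) f = far G (far F f)"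
  by (simp_all add: fcomp_def)

lemma is_functor_fcomp: "is_functor F \<Longrightarrow> is_functor G \<Longrightarrow> fcod F = fdom G \<Longrightarrow> is_functor (G \<circ>\<^sub>F F)"
  unfolding is_functor_def by (simp, metis)

text \<open>Functors to possibly infinite-dimensional vector spaces; pushing forward is closed under
  these without a dimension count.\<close>

definition mfunctor :: "('o, 'm, 'v) vfunctor \<Rightarrow> bool" where
  "mfunctor F \<longleftrightarrow> category (vdom F) \<and>
     (\<forall>a \<in> Obj (vdom F). cmod (vob F a)) \<and>
     (\<forall>a b. \<forall>f \<in> Hom (vdom F) a b. var F f \<in> lmap (vob F a) (vob F b)) \<and>
     (\<forall>a \<in> Obj (vdom F). \<forall>v \<in> carrier (vob F a). var F (Idm (vdom F) a) v = v) \<and>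
     (\<forall>a b c. \<forall>f \<in> Hom (vdom F) a b. \<forall>g \<in> Hom (vdom F) b c. \<forall>v \<in> carrier (vob F a).
        var F (Cmp (vdom F) g f) v = var F g (var F f v))"

lemma mfunctorD:
  assumes "mfunctor F"
  shows "category (vdom F)" "a \<in> Obj (vdom F) \<Longrightarrow> cmod (vob F a)"
    "f \<in> Hom (vdom F) a b \<Longrightarrow> var F f \<in> lmap (vob F a) (vob F b)"
    "a \<in> Obj (vdom F) \<Longrightarrow> v \<in> carrier (vob F a) \<Longrightarrow> var F (Idm (vdom F) a) v = v"
    "f \<in> Hom (vdom F) a b \<Longrightarrow> g \<in> Hom (vdom F) b c \<Longrightarrow> v \<in> carrier (vob F a) \<Longrightarrow>
      var F (Cmp (vdom F) g f) v = var F g (var F f v)"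
  using assms by (auto simp: mfunctor_def)

lemma mfunctor_closed:
  "mfunctor F \<Longrightarrow> f \<in> Hom (vdom F) a b \<Longrightarrow> v \<in> carrier (vob F a) \<Longrightarrow> var F f v \<in> carrier (vob F b)"
  by (rule lmap_closed[OF mfunctorD(3)])

lemma vfunctors_mfunctor: assumes "F \<in> vfunctors A" shows "mfunctor F"
proof -
  have "is_vfunctor F" using assms by (simp add: vfunctors_def)
  then show ?thesis
    unfolding is_vfunctor_def mfunctor_def fd_vectorspace_def vectorspace_def by blast
qed

lemma pull_simps [simp]:
  "vdom (pull f F) = fdom f" "vob (pull f F) b = vob F (fob f b)" "var (pull f F) h = var F (far f h)"
  by (simp_all add: pull_def)

lemma pull_mfunctor:
  assumes f: "is_functor f" and F: "mfunctor F" and "vdom F = fcod f"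
  shows "mfunctor (pull f F)"
  unfolding mfunctor_def pull_simps
proof (intro conjI allI ballI)
  fix a b c g h v
  assume g: "g \<in> Hom (fdom f) a b" and h: "h \<in> Hom (fdom f) b c" and v: "v \<in> carrier (vob F (fob f a))"
  show "var F (far f (Cmp (fdom f) h g)) v = var F (far f h) (var F (far f g) v)"
    using mfunctorD(5)[OF F, of "far f g" _ _ "far f h" _ v] is_functorD(4)[OF f g]
      is_functorD(4)[OF f h] is_functorD(6)[OF f g h] v assms(3) by metis
qed (use is_functorD(1-5)[OF f] mfunctorD(1-4)[OF F] assms(3) in simp_all)

text \<open>Naturality is recorded together with linearity because it supplies the cocone condition
  that makes \<open>push_map\<close> well defined.\<close>

definition linear_nat :: "('o, 'm, 'v) vfunctor \<Rightarrow> ('o, 'm, 'w) vfunctor \<Rightarrow> ('o \<Rightarrow> 'v \<Rightarrow> 'w) \<Rightarrow> bool" where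
  "linear_nat F G \<alpha> \<longleftrightarrow> (\<forall>a \<in> Obj (vdom F). \<alpha> a \<in> lmap (vob F a) (vob G a)) \<and>
     (\<forall>a b. \<forall>f \<in> Hom (vdom F) a b. \<forall>v \<in> carrier (vob F a). \<alpha> b (var F f v) = var G f (\<alpha> a v))"

lemma linear_natD:
  assumes "linear_nat F G \<alpha>"
  shows "a \<in> Obj (vdom F) \<Longrightarrow> \<alpha> a \<in> lmap (vob F a) (vob G a)"
    "f \<in> Hom (vdom F) a b \<Longrightarrow> v \<in> carrier (vob F a) \<Longrightarrow> \<alpha> b (var F f v) = var G f (\<alpha> a v)"
  using assms by (auto simp: linear_nat_def)

lemma linear_nat_pull:
  assumes f: "is_functor f" and "linear_nat F G \<alpha>" and "vdom F = fcod f"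
  shows "linear_nat (pull f F) (pull f G) (\<lambda>b. \<alpha> (fob f b))"
  using is_functorD[OF f] linear_natD[OF assms(2)] assms(3) by (auto simp: linear_nat_def)

section \<open>Generators and the universal property of a pushforward\<close>

context
  fixes f :: "('b, 'n, 'a, 'm) fctr" and G :: "('b, 'n, 'v) vfunctor"
  assumes f: "is_functor f" and G: "mfunctor G" and dom: "vdom G = fdom f"
begin

private lemma diagram_diag: "diagram (diag f G a)"
  unfolding diagram_def
  using mfunctorD[OF G] dom by (auto simp: comma_proj_def comma_def pull_def)

private lemma diag_simps:
  "p \<in> Obj (fdom (comma_proj f a)) \<longleftrightarrow>
    (\<exists>b k. p = (b, k) \<and> b \<in> Obj (fdom f) \<and> k \<in> Hom (fcod f) (fob f b) a)"
  "fob (comma_proj f a) (b, k) = b"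
  by (auto simp: comma_proj_def comma_def)

lemma push_cmod: "cmod (vob (push f G) a)"
  using colim_cmod[OF diagram_diag] by (simp add: push_def)

lemma gen_lmap:
  assumes "b \<in> Obj (fdom f)" "k \<in> Hom (fcod f) (fob f b) a"
  shows "gen f G a (b, k) \<in> lmap (vob G b) (vob (push f G) a)"
  using colim_in_lmap[OF diagram_diag, of "(b, k)" a] assms by (simp add: push_def diag_simps)

lemma gen_closed:
  assumes "b \<in> Obj (fdom f)" "k \<in> Hom (fcod f) (fob f b) a" "v \<in> carrier (vob G b)"
  shows "gen f G a (b, k) v \<in> carrier (vob (push f G) a)"
  using lmap_closed[OF gen_lmap] assms by blast

lemma gen_rel:
  assumes h: "h \<in> Hom (fdom f) b b'" and k: "k \<in> Hom (fcod f) (fob f b') a" and v: "v \<in> carrier (vob G b)"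
  shows "gen f G a (b, Cmp (fcod f) k (far f h)) v = gen f G a (b', k) (var G h v)"
proof -
  let ?k = "Cmp (fcod f) k (far f h)"
  have b: "b \<in> Obj (fdom f)" "b' \<in> Obj (fdom f)"
    using category.Hom_Obj[OF is_functorD(1)[OF f] h] by auto
  have "?k \<in> Hom (fcod f) (fob f b) a"
    using category.Cmp_Hom[OF is_functorD(2)[OF f] is_functorD(4)[OF f h] k] .
  then show ?thesis
    using colim_in_rel[OF diagram_diag, of "((b, ?k), h, (b', k))" a v] b h k v
    by (auto simp: comma_proj_def comma_def)
qed

lemma push_ext:
  assumes "cmod W" "\<phi> \<in> lmap (vob (push f G) a) W" "\<psi> \<in> lmap (vob (push f G) a) W"
    and "\<And>b k v. b \<in> Obj (fdom f) \<Longrightarrow> k \<in> Hom (fcod f) (fob f b) a \<Longrightarrow> v \<in> carrier (vob G b) \<Longrightarrow>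
      \<phi> (gen f G a (b, k) v) = \<psi> (gen f G a (b, k) v)"
    and "x \<in> carrier (vob (push f G) a)"
  shows "\<phi> x = \<psi> x"
  using colim_ext[OF diagram_diag, of W \<phi> a \<psi> x] assms by (auto simp: push_def diag_simps)

text \<open>An arrow \<open>h\<close> of the comma category with target \<open>(b', k)\<close> has
  source \<open>(b, k f(h))\<close>, so the cocone condition can be stated with \<open>h\<close> and
  \<open>k\<close> alone.\<close>

lemma push_desc:
  assumes "cmod W"
    and u: "\<And>b k. b \<in> Obj (fdom f) \<Longrightarrow> k \<in> Hom (fcod f) (fob f b) a \<Longrightarrow> u (b, k) \<in> lmap (vob G b) W"
    and cocone: "\<And>b b' h k v. h \<in> Hom (fdom f) b b' \<Longrightarrow> k \<in> Hom (fcod f) (fob f b') a \<Longrightarrow>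
      v \<in> carrier (vob G b) \<Longrightarrow> u (b', k) (var G h v) = u (b, Cmp (fcod f) k (far f h)) v"
  shows "colim_desc (diag f G a) W u \<in> lmap (vob (push f G) a) W"
    and "b \<in> Obj (fdom f) \<Longrightarrow> k \<in> Hom (fcod f) (fob f b) a \<Longrightarrow> v \<in> carrier (vob G b) \<Longrightarrow>
      colim_desc (diag f G a) W u (gen f G a (b, k) v) = u (b, k) v"
proof -
  have 1: "u p \<in> lmap (vob (diag f G a) p) W" if "p \<in> Obj (vdom (diag f G a))" for p
    using that u by (auto simp: diag_simps)
  have 2: "u (Cod (vdom (diag f G a)) h) (var (diag f G a) h v) = u (Dom (vdom (diag f G a)) h) v"
    if "h \<in> Arr (vdom (diag f G a))" "v \<in> carrier (vob (diag f G a) (Dom (vdom (diag f G a)) h))" for h v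
    using that by (auto simp: comma_proj_def comma_def cocone)
  note desc = colim_desc_lmap[OF diagram_diag assms(1) 1 2]
  show "colim_desc (diag f G a) W u \<in> lmap (vob (push f G) a) W"
    using desc(1) by (simp add: push_def)
  show "colim_desc (diag f G a) W u (gen f G a (b, k) v) = u (b, k) v"
    if "b \<in> Obj (fdom f)" "k \<in> Hom (fcod f) (fob f b) a" "v \<in> carrier (vob G b)"
    using desc(2)[of "(b, k)" v] that by (simp add: diag_simps)
qed

lemma push_var:
  assumes u: "u \<in> Hom (fcod f) a a'"
  shows push_var_lmap: "var (push f G) u \<in> lmap (vob (push f G) a) (vob (push f G) a')"
    and push_var_gen: "b \<in> Obj (fdom f) \<Longrightarrow> k \<in> Hom (fcod f) (fob f b) a \<Longrightarrow> v \<in> carrier (vob G b) \<Longrightarrow>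
      var (push f G) u (gen f G a (b, k) v) = gen f G a' (b, Cmp (fcod f) u k) v"
proof -
  interpret A: category "fcod f" using is_functorD(2)[OF f] .
  define U where "U = (\<lambda>(b, k) v. gen f G a' (b, Cmp (fcod f) u k) v)"
  have var: "var (push f G) u = colim_desc (diag f G a) (vob (push f G) a') U"
    using HomD[OF u] by (simp add: push_def U_def)
  have 1: "U (b, k) \<in> lmap (vob G b) (vob (push f G) a')"
    if "b \<in> Obj (fdom f)" "k \<in> Hom (fcod f) (fob f b) a" for b k
    using gen_lmap[OF that(1) A.Cmp_Hom[OF that(2) u]] by (simp add: U_def)
  have 2: "U (b', k) (var G h v) = U (b, Cmp (fcod f) k (far f h)) v"
    if "h \<in> Hom (fdom f) b b'" "k \<in> Hom (fcod f) (fob f b') a" "v \<in> carrier (vob G b)" for b b' h k v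
    using gen_rel[OF that(1) A.Cmp_Hom[OF that(2) u] that(3)]
      A.Cmp_assoc[OF is_functorD(4)[OF f that(1)] that(2) u] by (simp add: U_def)
  show "var (push f G) u \<in> lmap (vob (push f G) a) (vob (push f G) a')"
    unfolding var by (rule push_desc(1)[OF push_cmod 1 2])
  show "var (push f G) u (gen f G a (b, k) v) = gen f G a' (b, Cmp (fcod f) u k) v"
    if "b \<in> Obj (fdom f)" "k \<in> Hom (fcod f) (fob f b) a" "v \<in> carrier (vob G b)"
    unfolding var using push_desc(2)[OF push_cmod 1 2 that] by (simp add: U_def)
qed

lemma push_mfunctor: "mfunctor (push f G)"
  unfolding mfunctor_def
proof (intro conjI allI ballI)
  interpret A: category "fcod f" using is_functorD(2)[OF f] .
  have [simp]: "vdom (push f G) = fcod f" by (simp add: push_def)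
  show "category (vdom (push f G))" using A.category_axioms by simp
  show "cmod (vob (push f G) a)" for a by (rule push_cmod)
  show "var (push f G) u \<in> lmap (vob (push f G) a) (vob (push f G) b)"
    if "u \<in> Hom (vdom (push f G)) a b" for a b u
    using push_var_lmap that by simp
  have id_lmap: "(\<lambda>x. x) \<in> lmap V V" for V :: "(complex, 'w) module"
    by (rule lmapI) simp_all
  show "var (push f G) (Idm (vdom (push f G)) a) x = x"
    if a: "a \<in> Obj (vdom (push f G))" and x: "x \<in> carrier (vob (push f G) a)" for a x
  proof (rule push_ext[OF push_cmod _ id_lmap _ x])
    have id: "Idm (fcod f) a \<in> Hom (fcod f) a a" using A.Idm_Hom a by simp
    show "var (push f G) (Idm (vdom (push f G)) a) \<in> lmap (vob (push f G) a) (vob (push f G) a)"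
      using push_var_lmap[OF id] by simp
    show "var (push f G) (Idm (vdom (push f G)) a) (gen f G a (b, k) v) = gen f G a (b, k) v"
      if "b \<in> Obj (fdom f)" "k \<in> Hom (fcod f) (fob f b) a" "v \<in> carrier (vob G b)" for b k v
      using push_var_gen[OF id that] A.Idm_left[OF that(2)] by simp
  qed
  show "var (push f G) (Cmp (vdom (push f G)) w u) x = var (push f G) w (var (push f G) u x)"
    if u: "u \<in> Hom (vdom (push f G)) a b" and w: "w \<in> Hom (vdom (push f G)) b c"
      and x: "x \<in> carrier (vob (push f G) a)" for a b c u w x
  proof (rule push_ext[OF push_cmod _ _ _ x])
    have u': "u \<in> Hom (fcod f) a b" and w': "w \<in> Hom (fcod f) b c" using u w by simp_all
    note wu = A.Cmp_Hom[OF u' w']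
    show "var (push f G) (Cmp (vdom (push f G)) w u) \<in> lmap (vob (push f G) a) (vob (push f G) c)"
      using push_var_lmap[OF wu] by simp
    show "(\<lambda>x. var (push f G) w (var (push f G) u x)) \<in> lmap (vob (push f G) a) (vob (push f G) c)"
      by (rule lmap_comp[OF push_var_lmap[OF u'] push_var_lmap[OF w']])
    show "var (push f G) (Cmp (vdom (push f G)) w u) (gen f G a (d, k) v)
        = var (push f G) w (var (push f G) u (gen f G a (d, k) v))"
      if "d \<in> Obj (fdom f)" "k \<in> Hom (fcod f) (fob f d) a" "v \<in> carrier (vob G d)" for d k v
      using push_var_gen[OF wu that] push_var_gen[OF u' that]
        push_var_gen[OF w' that(1) A.Cmp_Hom[OF that(2) u'] that(3)]
        A.Cmp_assoc[OF that(2) u' w'] by simp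
  qed
qed

end

section \<open>Induced transformations and the left counit\<close>

lemma push_vdom [simp]: "vdom (push f G) = fcod f"
  by (simp add: push_def)

lemma push_map:
  assumes f: "is_functor f" and G: "mfunctor G" "vdom G = fdom f" and G': "mfunctor G'" "vdom G' = fdom f"
    and \<alpha>: "linear_nat G G' \<alpha>"
  shows push_map_lmap: "push_map f G G' \<alpha> a \<in> lmap (vob (push f G) a) (vob (push f G') a)"
    and push_map_gen: "b \<in> Obj (fdom f) \<Longrightarrow> k \<in> Hom (fcod f) (fob f b) a \<Longrightarrow> v \<in> carrier (vob G b) \<Longrightarrow>
      push_map f G G' \<alpha> a (gen f G a (b, k) v) = gen f G' a (b, k) (\<alpha> b v)"
proof -
  define U where "U = (\<lambda>(b, k) v. gen f G' a (b, k) (\<alpha> b v))"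
  have map: "push_map f G G' \<alpha> a = colim_desc (diag f G a) (vob (push f G') a) U"
    by (simp add: push_map_def U_def)
  note W = push_cmod[OF f G', of a]
  have 1: "U (b, k) \<in> lmap (vob G b) (vob (push f G') a)"
    if "b \<in> Obj (fdom f)" "k \<in> Hom (fcod f) (fob f b) a" for b k
    using lmap_comp[OF linear_natD(1)[OF \<alpha>] gen_lmap[OF f G' that]] that G by (simp add: U_def)
  have 2: "U (b', k) (var G h v) = U (b, Cmp (fcod f) k (far f h)) v"
    if h: "h \<in> Hom (fdom f) b b'" and k: "k \<in> Hom (fcod f) (fob f b') a" and v: "v \<in> carrier (vob G b)"
    for b b' h k v
    using gen_rel[OF f G' h k lmap_closed[OF linear_natD(1)[OF \<alpha>] v]] linear_natD(2)[OF \<alpha>, of h b b' v]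
      h v G category.Hom_Obj[OF is_functorD(1)[OF f] h]
    by (simp add: U_def)
  show "push_map f G G' \<alpha> a \<in> lmap (vob (push f G) a) (vob (push f G') a)"
    unfolding map by (rule push_desc(1)[OF f G W 1 2])
  show "push_map f G G' \<alpha> a (gen f G a (b, k) v) = gen f G' a (b, k) (\<alpha> b v)"
    if "b \<in> Obj (fdom f)" "k \<in> Hom (fcod f) (fob f b) a" "v \<in> carrier (vob G b)"
    unfolding map using push_desc(2)[OF f G W 1 2 that] by (simp add: U_def)
qed

text \<open>The cocone condition is functoriality of \<open>F\<close>: applying
  \<open>F(f(h))\<close> and then \<open>F(k)\<close> is applying \<open>F(k f(h))\<close>, so
  \<open>k \<otimes> v \<mapsto> F(k) v\<close> respects the relations.\<close>

lemma counit_L: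
  fixes f :: "('b, 'n, 'a, 'm) fctr"
  assumes f: "is_functor f" and F: "mfunctor F" "vdom F = fcod f"
  shows counit_L_lmap: "a \<in> Obj (fcod f) \<Longrightarrow> counit_L f F a \<in> lmap (vob (push f (pull f F)) a) (vob F a)"
    and counit_L_gen: "b \<in> Obj (fdom f) \<Longrightarrow> k \<in> Hom (fcod f) (fob f b) a \<Longrightarrow> v \<in> carrier (vob F (fob f b)) \<Longrightarrow>
      counit_L f F a (gen f (pull f F) a (b, k) v) = var F k v"
proof -
  interpret A: category "fcod f" using is_functorD(2)[OF f] .
  define U where "U = (\<lambda>(b :: 'b, k) v. var F k v)"
  have eq: "counit_L f F a = colim_desc (diag f (pull f F) a) (vob F a) U" for a
    by (simp add: counit_L_def U_def)
  have G: "mfunctor (pull f F)" "vdom (pull f F) = fdom f"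
    using pull_mfunctor[OF f F] by simp_all
  have 1: "U (b, k) \<in> lmap (vob (pull f F) b) (vob F a)"
    if "b \<in> Obj (fdom f)" "k \<in> Hom (fcod f) (fob f b) a" for b k a
    using mfunctorD(3)[OF F(1)] that F(2) by (simp add: U_def)
  have 2: "U (b', k) (var (pull f F) h v) = U (b, Cmp (fcod f) k (far f h)) v"
    if h: "h \<in> Hom (fdom f) b b'" and k: "k \<in> Hom (fcod f) (fob f b') a" and v: "v \<in> carrier (vob (pull f F) b)"
    for b b' h k v a
    using mfunctorD(5)[OF F(1), of "far f h" "fob f b" "fob f b'" k a v] is_functorD(4)[OF f h] k v F(2)
    by (simp add: U_def)
  show "counit_L f F a \<in> lmap (vob (push f (pull f F)) a) (vob F a)" if "a \<in> Obj (fcod f)"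
    unfolding eq using that F by (intro push_desc(1)[OF f G _ 1 2] mfunctorD(2)) auto
  show "counit_L f F a (gen f (pull f F) a (b, k) v) = var F k v"
    if "b \<in> Obj (fdom f)" "k \<in> Hom (fcod f) (fob f b) a" "v \<in> carrier (vob F (fob f b))"
  proof -
    have "cmod (vob F a)" using mfunctorD(2)[OF F(1)] F(2) A.Hom_Obj[OF that(2)] by simp
    then show ?thesis
      unfolding eq using push_desc(2)[OF f G _ 1 2, where a = a and b = b and k = k and v = v] that
      by (simp add: U_def)
  qed
qed

lemma counit_L_linear_nat:
  assumes f: "is_functor f" and F: "mfunctor F" "vdom F = fcod f"
  shows "linear_nat (push f (pull f F)) F (counit_L f F)"
  unfolding linear_nat_def
proof (intro conjI allI ballI)
  interpret A: category "fcod f" using is_functorD(2)[OF f] .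
  have G: "mfunctor (pull f F)" "vdom (pull f F) = fdom f"
    using pull_mfunctor[OF f F] by simp_all
  show "counit_L f F a \<in> lmap (vob (push f (pull f F)) a) (vob F a)"
    if "a \<in> Obj (vdom (push f (pull f F)))" for a
    using counit_L_lmap[OF f F] that by simp
  fix a b u x assume u: "u \<in> Hom (vdom (push f (pull f F))) a b" and x: "x \<in> carrier (vob (push f (pull f F)) a)"
  then have u: "u \<in> Hom (fcod f) a b" by simp
  note ab = A.Hom_Obj[OF u]
  have Fu: "var F u \<in> lmap (vob F a) (vob F b)" using mfunctorD(3)[OF F(1)] F(2) u by simp
  show "counit_L f F b (var (push f (pull f F)) u x) = var F u (counit_L f F a x)"
  proof (rule push_ext[OF f G _ _ _ _ x])
    show "cmod (vob F b)" using mfunctorD(2)[OF F(1)] F(2) ab by simp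
    show "(\<lambda>x. counit_L f F b (var (push f (pull f F)) u x)) \<in> lmap (vob (push f (pull f F)) a) (vob F b)"
      using lmap_comp[OF push_var_lmap[OF f G u] counit_L_lmap[OF f F]] ab by blast
    show "(\<lambda>x. var F u (counit_L f F a x)) \<in> lmap (vob (push f (pull f F)) a) (vob F b)"
      using lmap_comp[OF counit_L_lmap[OF f F] Fu] ab by blast
    fix c k v assume c: "c \<in> Obj (fdom f)" "k \<in> Hom (fcod f) (fob f c) a" "v \<in> carrier (vob (pull f F) c)"
    then have v: "v \<in> carrier (vob F (fob f c))" by simp
    show "counit_L f F b (var (push f (pull f F)) u (gen f (pull f F) a (c, k) v)) =
        var F u (counit_L f F a (gen f (pull f F) a (c, k) v))"
      using push_var_gen[OF f G u c] counit_L_gen[OF f F c(1) A.Cmp_Hom[OF c(2) u] v]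
        counit_L_gen[OF f F c(1,2) v] mfunctorD(5)[OF F(1), of k "fob f c" a u b v] F(2) c u v by simp
  qed
qed

section \<open>Pushforward along a composite functor\<close>

context
  fixes f :: "('b, 'n, 'a, 'm) fctr" and g :: "('c, 'l, 'b, 'n) fctr" and G :: "('c, 'l, 'v) vfunctor"
  assumes f: "is_functor f" and g: "is_functor g" and fg: "fcod g = fdom f"
    and G: "mfunctor G" "vdom G = fdom g"
begin

private lemmas fg_functor = is_functor_fcomp[OF g f fg]

private lemma G': "vdom G = fdom (f \<circ>\<^sub>F g)"
  using G by simp

private lemma pushG: "mfunctor (push g G)" "vdom (push g G) = fdom f"
  using push_mfunctor[OF g G] fg by simp_all

text \<open>The universal property is applied twice: for fixed \<open>k\<close> the cocone
  \<open>u k\<close> defines \<open>U (b, k)\<close> on the inner pushforward, and the maps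
  \<open>U\<close> form a cocone for the outer one. Both cocone conditions come from associativity
  and functoriality of \<open>f\<close>.\<close>

lemma push_merge:
  shows push_merge_lmap: "push_merge f g G a \<in> lmap (vob (push f (push g G)) a) (vob (push (f \<circ>\<^sub>F g) G) a)"
    and push_merge_gen: "b \<in> Obj (fdom f) \<Longrightarrow> k \<in> Hom (fcod f) (fob f b) a \<Longrightarrow>
      c \<in> Obj (fdom g) \<Longrightarrow> h \<in> Hom (fcod g) (fob g c) b \<Longrightarrow> v \<in> carrier (vob G c) \<Longrightarrow>
      push_merge f g G a (gen f (push g G) a (b, k) (gen g G b (c, h) v)) =
        gen (f \<circ>\<^sub>F g) G a (c, Cmp (fcod f) k (far f h)) v"
proof -
  interpret A: category "fcod f" using is_functorD(2)[OF f] .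
  let ?W = "vob (push (f \<circ>\<^sub>F g) G) a"
  note W = push_cmod[OF fg_functor G(1) G', of a]
  define u where "u = (\<lambda>k (c, h) v. gen (f \<circ>\<^sub>F g) G a (c, Cmp (fcod f) k (far f h)) v)"
  define U where "U = (\<lambda>(b, k). colim_desc (diag g G b) ?W (u k))"
  have eq: "push_merge f g G a = colim_desc (diag f (push g G) a) ?W U"
    by (simp add: push_merge_def U_def u_def)
  have kh: "Cmp (fcod f) k (far f h) \<in> Hom (fcod f) (fob f (fob g c)) a"
    if "k \<in> Hom (fcod f) (fob f b) a" "h \<in> Hom (fcod g) (fob g c) b" for b k c h
    using A.Cmp_Hom[OF is_functorD(4)[OF f] that(1)] that(2) fg by simp
  have u1: "u k (c, h) \<in> lmap (vob G c) ?W"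
    if "k \<in> Hom (fcod f) (fob f b) a" "c \<in> Obj (fdom g)" "h \<in> Hom (fcod g) (fob g c) b" for b k c h
    using gen_lmap[OF fg_functor G(1) G', of c _ a] that kh[OF that(1,3)] by (simp add: u_def)
  have u2: "u k (c', h) (var G l v) = u k (c, Cmp (fcod g) h (far g l)) v"
    if k: "k \<in> Hom (fcod f) (fob f b) a" and l: "l \<in> Hom (fdom g) c c'"
      and h: "h \<in> Hom (fcod g) (fob g c') b" and v: "v \<in> carrier (vob G c)" for b k c c' l h v
  proof -
    have fl: "far g l \<in> Hom (fdom f) (fob g c) (fob g c')" using is_functorD(4)[OF g l] fg by simp
    have "Cmp (fcod f) k (far f (Cmp (fcod g) h (far g l)))
        = Cmp (fcod f) (Cmp (fcod f) k (far f h)) (far f (far g l))"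
      using is_functorD(6)[OF f fl, of h b] h fg
        A.Cmp_assoc[OF is_functorD(4)[OF f fl] is_functorD(4)[OF f, of h _ b] k] by simp
    then show ?thesis
      using gen_rel[OF fg_functor G(1) G', of l c c' "Cmp (fcod f) k (far f h)" a v] l v kh[OF k h]
      by (simp add: u_def)
  qed
  have U1: "U (b, k) \<in> lmap (vob (push g G) b) ?W" if "k \<in> Hom (fcod f) (fob f b) a" for b k
    using push_desc(1)[OF g G W u1[OF that] u2[OF that]] by (simp add: U_def)
  have Ugen: "U (b, k) (gen g G b (c, h) v) = gen (f \<circ>\<^sub>F g) G a (c, Cmp (fcod f) k (far f h)) v"
    if "k \<in> Hom (fcod f) (fob f b) a" "c \<in> Obj (fdom g)" "h \<in> Hom (fcod g) (fob g c) b" "v \<in> carrier (vob G c)"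
    for b k c h v
    using push_desc(2)[OF g G W u1[OF that(1)] u2[OF that(1)] that(2-4)] by (simp add: U_def u_def)
  \<comment> \<open>The outer condition compares two linear maps on the inner pushforward, so it is
    checked on the generators \<open>l \<otimes> v\<close>.\<close>
  have U2: "U (b', k) (var (push g G) h x) = U (b, Cmp (fcod f) k (far f h)) x"
    if h: "h \<in> Hom (fdom f) b b'" and k: "k \<in> Hom (fcod f) (fob f b') a"
      and x: "x \<in> carrier (vob (push g G) b)" for b b' h k x
  proof (rule push_ext[OF g G W _ _ _ x])
    have h': "h \<in> Hom (fcod g) b b'" using h fg by simp
    have kfh: "Cmp (fcod f) k (far f h) \<in> Hom (fcod f) (fob f b) a"
      using A.Cmp_Hom[OF is_functorD(4)[OF f h] k] .
    show "(\<lambda>x. U (b', k) (var (push g G) h x)) \<in> lmap (vob (push g G) b) ?W"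
      by (rule lmap_comp[OF push_var_lmap[OF g G h'] U1[OF k]])
    show "U (b, Cmp (fcod f) k (far f h)) \<in> lmap (vob (push g G) b) ?W"
      by (rule U1[OF kfh])
    show "U (b', k) (var (push g G) h (gen g G b (c, l) v)) = U (b, Cmp (fcod f) k (far f h)) (gen g G b (c, l) v)"
      if c: "c \<in> Obj (fdom g)" "l \<in> Hom (fcod g) (fob g c) b" "v \<in> carrier (vob G c)" for c l v
    proof -
      have l: "l \<in> Hom (fdom f) (fob g c) b" using c fg by simp
      have "U (b', k) (var (push g G) h (gen g G b (c, l) v))
          = gen (f \<circ>\<^sub>F g) G a (c, Cmp (fcod f) k (far f (Cmp (fcod g) h l))) v"
        using push_var_gen[OF g G h' c] Ugen[OF k c(1) _ c(3), of "Cmp (fcod g) h l"]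
          category.Cmp_Hom[OF is_functorD(2)[OF g] c(2) h'] by simp
      also have "Cmp (fcod f) k (far f (Cmp (fcod g) h l)) = Cmp (fcod f) (Cmp (fcod f) k (far f h)) (far f l)"
        using is_functorD(6)[OF f l h] A.Cmp_assoc[OF is_functorD(4)[OF f l] is_functorD(4)[OF f h] k] fg
        by simp
      also have "gen (f \<circ>\<^sub>F g) G a (c, \<dots>) v = U (b, Cmp (fcod f) k (far f h)) (gen g G b (c, l) v)"
        using Ugen[OF kfh c] by simp
      finally show ?thesis .
    qed
  qed
  show "push_merge f g G a \<in> lmap (vob (push f (push g G)) a) ?W"
    unfolding eq by (rule push_desc(1)[OF f pushG W U1 U2])
  show "push_merge f g G a (gen f (push g G) a (b, k) (gen g G b (c, h) v)) =
      gen (f \<circ>\<^sub>F g) G a (c, Cmp (fcod f) k (far f h)) v"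
    if b: "b \<in> Obj (fdom f)" "k \<in> Hom (fcod f) (fob f b) a"
      and c: "c \<in> Obj (fdom g)" "h \<in> Hom (fcod g) (fob g c) b" "v \<in> carrier (vob G c)"
    unfolding eq using push_desc(2)[OF f pushG W U1 U2 b gen_closed[OF g G c]] Ugen[OF b(2) c] by simp
qed

lemma push_split:
  shows push_split_lmap: "push_split f g G a \<in> lmap (vob (push (f \<circ>\<^sub>F g) G) a) (vob (push f (push g G)) a)"
    and push_split_gen: "c \<in> Obj (fdom g) \<Longrightarrow> k \<in> Hom (fcod f) (fob f (fob g c)) a \<Longrightarrow> v \<in> carrier (vob G c) \<Longrightarrow>
      push_split f g G a (gen (f \<circ>\<^sub>F g) G a (c, k) v) =
        gen f (push g G) a (fob g c, k) (gen g G (fob g c) (c, Idm (fcod g) (fob g c)) v)"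
proof -
  interpret B: category "fcod g" using is_functorD(2)[OF g] .
  let ?W = "vob (push f (push g G)) a"
  note W = push_cmod[OF f pushG, of a]
  define U where "U = (\<lambda>(c, k) v. gen f (push g G) a (fob g c, k)
        (gen g G (fob g c) (c, Idm (fcod g) (fob g c)) v))"
  have eq: "push_split f g G a = colim_desc (diag (f \<circ>\<^sub>F g) G a) ?W U"
    by (simp add: push_split_def U_def)
  have id: "Idm (fcod g) (fob g c) \<in> Hom (fcod g) (fob g c) (fob g c)" if "c \<in> Obj (fdom g)" for c
    using B.Idm_Hom is_functorD(3)[OF g that] .
  have 1: "U (c, k) \<in> lmap (vob G c) ?W"
    if "c \<in> Obj (fdom (f \<circ>\<^sub>F g))" "k \<in> Hom (fcod (f \<circ>\<^sub>F g)) (fob (f \<circ>\<^sub>F g) c) a" for c k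
    using lmap_comp[OF gen_lmap[OF g G _ id] gen_lmap[OF f pushG, of "fob g c" k a]] that
      is_functorD(3)[OF g] fg by (simp add: U_def)
  have 2: "U (c', k) (var G l v) = U (c, Cmp (fcod (f \<circ>\<^sub>F g)) k (far (f \<circ>\<^sub>F g) l)) v"
    if "l \<in> Hom (fdom (f \<circ>\<^sub>F g)) c c'" and "k \<in> Hom (fcod (f \<circ>\<^sub>F g)) (fob (f \<circ>\<^sub>F g) c') a"
      and v: "v \<in> carrier (vob G c)" for c c' l k v
  proof -
    have l: "l \<in> Hom (fdom g) c c'" and k: "k \<in> Hom (fcod f) (fob f (fob g c')) a" using that by simp_all
    have c: "c \<in> Obj (fdom g)" "c' \<in> Obj (fdom g)" using category.Hom_Obj[OF is_functorD(1)[OF g] l] by auto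
    note gl = is_functorD(4)[OF g l]
    \<comment> \<open>The arrow \<open>l\<close> is moved outwards in two stages:
      \<open>1 \<otimes> G(l) v\<close> becomes \<open>g(l) \<otimes> v\<close>, which is the action
      of \<open>g(l)\<close> on \<open>1 \<otimes> v\<close>; the outer relation then absorbs
      \<open>g(l)\<close> into \<open>k\<close>.\<close>
    have "gen g G (fob g c') (c', Idm (fcod g) (fob g c')) (var G l v)
        = gen g G (fob g c') (c, Cmp (fcod g) (far g l) (Idm (fcod g) (fob g c))) v"
      using gen_rel[OF g G l id[OF c(2)] v] B.Idm_left[OF gl] B.Idm_right[OF gl] by simp
    also have "\<dots> = var (push g G) (far g l) (gen g G (fob g c) (c, Idm (fcod g) (fob g c)) v)"
      using push_var_gen[OF g G gl c(1) id[OF c(1)] v] by simp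
    finally show ?thesis
      using gen_rel[OF f pushG _ k gen_closed[OF g G c(1) id[OF c(1)] v], of "far g l"] gl fg
      by (simp add: U_def)
  qed
  show "push_split f g G a \<in> lmap (vob (push (f \<circ>\<^sub>F g) G) a) ?W"
    unfolding eq by (rule push_desc(1)[OF fg_functor G(1) G' W 1 2])
  show "push_split f g G a (gen (f \<circ>\<^sub>F g) G a (c, k) v) =
        gen f (push g G) a (fob g c, k) (gen g G (fob g c) (c, Idm (fcod g) (fob g c)) v)"
    if "c \<in> Obj (fdom g)" "k \<in> Hom (fcod f) (fob f (fob g c)) a" "v \<in> carrier (vob G c)"
    unfolding eq using push_desc(2)[OF fg_functor G(1) G' W 1 2, where b = c and k = k and v = v] that by (simp add: U_def)
qed

end

section \<open>Colimits of diagrams with the same values\<close>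

lemma dsum_cong:
  assumes "\<And>i. i \<in> I \<Longrightarrow> V i = V' i"
  shows "dsum I V = dsum I V'" "dsum_in I V = dsum_in I V'"
  using assms by (auto simp: dsum_def dsum_in_def fun_eq_iff restrict_def PiE_iff cong: conj_cong)

lemma colim_cong:
  assumes vd: "vdom D = vdom D'" and vo: "\<And>p. p \<in> Obj (vdom D) \<Longrightarrow> vob D p = vob D' p"
    and va: "\<And>h. h \<in> Arr (vdom D) \<Longrightarrow> var D h = var D' h"
    and dm: "\<And>h. h \<in> Arr (vdom D) \<Longrightarrow> Dom (vdom D) h \<in> Obj (vdom D)"
  shows "colim D = colim D'" "colim_in D = colim_in D'"
proof -
  have ds: "dsum (Obj (vdom D)) (vob D) = dsum (Obj (vdom D)) (vob D')"
    "dsum_in (Obj (vdom D)) (vob D) = dsum_in (Obj (vdom D)) (vob D')"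
    by (rule dsum_cong, erule vo)+
  have rel: "colim_rel D = colim_rel D'"
    unfolding colim_rel_def ds(1) ds(2) vd[symmetric]
    by (intro arg_cong[where f = "LinearCombinations.module.span class_ring (dsum (Obj (vdom D)) (vob D'))"])
      (rule Collect_cong, metis va vo dm)
  show "colim D = colim D'" by (simp only: colim_def rel ds vd[symmetric])
  show "colim_in D = colim_in D'"
    by (intro ext) (simp only: colim_in_def rel ds vd[symmetric])
qed

text \<open>Comma categories and relations are built from the values of the functors on objects and
  arrows of the domain, so \<open>functor_eq\<close> yields equal modules and equal generators. This
  turns strict commutativity of a span of span maps into an identity instead of an
  isomorphism.\<close>

lemma diag_cong:
  assumes f: "is_functor f" and eq: "functor_eq f f'" and dom: "vdom G = fdom f" "vdom G' = fdom f"
    and ob: "\<And>b. b \<in> Obj (fdom f) \<Longrightarrow> vob G b = vob G' b"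
    and ar: "\<And>h. h \<in> Arr (fdom f) \<Longrightarrow> var G h = var G' h"
  shows "colim (diag f G a) = colim (diag f' G' a)" "gen f G a = gen f' G' a"
proof -
  have fd: "fdom f' = fdom f" "fcod f' = fcod f"
    and fe: "b \<in> Obj (fdom f) \<Longrightarrow> fob f' b = fob f b" "h \<in> Arr (fdom f) \<Longrightarrow> far f' h = far f h" for b h
    using eq by (auto simp: functor_eq_def)
  have far: "far f' h = far f h" if "h \<in> Hom (fdom f) b b'" for h b b'
    using fe(2) HomD(1)[OF that] .
  have comma: "comma f' a = comma f a"
    using fd fe(1) far by (auto simp: comma_def)
  let ?D = "diag f G a" and ?D' = "diag f' G' a"
  have vd: "vdom ?D' = vdom ?D" using comma by (simp add: comma_proj_def)
  have vo: "vob ?D p = vob ?D' p" if "p \<in> Obj (vdom ?D)" for p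
    using that ob by (auto simp: comma_proj_def comma_def)
  have va: "var ?D h = var ?D' h" if "h \<in> Arr (vdom ?D)" for h
    using that ar by (auto simp: comma_proj_def comma_def dest: HomD(1))
  have dm: "Dom (vdom ?D) h \<in> Obj (vdom ?D)" if "h \<in> Arr (vdom ?D)" for h
    using that by (auto simp: comma_proj_def comma_def)
  show "colim ?D = colim ?D'" "gen f G a = gen f' G' a"
    using colim_cong[OF vd[symmetric] vo va dm] by auto
qed

section \<open>Groupoid sums and the right unit\<close>

lemma finsum_bij:
  assumes "cmod M" "bij_betw h A B" "\<And>x. x \<in> B \<Longrightarrow> g x \<in> carrier M" "\<And>x. x \<in> A \<Longrightarrow> f x = g (h x)"
  shows "finsum M f A = finsum M g B"
proof -
  interpret M: Module.module "class_ring :: complex ring" M by fact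
  have B: "B = h ` A" and inj: "inj_on h A" using assms(2) by (auto simp: bij_betw_def)
  have "finsum M g B = finsum M (\<lambda>x. g (h x)) A"
    unfolding B by (rule M.finsum_reindex[OF _ inj]) (use assms(3) B in auto)
  also have "\<dots> = finsum M f A"
    by (rule M.finsum_cong') (use assms(3,4) B in auto)
  finally show ?thesis by simp
qed

lemma finsum_Sigma:
  assumes "cmod M" "finite A" "\<And>a. a \<in> A \<Longrightarrow> finite (B a)"
    and f: "\<And>a b. a \<in> A \<Longrightarrow> b \<in> B a \<Longrightarrow> f a b \<in> carrier M"
  shows "finsum M (\<lambda>a. finsum M (f a) (B a)) A = finsum M (\<lambda>(a, b). f a b) (Sigma A B)"
proof -
  interpret M: Module.module "class_ring :: complex ring" M by fact
  show ?thesis using assms(2-)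
  proof (induction A rule: finite_induct)
    case (insert a A)
    have S: "Sigma (insert a A) B = Pair a ` B a \<union> Sigma A B" by auto
    have "finsum M (\<lambda>(a, b). f a b) (Sigma (insert a A) B)
        = finsum M (\<lambda>(a, b). f a b) (Pair a ` B a) \<oplus>\<^bsub>M\<^esub> finsum M (\<lambda>(a, b). f a b) (Sigma A B)"
      unfolding S by (rule M.finsum_Un_disjoint) (use insert in auto)
    also have "finsum M (\<lambda>(a, b). f a b) (Pair a ` B a) = finsum M (f a) (B a)"
      by (subst M.finsum_reindex) (use insert in \<open>auto simp: inj_on_def\<close>)
    finally show ?case
      using insert by (subst M.finsum_insert) (auto intro!: M.finsum_closed)
  qed simp
qed

lemma finsum_smult_const:
  assumes "cmod M" "finite A" "x \<in> carrier M"
  shows "finsum M (\<lambda>i. w i \<odot>\<^bsub>M\<^esub> x) A = (\<Sum>i\<in>A. w i) \<odot>\<^bsub>M\<^esub> x"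
proof -
  interpret M: Module.module "class_ring :: complex ring" M by fact
  show ?thesis using assms(2)
  proof (induction A rule: finite_induct)
    case empty then show ?case using assms(3) M.smult_l_null[of x] by simp
  next
    case (insert i A)
    then show ?case
      using assms(3) M.smult_closed[of _ x] M.smult_l_distr[of "w i" "\<Sum>i\<in>A. w i" x]
      by (subst M.finsum_insert) auto
  qed
qed

lemma lmap_finsum_fun:
  assumes "cmod V" "cmod W" "finite I" and u: "\<And>i. i \<in> I \<Longrightarrow> u i \<in> lmap V W"
  shows "(\<lambda>v. finsum W (\<lambda>i. u i v) I) \<in> lmap V W"
proof -
  interpret W: Module.module "class_ring :: complex ring" W by fact
  show ?thesis
  proof (rule lmapI)
    fix v w assume v: "v \<in> carrier V"
    show "finsum W (\<lambda>i. u i v) I \<in> carrier W"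
      by (rule W.finsum_closed) (use v lmap_closed[OF u] in auto)
    show "finsum W (\<lambda>i. u i (c \<odot>\<^bsub>V\<^esub> v)) I = c \<odot>\<^bsub>W\<^esub> finsum W (\<lambda>i. u i v) I" for c
      using W.finsum_smult_ldistr[OF assms(3), of c "\<lambda>i. u i v"] v lmap_closed[OF u] lmap_smult[OF u]
        W.smult_closed[of c]
      by (auto simp: Pi_def intro!: W.finsum_cong')
    assume w: "w \<in> carrier V"
    have "finsum W (\<lambda>i. u i (v \<oplus>\<^bsub>V\<^esub> w)) I = finsum W (\<lambda>i. u i v \<oplus>\<^bsub>W\<^esub> u i w) I"
      by (rule W.finsum_cong') (use v w lmap_closed[OF u] lmap_add[OF u] in auto)
    also have "\<dots> = finsum W (\<lambda>i. u i v) I \<oplus>\<^bsub>W\<^esub> finsum W (\<lambda>i. u i w) I"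
      by (rule W.finsum_addf) (use v w lmap_closed[OF u] in auto)
    finally show "finsum W (\<lambda>i. u i (v \<oplus>\<^bsub>V\<^esub> w)) I = finsum W (\<lambda>i. u i v) I \<oplus>\<^bsub>W\<^esub> finsum W (\<lambda>i. u i w) I" .
  qed
qed

lemma lmap_smult_fun:
  assumes "cmod W" "u \<in> lmap V W"
  shows "(\<lambda>v. c \<odot>\<^bsub>W\<^esub> u v) \<in> lmap V W"
proof -
  interpret W: Module.module "class_ring :: complex ring" W by fact
  have comm: "c \<odot>\<^bsub>W\<^esub> (d \<odot>\<^bsub>W\<^esub> x) = d \<odot>\<^bsub>W\<^esub> (c \<odot>\<^bsub>W\<^esub> x)" if "x \<in> carrier W" for d x
    using W.smult_assoc1[of c d x] W.smult_assoc1[of d c x] that by (simp add: mult.commute)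
  show ?thesis
    by (rule lmapI)
      (simp_all add: lmap_closed[OF assms(2)] lmap_add[OF assms(2)] lmap_smult[OF assms(2)] comm
        W.smult_closed[simplified] W.smult_r_distr[simplified])
qed

section \<open>Inverses and hom-sets in a groupoid\<close>

context groupoid
begin

lemma is_inverse_inv_arr:
  assumes "f \<in> Arr C" shows "is_inverse C f (inv_arr C f)"
proof -
  obtain g where g: "is_inverse C f g" using all_invertible[OF assms] by (auto simp: invertible_arr_def)
  have "g' = g" if "is_inverse C f g'" for g'
  proof -
    have f: "f \<in> Hom C (Dom C f) (Cod C f)" using assms by (simp add: Hom_def)
    have gh: "g \<in> Hom C (Cod C f) (Dom C f)" "g' \<in> Hom C (Cod C f) (Dom C f)"
      using g that by (auto simp: is_inverse_def)
    show ?thesis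
      using Cmp_assoc[OF gh(1) f gh(2)] Idm_left[OF gh(1)] Idm_right[OF gh(2)] g that
      by (simp add: is_inverse_def)
  qed
  then show ?thesis unfolding inv_arr_def by (rule theI[of "is_inverse C f", OF g])
qed

lemma inv_arr:
  assumes "f \<in> Hom C a b"
  shows "inv_arr C f \<in> Hom C b a" "Cmp C (inv_arr C f) f = Idm C a" "Cmp C f (inv_arr C f) = Idm C b"
  using is_inverse_inv_arr[OF HomD(1)[OF assms]] HomD[OF assms] by (auto simp: is_inverse_def)

lemma inv_arr_eqI:
  assumes f: "f \<in> Hom C a b" and g: "g \<in> Hom C b a" and "Cmp C g f = Idm C a"
  shows "inv_arr C f = g"
  using Cmp_assoc[OF inv_arr(1)[OF f] f g] inv_arr[OF f] Idm_left[OF inv_arr(1)[OF f]] Idm_right[OF g] assms(3)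
  by simp

lemma Cmp_inv_cancel:
  assumes f: "f \<in> Hom C a b"
  shows "g \<in> Hom C b c \<Longrightarrow> Cmp C (Cmp C g f) (inv_arr C f) = g"
    "g \<in> Hom C a c \<Longrightarrow> Cmp C (Cmp C g (inv_arr C f)) f = g"
    "g \<in> Hom C c a \<Longrightarrow> Cmp C (inv_arr C f) (Cmp C f g) = g"
    "g \<in> Hom C c b \<Longrightarrow> Cmp C f (Cmp C (inv_arr C f) g) = g"
  using inv_arr[OF f] Cmp_assoc[OF inv_arr(1)[OF f] f, of g c] Cmp_assoc[OF f inv_arr(1)[OF f], of g c]
    Cmp_assoc[of g c a f b, OF _ f inv_arr(1)[OF f]] Cmp_assoc[of g c b, OF _ inv_arr(1)[OF f] f]
    Idm_right[of g b c] Idm_right[of g a c] Idm_left[of g c a] Idm_left[of g c b]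
  by auto

lemma inv_arr_Cmp:
  assumes f: "f \<in> Hom C a b" and g: "g \<in> Hom C b c"
  shows "inv_arr C (Cmp C g f) = Cmp C (inv_arr C f) (inv_arr C g)"
proof (rule inv_arr_eqI[OF Cmp_Hom[OF f g]])
  show "Cmp C (inv_arr C f) (inv_arr C g) \<in> Hom C c a"
    using Cmp_Hom[OF inv_arr(1)[OF g] inv_arr(1)[OF f]] .
  show "Cmp C (Cmp C (inv_arr C f) (inv_arr C g)) (Cmp C g f) = Idm C a"
    using Cmp_assoc[OF f g Cmp_Hom[OF inv_arr(1)[OF g] inv_arr(1)[OF f]]]
      Cmp_inv_cancel(2)[OF g inv_arr(1)[OF f]] inv_arr[OF f] by simp
qed

lemma isomorphic_iff: "isomorphic C a b \<longleftrightarrow> Hom C a b \<noteq> {}"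
  using all_invertible[OF HomD(1)] Hom_Obj by (fastforce simp: isomorphic_def)

lemma equiv_isomorphic: "equiv (Obj C) {(a, b). isomorphic C a b}"
proof (rule equivI)
  show "{(a, b). isomorphic C a b} \<subseteq> Obj C \<times> Obj C" by (auto simp: isomorphic_def)
  show "refl_on (Obj C) {(a, b). isomorphic C a b}"
    using Idm_Hom by (auto simp: refl_on_def isomorphic_iff)
  show "sym {(a, b). isomorphic C a b}"
    using inv_arr(1) by (auto simp: sym_def isomorphic_iff)
  show "trans {(a, b). isomorphic C a b}"
    using Cmp_Hom by (fastforce simp: trans_def isomorphic_iff)
qed

lemma card_Hom:
  assumes s: "s \<in> Hom C a b" and t: "t \<in> Hom C c d"
  shows "card (Hom C a c) = card (Hom C b d)"
proof (rule bij_betw_same_card)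
  show "bij_betw (\<lambda>h. Cmp C (Cmp C t h) (inv_arr C s)) (Hom C a c) (Hom C b d)"
  proof (rule bij_betw_byWitness[where f' = "\<lambda>h. Cmp C (inv_arr C t) (Cmp C h s)"])
    show "\<forall>h\<in>Hom C a c. Cmp C (inv_arr C t) (Cmp C (Cmp C (Cmp C t h) (inv_arr C s)) s) = h"
      using Cmp_inv_cancel(2)[OF s Cmp_Hom[OF _ t]] Cmp_inv_cancel(3)[OF t] by auto
    show "\<forall>h\<in>Hom C b d. Cmp C (Cmp C t (Cmp C (inv_arr C t) (Cmp C h s))) (inv_arr C s) = h"
      using Cmp_inv_cancel(4)[OF t Cmp_Hom[OF s]] Cmp_inv_cancel(1)[OF s] by auto
    show "(\<lambda>h. Cmp C (Cmp C t h) (inv_arr C s)) ` Hom C a c \<subseteq> Hom C b d"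
      using Cmp_Hom[OF inv_arr(1)[OF s] Cmp_Hom[OF _ t]] by auto
    show "(\<lambda>h. Cmp C (inv_arr C t) (Cmp C h s)) ` Hom C b d \<subseteq> Hom C a c"
      using Cmp_Hom[OF Cmp_Hom[OF s] inv_arr(1)[OF t]] by auto
  qed
qed

end

lemma functor_inv_arr:
  assumes F: "is_functor F" and "groupoid (fdom F)" "groupoid (fcod F)" and f: "f \<in> Hom (fdom F) a b"
  shows "far F (inv_arr (fdom F) f) = inv_arr (fcod F) (far F f)"
proof -
  interpret B: groupoid "fdom F" by fact
  interpret A: groupoid "fcod F" by fact
  show ?thesis
    using A.inv_arr_eqI[OF is_functorD(4)[OF F f] is_functorD(4)[OF F B.inv_arr(1)[OF f]]]
      is_functorD(6)[OF F f B.inv_arr(1)[OF f]] B.inv_arr(2)[OF f] is_functorD(5)[OF F] B.Hom_Obj[OF f]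
    by simp
qed

text \<open>An intrinsic form of essential finiteness, free of a chosen equivalence. It can be
  established for a weak pullback directly, from finite hom-sets and a finite covering
  family.\<close>

definition finite_type :: "('o, 'm) cat \<Rightarrow> bool" where
  "finite_type C \<longleftrightarrow> groupoid C \<and> finite (iso_classes C) \<and> (\<forall>a b. finite (Hom C a b))"

section \<open>Covering families and weighted sums\<close>

definition covering :: "('o, 'm) cat \<Rightarrow> 'o set \<Rightarrow> bool" where
  "covering C S \<longleftrightarrow> finite S \<and> S \<subseteq> Obj C \<and> (\<forall>b \<in> Obj C. \<exists>s \<in> S. Hom C b s \<noteq> {})"

text \<open>For a covering family \<open>S\<close> the weights \<open>1 / star_card C S b\<close> of the members \<open>b\<close> of one
  isomorphism class add up to \<open>1 / #Aut(b)\<close>. Unlike a choice of representatives, covering families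
  are compatible with weak pullbacks.\<close>

definition star_card :: "('o, 'm) cat \<Rightarrow> 'o set \<Rightarrow> 'o \<Rightarrow> nat" where
  "star_card C S b = card {h \<in> Arr C. Dom C h = b \<and> Cod C h \<in> S}"

lemma covering_exists:
  assumes "finite_type C" shows "\<exists>S. covering C S"
proof -
  interpret groupoid C using assms by (simp add: finite_type_def)
  let ?r = "{(a, b). isomorphic C a b}"
  have fin: "finite (iso_classes C)" using assms by (simp add: finite_type_def)
  have rep: "(SOME b. b \<in> c) \<in> c" if "c \<in> iso_classes C" for c
    using in_quotient_imp_non_empty[OF equiv_isomorphic] that
    by (auto simp: iso_classes_def some_in_eq)
  have "covering C ((\<lambda>c. SOME b. b \<in> c) ` iso_classes C)"
    unfolding covering_def
  proof (intro conjI ballI)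
    show "finite ((\<lambda>c. SOME b. b \<in> c) ` iso_classes C)" using fin by simp
    show "(\<lambda>c. SOME b. b \<in> c) ` iso_classes C \<subseteq> Obj C"
      using rep in_quotient_imp_subset[OF equiv_isomorphic] by (auto simp: iso_classes_def)
    fix b assume b: "b \<in> Obj C"
    then have c: "?r `` {b} \<in> iso_classes C" by (auto simp: iso_classes_def quotient_def)
    then have "Hom C b (SOME x. x \<in> ?r `` {b}) \<noteq> {}"
      using rep[OF c] by (simp add: isomorphic_iff)
    then show "\<exists>s\<in>(\<lambda>c. SOME b. b \<in> c) ` iso_classes C. Hom C b s \<noteq> {}" using c by blast
  qed
  then show ?thesis ..
qed

text \<open>Sort the arrows from \<open>b\<close> into \<open>S\<close> by their target: the targets
  that occur are the members of \<open>S \<inter> c\<close>, and each of the corresponding hom-sets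
  has as many elements as the automorphism group of \<open>r\<close>. The intersection is nonempty
  because \<open>S\<close> covers.\<close>

lemma star_card:
  assumes C: "finite_type C" and S: "covering C S" and c: "c \<in> iso_classes C" and b: "b \<in> c" "r \<in> c"
  shows "star_card C S b = card (S \<inter> c) * card (Hom C r r)" "card (S \<inter> c) \<noteq> 0" "card (Hom C r r) \<noteq> 0"
proof -
  interpret groupoid C using C by (simp add: finite_type_def)
  have fin: "finite (Hom C a b)" for a b using C by (simp add: finite_type_def)
  have cObj: "c \<subseteq> Obj C" using in_quotient_imp_subset[OF equiv_isomorphic] c by (simp add: iso_classes_def)
  have c_iff: "x \<in> c \<longleftrightarrow> Hom C a x \<noteq> {}" if "a \<in> c" for a x
    using in_quotient_imp_in_rel[OF equiv_isomorphic, of c a x] in_quotient_imp_closed[OF equiv_isomorphic, of c a x]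
      c that by (auto simp: iso_classes_def isomorphic_iff)
  have "{h \<in> Arr C. Dom C h = b \<and> Cod C h \<in> S} = (\<Union>s\<in>S \<inter> c. Hom C b s)"
    using c_iff[OF b(1)] by (auto simp: Hom_def)
  also have "card \<dots> = (\<Sum>s\<in>S \<inter> c. card (Hom C b s))"
    by (rule card_UN_disjoint) (use S fin in \<open>auto simp: covering_def Hom_def\<close>)
  also have "\<dots> = (\<Sum>s\<in>S \<inter> c. card (Hom C r r))"
  proof (rule sum.cong[OF refl])
    fix s assume "s \<in> S \<inter> c"
    then have "Hom C b r \<noteq> {}" "Hom C s r \<noteq> {}" using c_iff b by blast+
    then show "card (Hom C b s) = card (Hom C r r)" using card_Hom by blast
  qed
  finally show "star_card C S b = card (S \<inter> c) * card (Hom C r r)" by (simp add: star_card_def)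
  have "b \<in> Obj C" using b cObj by blast
  then obtain s where "s \<in> S" "Hom C b s \<noteq> {}" using S unfolding covering_def by blast
  then have "s \<in> S \<inter> c" using c_iff[OF b(1)] by blast
  moreover have "finite (S \<inter> c)" using S by (simp add: covering_def)
  ultimately show "card (S \<inter> c) \<noteq> 0" by auto
  have "Hom C r r \<noteq> {}" using Idm_Hom b cObj by blast
  then show "card (Hom C r r) \<noteq> 0" using fin by simp
qed

text \<open>Group \<open>S\<close> by classes. By invariance the \<open>card (S \<inter> c)\<close>
  summands in a class agree, and the first factor of \<open>star_card\<close> cancels against their
  number. This is where the chosen representatives disappear.\<close>

lemma finsum_iso_classes:
  assumes C: "finite_type C" and S: "covering C S" and M: "cmod M"
    and closed: "\<And>b. b \<in> Obj C \<Longrightarrow> \<phi> b \<in> carrier M"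
    and inv: "\<And>b b' h. h \<in> Hom C b b' \<Longrightarrow> \<phi> b = \<phi> b'"
  shows "finsum M (\<lambda>c. (1 / of_nat (card (Hom C (SOME b. b \<in> c) (SOME b. b \<in> c)))) \<odot>\<^bsub>M\<^esub> \<phi> (SOME b. b \<in> c))
      (iso_classes C) = finsum M (\<lambda>b. (1 / of_nat (star_card C S b)) \<odot>\<^bsub>M\<^esub> \<phi> b) S"
proof -
  interpret groupoid C using C by (simp add: finite_type_def)
  interpret M: Module.module "class_ring :: complex ring" M by fact
  note smult_closed = M.smult_closed[simplified]
  have cObj: "c \<subseteq> Obj C" if "c \<in> iso_classes C" for c
    using in_quotient_imp_subset[OF equiv_isomorphic] that by (simp add: iso_classes_def)
  have finS: "finite S" and SObj: "S \<subseteq> Obj C" using S by (simp_all add: covering_def)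
  have rep: "(SOME b. b \<in> c) \<in> c" if "c \<in> iso_classes C" for c
    using in_quotient_imp_non_empty[OF equiv_isomorphic] that
    by (auto simp: iso_classes_def some_in_eq)
  have un: "S = (\<Union>c\<in>iso_classes C. S \<inter> c)"
    using Union_quotient[OF equiv_isomorphic] SObj by (auto simp: iso_classes_def)
  have "finsum M (\<lambda>b. (1 / of_nat (star_card C S b)) \<odot>\<^bsub>M\<^esub> \<phi> b) (\<Union>c\<in>iso_classes C. S \<inter> c)
      = finsum M (\<lambda>c. finsum M (\<lambda>b. (1 / of_nat (star_card C S b)) \<odot>\<^bsub>M\<^esub> \<phi> b) (S \<inter> c)) (iso_classes C)"
  proof (rule M.add.finprod_UN_disjoint)
    show "finite (iso_classes C)" using C by (simp add: finite_type_def)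
    show "pairwise (\<lambda>i j. disjnt (S \<inter> i) (S \<inter> j)) (iso_classes C)"
      using quotient_disj[OF equiv_isomorphic] by (fastforce simp: pairwise_def disjnt_def iso_classes_def)
  qed (use finS SObj closed smult_closed in auto)
  also have "\<dots> = finsum M (\<lambda>c. (1 / of_nat (card (Hom C (SOME b. b \<in> c) (SOME b. b \<in> c)))) \<odot>\<^bsub>M\<^esub>
      \<phi> (SOME b. b \<in> c)) (iso_classes C)"
  proof (rule M.finsum_cong')
    fix c assume c: "c \<in> iso_classes C"
    let ?r = "SOME b. b \<in> c"
    have r: "\<phi> ?r \<in> carrier M" using rep[OF c] cObj[OF c] closed by blast
    have "finsum M (\<lambda>b. (1 / of_nat (star_card C S b)) \<odot>\<^bsub>M\<^esub> \<phi> b) (S \<inter> c)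
        = finsum M (\<lambda>b. (1 / of_nat (card (S \<inter> c) * card (Hom C ?r ?r))) \<odot>\<^bsub>M\<^esub> \<phi> ?r) (S \<inter> c)"
    proof (rule M.finsum_cong')
      fix b assume b: "b \<in> S \<inter> c"
      then have "isomorphic C b ?r"
        using in_quotient_imp_in_rel[OF equiv_isomorphic, of c b ?r] c rep[OF c] by (auto simp: iso_classes_def)
      then have "\<phi> b = \<phi> ?r" using inv by (auto simp: isomorphic_iff)
      then show "(1 / of_nat (star_card C S b)) \<odot>\<^bsub>M\<^esub> \<phi> b
          = (1 / of_nat (card (S \<inter> c) * card (Hom C ?r ?r))) \<odot>\<^bsub>M\<^esub> \<phi> ?r"
        using star_card(1)[OF C S c _ rep[OF c], of b] b by simp
    qed (use r smult_closed in auto)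
    also have "\<dots> = (\<Sum>b\<in>S \<inter> c. 1 / of_nat (card (S \<inter> c) * card (Hom C ?r ?r))) \<odot>\<^bsub>M\<^esub> \<phi> ?r"
      by (rule finsum_smult_const[OF M _ r]) (use finS in simp)
    also have "(\<Sum>b\<in>S \<inter> c. 1 / of_nat (card (S \<inter> c) * card (Hom C ?r ?r)) :: complex) = 1 / of_nat (card (Hom C ?r ?r))"
      using star_card(2)[OF C S c rep[OF c] rep[OF c]] by (simp add: field_simps)
    finally show "finsum M (\<lambda>b. (1 / of_nat (star_card C S b)) \<odot>\<^bsub>M\<^esub> \<phi> b) (S \<inter> c)
        = (1 / of_nat (card (Hom C ?r ?r))) \<odot>\<^bsub>M\<^esub> \<phi> ?r" .
  qed (use rep cObj closed smult_closed in \<open>auto simp: Pi_def subset_eq\<close>)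
  finally show ?thesis using un by simp
qed

section \<open>The right unit as a sum over a covering family\<close>

context
  fixes f :: "('b, 'n, 'a, 'm) fctr" and F :: "('a, 'm, 'v) vfunctor"
  assumes f: "is_functor f" and B: "finite_type (fdom f)" and A: "finite_type (fcod f)"
    and F: "mfunctor F" "vdom F = fcod f"
begin

private lemma pF: "mfunctor (pull f F)" "vdom (pull f F) = fdom f"
  using pull_mfunctor[OF f F] by simp_all

private abbreviation (input) "P a \<equiv> vob (push f (pull f F)) a"

private abbreviation (input) "\<psi> a v b g \<equiv> gen f (pull f F) a (b, inv_arr (fcod f) g) (var F g v)"

private lemma P_cmod: "cmod (P a)"
  using push_cmod[OF f pF] .

private lemma psi_lmap:
  assumes "b \<in> Obj (fdom f)" "g \<in> Hom (fcod f) a (fob f b)"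
  shows "(\<lambda>v. \<psi> a v b g) \<in> lmap (vob F a) (P a)"
proof -
  interpret A: groupoid "fcod f" using A by (simp add: finite_type_def)
  show ?thesis
    using lmap_comp[OF mfunctorD(3)[OF F(1), unfolded F(2), OF assms(2)]
        gen_lmap[OF f pF assms(1) A.inv_arr(1)[OF assms(2)], simplified]] .
qed

text \<open>For each object \<open>b\<close> the inner sum over \<open>g\<close> depends only on the
  isomorphism class of \<open>b\<close>, so \<open>finsum_iso_classes\<close> applies; the double
  sum is then flattened to one sum over pairs, the form used in all later reindexings.\<close>

lemma unit_R_sum:
  assumes S: "covering (fdom f) S" and v: "v \<in> carrier (vob F a)"
  shows "unit_R f F a v = finsum (P a) (\<lambda>(b, g). (1 / of_nat (star_card (fdom f) S b)) \<odot>\<^bsub>P a\<^esub> \<psi> a v b g)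
    (SIGMA b:S. Hom (fcod f) a (fob f b))"
proof -
  interpret A: groupoid "fcod f" using A by (simp add: finite_type_def)
  interpret B: groupoid "fdom f" using B by (simp add: finite_type_def)
  interpret P: Module.module "class_ring :: complex ring" "P a" by (rule P_cmod)
  have finA: "finite (Hom (fcod f) x y)" for x y using A by (simp add: finite_type_def)
  have psi_closed: "\<psi> a v b g \<in> carrier (P a)"
    if "b \<in> Obj (fdom f)" "g \<in> Hom (fcod f) a (fob f b)" for b g
    using lmap_closed[OF psi_lmap[OF that] v] .
  define \<phi> where "\<phi> b = finsum (P a) (\<psi> a v b) (Hom (fcod f) a (fob f b))" for b
  have \<phi>_closed: "\<phi> b \<in> carrier (P a)" if "b \<in> Obj (fdom f)" for b
    unfolding \<phi>_def by (rule P.finsum_closed) (use psi_closed[OF that] in auto)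
  \<comment> \<open>Replace \<open>g\<close> by \<open>f(h) g\<close>. Since
    \<open>(f(h) g)\<inverse> f(h) = g\<inverse>\<close>, the balancing relation along
    \<open>h\<close> identifies the summand of \<open>g\<close> at \<open>b\<close> with that of
    \<open>f(h) g\<close> at \<open>b'\<close>.\<close>
  have \<phi>_inv: "\<phi> b = \<phi> b'" if h: "h \<in> Hom (fdom f) b b'" for b b' h
    unfolding \<phi>_def
  proof (rule finsum_bij[OF P_cmod])
    note b = B.Hom_Obj[OF h] and fh = is_functorD(4)[OF f h]
    show "bij_betw (Cmp (fcod f) (far f h)) (Hom (fcod f) a (fob f b)) (Hom (fcod f) a (fob f b'))"
    proof (rule bij_betw_byWitness[where f' = "Cmp (fcod f) (inv_arr (fcod f) (far f h))"])
      show "\<forall>g\<in>Hom (fcod f) a (fob f b). Cmp (fcod f) (inv_arr (fcod f) (far f h)) (Cmp (fcod f) (far f h) g) = g"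
        using A.Cmp_inv_cancel(3)[OF fh] by blast
      show "\<forall>g\<in>Hom (fcod f) a (fob f b'). Cmp (fcod f) (far f h) (Cmp (fcod f) (inv_arr (fcod f) (far f h)) g) = g"
        using A.Cmp_inv_cancel(4)[OF fh] by blast
    qed (use A.Cmp_Hom[OF _ fh] A.Cmp_Hom[OF _ A.inv_arr(1)[OF fh]] in auto)
    show "\<psi> a v b' g \<in> carrier (P a)" if "g \<in> Hom (fcod f) a (fob f b')" for g
      using psi_closed[OF _ that] b by blast
    fix g assume g: "g \<in> Hom (fcod f) a (fob f b)"
    note hg = A.Cmp_Hom[OF g fh]
    have inv: "Cmp (fcod f) (inv_arr (fcod f) (Cmp (fcod f) (far f h) g)) (far f h) = inv_arr (fcod f) g"
      using A.Cmp_inv_cancel(2)[OF fh A.inv_arr(1)[OF g]] A.inv_arr_Cmp[OF g fh] by simp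
    have "var F g v \<in> carrier (vob (pull f F) b)"
      using mfunctor_closed[OF F(1) _ v] g F by simp
    then have "gen f (pull f F) a (b, inv_arr (fcod f) g) (var F g v)
        = gen f (pull f F) a (b', inv_arr (fcod f) (Cmp (fcod f) (far f h) g)) (var F (far f h) (var F g v))"
      using gen_rel[OF f pF h A.inv_arr(1)[OF hg], of "var F g v"] inv by simp
    then show "\<psi> a v b g = \<psi> a v b' (Cmp (fcod f) (far f h) g)"
      using mfunctorD(5)[OF F(1), of g a "fob f b" "far f h" "fob f b'" v] g fh v F by simp
  qed
  have rep: "(SOME b. b \<in> c) \<in> c" if "c \<in> iso_classes (fdom f)" for c
    using in_quotient_imp_non_empty[OF B.equiv_isomorphic] that
    by (auto simp: iso_classes_def some_in_eq)
  have repObj: "(SOME b. b \<in> c) \<in> Obj (fdom f)" if "c \<in> iso_classes (fdom f)" for c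
    using rep[OF that] in_quotient_imp_subset[OF B.equiv_isomorphic] that by (auto simp: iso_classes_def)
  \<comment> \<open>The restriction to classes with \<open>f(b)\<close> isomorphic to
    \<open>a\<close> can be lifted: for any other class there is no
    \<open>g : a \<rightarrow> f(b)\<close>, so its summand is an empty sum.\<close>
  have "unit_R f F a v = finsum (P a) (\<lambda>c. (1 / of_nat (card (Hom (fdom f) (SOME b. b \<in> c) (SOME b. b \<in> c))))
      \<odot>\<^bsub>P a\<^esub> \<phi> (SOME b. b \<in> c)) (iso_classes (fdom f))"
    unfolding unit_R_def Let_def \<phi>_def[symmetric]
  proof (rule P.add.finprod_mono_neutral_cong_left)
    show "finite (iso_classes (fdom f))" using B by (simp add: finite_type_def)
    fix c assume c: "c \<in> iso_classes (fdom f) - {c \<in> iso_classes (fdom f). isomorphic (fcod f) (fob f (SOME b. b \<in> c)) a}"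
    then have "Hom (fcod f) a (fob f (SOME b. b \<in> c)) = {}"
      using A.inv_arr(1) by (auto simp: A.isomorphic_iff)
    then show "(1 / of_nat (card (Hom (fdom f) (SOME b. b \<in> c) (SOME b. b \<in> c)))) \<odot>\<^bsub>P a\<^esub> \<phi> (SOME b. b \<in> c)
        = \<zero>\<^bsub>P a\<^esub>"
      using P.smult_r_null by (simp add: \<phi>_def)
  qed (use \<phi>_closed repObj P.smult_closed in auto)
  also have "\<dots> = finsum (P a) (\<lambda>b. (1 / of_nat (star_card (fdom f) S b)) \<odot>\<^bsub>P a\<^esub> \<phi> b) S"
    by (rule finsum_iso_classes[OF B S P_cmod \<phi>_closed \<phi>_inv])
  also have "\<dots> = finsum (P a) (\<lambda>b. finsum (P a)
      (\<lambda>g. (1 / of_nat (star_card (fdom f) S b)) \<odot>\<^bsub>P a\<^esub> \<psi> a v b g) (Hom (fcod f) a (fob f b))) S"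
  proof (rule P.finsum_cong')
    fix b assume "b \<in> S"
    then have b: "b \<in> Obj (fdom f)" using S by (auto simp: covering_def)
    show "(1 / of_nat (star_card (fdom f) S b)) \<odot>\<^bsub>P a\<^esub> \<phi> b = finsum (P a)
      (\<lambda>g. (1 / of_nat (star_card (fdom f) S b)) \<odot>\<^bsub>P a\<^esub> \<psi> a v b g) (Hom (fcod f) a (fob f b))"
      unfolding \<phi>_def using P.finsum_smult_ldistr[OF finA] psi_closed[OF b] by simp
  next
    show "(\<lambda>b. finsum (P a) (\<lambda>g. (1 / of_nat (star_card (fdom f) S b)) \<odot>\<^bsub>P a\<^esub> \<psi> a v b g)
        (Hom (fcod f) a (fob f b))) \<in> S \<rightarrow> carrier (P a)"
      using S psi_closed P.smult_closed by (auto simp: covering_def subset_eq intro!: P.finsum_closed)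
  qed simp
  also have "\<dots> = finsum (P a) (\<lambda>(b, g). (1 / of_nat (star_card (fdom f) S b)) \<odot>\<^bsub>P a\<^esub> \<psi> a v b g)
      (SIGMA b:S. Hom (fcod f) a (fob f b))"
    by (rule finsum_Sigma[OF P_cmod])
      (use S finA psi_closed P.smult_closed in \<open>auto simp: covering_def subset_eq\<close>)
  finally show ?thesis .
qed

text \<open>One covering family of the domain of \<open>f\<close> serves all objects
  \<open>a\<close>, so the sums for the two ends of an arrow \<open>u\<close> can be matched term by
  term.\<close>

lemma unit_R_linear_nat: "linear_nat F (push f (pull f F)) (unit_R f F)"
  unfolding linear_nat_def
proof (intro conjI allI ballI)
  interpret A: groupoid "fcod f" using A by (simp add: finite_type_def)
  have finA: "finite (Hom (fcod f) x y)" for x y using A by (simp add: finite_type_def)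
  obtain S where S: "covering (fdom f) S" using covering_exists[OF B] ..
  then have finS: "finite S" and SObj: "\<And>b. b \<in> S \<Longrightarrow> b \<in> Obj (fdom f)" by (auto simp: covering_def)
  define T where "T a = (SIGMA b:S. Hom (fcod f) a (fob f b))" for a
  define \<xi> where "\<xi> a v = (\<lambda>(b, g). (1 / of_nat (star_card (fdom f) S b)) \<odot>\<^bsub>P a\<^esub> \<psi> a v b g)" for a v
  have finT: "finite (T a)" for a using finS finA by (simp add: T_def)
  have sum: "unit_R f F a v = finsum (P a) (\<xi> a v) (T a)" if "v \<in> carrier (vob F a)" for a v
    using unit_R_sum[OF S that] by (simp add: T_def \<xi>_def)
  have \<xi>: "(\<lambda>v. \<xi> a v i) \<in> lmap (vob F a) (P a)" if "i \<in> T a" for a i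
    using that lmap_smult_fun[OF P_cmod psi_lmap] SObj by (auto simp: T_def \<xi>_def)
  show "unit_R f F a \<in> lmap (vob F a) (P a)" if a: "a \<in> Obj (vdom F)" for a
    using lmap_finsum_fun[OF mfunctorD(2)[OF F(1) a] P_cmod finT \<xi>]
    by (rule lmap_cong[OF mfunctorD(2)[OF F(1) a]]) (simp_all add: sum)
  fix a a' u v assume "u \<in> Hom (vdom F) a a'" and v: "v \<in> carrier (vob F a)"
  then have u: "u \<in> Hom (fcod f) a a'" using F by simp
  have Fu: "var F u v \<in> carrier (vob F a')" using mfunctor_closed[OF F(1) _ v] u F by simp
  have "unit_R f F a' (var F u v) = finsum (P a') (\<xi> a' (var F u v)) (T a')"
    by (rule sum[OF Fu])
  \<comment> \<open>The terms are matched by \<open>g \<mapsto> g u\<close>: since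
    \<open>u (g u)\<inverse> = g\<inverse>\<close>, the action of \<open>u\<close> on the term of
    \<open>g u\<close> at \<open>a\<close> is the term of \<open>g\<close> at
    \<open>a'\<close>.\<close>
  also have "\<dots> = finsum (P a') (\<lambda>i. var (push f (pull f F)) u (\<xi> a v i)) (T a)"
  proof (rule finsum_bij[OF P_cmod])
    show "bij_betw (\<lambda>(b, g). (b, Cmp (fcod f) g u)) (T a') (T a)"
      by (rule bij_betw_byWitness[where f' = "\<lambda>(b, g). (b, Cmp (fcod f) g (inv_arr (fcod f) u))"])
        (use A.Cmp_inv_cancel(1,2)[OF u] A.Cmp_Hom[OF u] A.Cmp_Hom[OF A.inv_arr(1)[OF u]] in \<open>auto simp: T_def\<close>)
    show "var (push f (pull f F)) u (\<xi> a v i) \<in> carrier (P a')" if "i \<in> T a" for i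
      using lmap_closed[OF push_var_lmap[OF f pF u] lmap_closed[OF \<xi>[OF that] v]] .
    fix i assume "i \<in> T a'"
    then obtain b g where i: "i = (b, g)" "b \<in> Obj (fdom f)" and g: "g \<in> Hom (fcod f) a' (fob f b)"
      using SObj by (auto simp: T_def)
    note gu = A.Cmp_Hom[OF u g]
    have Fgu: "var F (Cmp (fcod f) g u) v \<in> carrier (vob (pull f F) b)"
      using mfunctor_closed[OF F(1) _ v] gu F by simp
    have "Cmp (fcod f) u (inv_arr (fcod f) (Cmp (fcod f) g u)) = inv_arr (fcod f) g"
      using A.inv_arr_Cmp[OF u g] A.Cmp_inv_cancel(4)[OF u A.inv_arr(1)[OF g]] by simp
    then have "var (push f (pull f F)) u (\<psi> a v b (Cmp (fcod f) g u)) = \<psi> a' (var F u v) b g"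
      using push_var_gen[OF f pF u i(2) A.inv_arr(1)[OF gu] Fgu]
        mfunctorD(5)[OF F(1), of u a a' g "fob f b" v] u g v F by simp
    then show "\<xi> a' (var F u v) i = var (push f (pull f F)) u (\<xi> a v (case i of (b, g) \<Rightarrow> (b, Cmp (fcod f) g u)))"
      using lmap_smult[OF push_var_lmap[OF f pF u] lmap_closed[OF psi_lmap[OF i(2) gu] v]] i(1)
      by (simp add: \<xi>_def)
  qed
  also have "\<dots> = var (push f (pull f F)) u (unit_R f F a v)"
    unfolding sum[OF v]
    by (rule lmap_finsum[OF P_cmod P_cmod push_var_lmap[OF f pF u], symmetric])
      (rule lmap_closed[OF \<xi> v])
  finally show "unit_R f F a' (var F u v) = var (push f (pull f F)) u (unit_R f F a v)" .
qed

end

section \<open>Linearization of spans of span maps\<close>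

text \<open>Every isomorphism class is the class of some member of \<open>S\<close>, so there are at
  most as many classes as members.\<close>

lemma (in groupoid) finite_typeI:
  assumes fin: "\<And>a b. finite (Hom C a b)" and S: "covering C S"
  shows "finite_type C"
proof -
  have "iso_classes C \<subseteq> (\<lambda>s. {(a, b). isomorphic C a b} `` {s}) ` S"
  proof
    fix c assume "c \<in> iso_classes C"
    then obtain b where b: "b \<in> Obj C" "c = {(a, b). isomorphic C a b} `` {b}"
      by (auto simp: iso_classes_def elim: quotientE)
    then obtain s where s: "s \<in> S" "Hom C b s \<noteq> {}" using S unfolding covering_def by blast
    then have "c = {(a, b). isomorphic C a b} `` {s}"
      using equiv_class_eq[OF equiv_isomorphic, of b s] b by (simp add: isomorphic_iff)
    then show "c \<in> (\<lambda>s. {(a, b). isomorphic C a b} `` {s}) ` S" using s by blast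
  qed
  moreover have "finite S" using S by (simp add: covering_def)
  ultimately show ?thesis
    using fin groupoid_axioms by (auto simp: finite_type_def intro: finite_subset)
qed

text \<open>The natural isomorphism from \<open>G F\<close> to the identity makes \<open>F\<close>
  faithful and makes it reflect isomorphism of objects; finiteness of arrows and objects of
  \<open>D\<close> thus bounds hom-sets and classes of \<open>C\<close>.\<close>

lemma ess_finite_finite_type:
  assumes "ess_finite_groupoid C" shows "finite_type C"
proof -
  interpret C: groupoid C using assms by (simp add: ess_finite_groupoid_def)
  obtain D :: "(nat, nat) cat" and F G where D: "groupoid D" "finite (Obj D)" "finite (Arr D)"
    and F: "is_functor F" "fdom F = C" "fcod F = D" and G: "is_functor G" "fdom G = D" "fcod G = C"
    and nat: "naturally_isomorphic (G \<circ>\<^sub>F F) (fid C)"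
    using assms by (auto simp: ess_finite_groupoid_def equivalent_def)
  obtain \<theta> where \<theta>: "\<And>a. a \<in> Obj C \<Longrightarrow> \<theta> a \<in> Hom C (fob G (fob F a)) a"
    and \<theta>_nat: "\<And>a b f. f \<in> Hom C a b \<Longrightarrow> Cmp C (\<theta> b) (far G (far F f)) = Cmp C f (\<theta> a)"
    using nat F G by (auto simp: naturally_isomorphic_def fid_def) blast
  have "finite (Hom C a b)" for a b
  proof (rule inj_on_finite)
    show "inj_on (far F) (Hom C a b)"
    proof (rule inj_onI)
      fix f g assume f: "f \<in> Hom C a b" and g: "g \<in> Hom C a b" and eq: "far F f = far F g"
      have a: "a \<in> Obj C" using C.Hom_Obj[OF f] by simp
      \<comment> \<open>Naturality recovers an arrow from its image:
        \<open>f = \<theta> b G(F(f)) (\<theta> a)\<inverse>\<close>.\<close>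
      show "f = g"
        using C.Cmp_inv_cancel(1)[OF \<theta>[OF a] f] C.Cmp_inv_cancel(1)[OF \<theta>[OF a] g]
          \<theta>_nat[OF f] \<theta>_nat[OF g] eq by simp
    qed
    show "far F ` Hom C a b \<subseteq> Arr D" using is_functorD(4)[OF F(1)] F HomD(1) by fastforce
  qed (use D in simp)
  moreover have "finite (iso_classes C)"
  proof (rule inj_on_finite)
    show "inj_on (\<lambda>c. fob F (SOME b. b \<in> c)) (iso_classes C)"
    proof (rule inj_onI)
      fix c d assume c: "c \<in> iso_classes C" and d: "d \<in> iso_classes C"
        and eq: "fob F (SOME b. b \<in> c) = fob F (SOME b. b \<in> d)"
      have rep: "(SOME b. b \<in> c) \<in> c" "(SOME b. b \<in> c) \<in> Obj C" if "c \<in> iso_classes C" for c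
        using in_quotient_imp_non_empty[OF C.equiv_isomorphic] in_quotient_imp_subset[OF C.equiv_isomorphic] that
        by (auto simp: iso_classes_def some_in_eq subset_eq)
      \<comment> \<open>If the representatives have the same image under \<open>F\<close>, then the
        inverse of \<open>\<theta>\<close> at the first followed by \<open>\<theta>\<close> at the
        second is an arrow between them.\<close>
      have "Hom C (SOME b. b \<in> c) (SOME b. b \<in> d) \<noteq> {}"
        using C.Cmp_Hom[OF C.inv_arr(1)[OF \<theta>[OF rep(2)[OF c]]]] \<theta>[OF rep(2)[OF d]] eq by auto
      then have "((SOME b. b \<in> c), (SOME b. b \<in> d)) \<in> {(a, b). isomorphic C a b}"
        by (simp add: C.isomorphic_iff)
      then show "c = d"
        using quotient_eqI[OF C.equiv_isomorphic _ _ rep(1)[OF c] rep(1)[OF d]] c d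
        by (simp add: iso_classes_def)
    qed
    show "(\<lambda>c. fob F (SOME b. b \<in> c)) ` iso_classes C \<subseteq> Obj D"
      using is_functorD(3)[OF F(1)] F in_quotient_imp_non_empty[OF C.equiv_isomorphic]
        in_quotient_imp_subset[OF C.equiv_isomorphic]
      by (auto simp: iso_classes_def some_in_eq) (metis some_in_eq subsetD)
  qed (use D in simp)
  ultimately show ?thesis using C.groupoid_axioms by (simp add: finite_type_def)
qed

text \<open>The counterpart of \<open>is_span\<close> with \<open>finite_type\<close> in place of
  essential finiteness. In this form spans are shown closed under composition, so that results on a
  single span apply to \<open>X1' \<circ>\<^sub>S X1\<close> as well.\<close>

definition finite_span ::
    "('a, 'am) cat \<Rightarrow> ('b, 'bm) cat \<Rightarrow> ('x, 'xm, 'a, 'am, 'b, 'bm) span \<Rightarrow> bool" where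
  "finite_span A B X \<longleftrightarrow> is_functor (lleg X) \<and> is_functor (rleg X) \<and>
     fdom (rleg X) = apex X \<and> fcod (lleg X) = A \<and> fcod (rleg X) = B \<and>
     finite_type A \<and> finite_type B \<and> finite_type (apex X)"

definition finite_span_map :: "('x, 'xm, 'a, 'am, 'b, 'bm) span \<Rightarrow> ('z, 'zm, 'a, 'am, 'b, 'bm) span \<Rightarrow>
    ('y, 'ym, 'x, 'xm, 'z, 'zm) span \<Rightarrow> bool" where
  "finite_span_map X1 X2 Y \<longleftrightarrow> finite_span (apex X1) (apex X2) Y \<and>
     functor_eq (lleg X1 \<circ>\<^sub>F lleg Y) (lleg X2 \<circ>\<^sub>F rleg Y) \<and>
     functor_eq (rleg X1 \<circ>\<^sub>F lleg Y) (rleg X2 \<circ>\<^sub>F rleg Y)"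

lemma is_span_finite_span: "is_span A B X \<Longrightarrow> finite_span A B X"
  by (simp add: is_span_def finite_span_def ess_finite_finite_type)

lemma is_span_map_finite_span_map: "is_span_map X1 X2 Y \<Longrightarrow> finite_span_map X1 X2 Y"
  by (simp add: is_span_map_def finite_span_map_def is_span_finite_span)

lemma finite_spanD:
  assumes "finite_span A B X"
  shows "is_functor (lleg X)" "is_functor (rleg X)" "fdom (lleg X) = apex X" "fdom (rleg X) = apex X"
    "fcod (lleg X) = A" "fcod (rleg X) = B" "finite_type A" "finite_type B" "finite_type (apex X)"
  using assms by (auto simp: finite_span_def apex_def)

lemma pull_lleg:
  assumes "finite_span A B X" "mfunctor F" "vdom F = A"
  shows "mfunctor (pull (lleg X) F)" "vdom (pull (lleg X) F) = fdom (rleg X)"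
  using pull_mfunctor[OF finite_spanD(1)[OF assms(1)] assms(2)] finite_spanD[OF assms(1)] assms(3) by simp_all

lemma Lam_cmod:
  assumes "finite_span A B X" "mfunctor F" "vdom F = A"
  shows "cmod (vob (Lam X F) a)"
  unfolding Lam_def by (rule push_cmod[OF finite_spanD(2)[OF assms(1)] pull_lleg[OF assms]])

lemma Lam_mfunctor:
  assumes "finite_span A B X" "mfunctor F" "vdom F = A"
  shows "mfunctor (Lam X F)" "vdom (Lam X F) = B"
  using push_mfunctor[OF finite_spanD(2)[OF assms(1)] pull_lleg[OF assms]] finite_spanD[OF assms(1)]
  by (simp_all add: Lam_def)

section \<open>The transformation of a span of span maps on generators\<close>

context
  fixes A :: "('a, 'am) cat" and B :: "('b, 'bm) cat"
    and X1 :: "('x, 'xm, 'a, 'am, 'b, 'bm) span" and X2 :: "('z, 'zm, 'a, 'am, 'b, 'bm) span"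
    and Y :: "('y, 'ym, 'x, 'xm, 'z, 'zm) span" and F :: "('a, 'am, 'v) vfunctor"
  assumes X1: "finite_span A B X1" and X2: "finite_span A B X2" and Y: "finite_span_map X1 X2 Y"
    and F: "mfunctor F" "vdom F = A"
begin

private abbreviation (input) "s1 \<equiv> lleg X1"
private abbreviation (input) "t1 \<equiv> rleg X1"
private abbreviation (input) "s2 \<equiv> lleg X2"
private abbreviation (input) "t2 \<equiv> rleg X2"
private abbreviation (input) "s \<equiv> lleg Y"
private abbreviation (input) "t \<equiv> rleg Y"
private abbreviation (input) "F1 \<equiv> pull (lleg X1) F"
private abbreviation (input) "F2 \<equiv> pull (lleg X2) F"

private lemma span_Y: "finite_span (apex X1) (apex X2) Y"
  using Y by (simp add: finite_span_map_def)

private lemmas S1 = finite_spanD[OF X1]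
private lemmas S2 = finite_spanD[OF X2]
private lemmas SY = finite_spanD[OF span_Y]

private lemma leg_eqs:
  "y \<in> Obj (apex Y) \<Longrightarrow> fob s1 (fob s y) = fob s2 (fob t y)"
  "y \<in> Obj (apex Y) \<Longrightarrow> fob t1 (fob s y) = fob t2 (fob t y)"
  "h \<in> Arr (apex Y) \<Longrightarrow> far s1 (far s h) = far s2 (far t h)"
  using Y by (auto simp: finite_span_map_def functor_eq_def apex_def)

private lemmas F1 = pull_lleg[OF X1 F]
private lemmas F2 = pull_lleg[OF X2 F]

private lemma sF1: "mfunctor (pull s F1)" "vdom (pull s F1) = fdom s"
  using pull_mfunctor[OF SY(1) F1(1)] F1 S1 SY by simp_all

private lemma tF2: "mfunctor (pull t F2)" "vdom (pull t F2) = fdom t"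
  using pull_mfunctor[OF SY(2) F2(1)] F2 S2 SY by simp_all

private lemma psF1: "mfunctor (push s (pull s F1))" "vdom (push s (pull s F1)) = fdom t1"
  using push_mfunctor[OF SY(1) sF1] S1 SY by simp_all

private lemma ptF2: "mfunctor (push t (pull t F2))" "vdom (push t (pull t F2)) = fdom t2"
  using push_mfunctor[OF SY(2) tF2] S2 SY by simp_all

private lemma unit: "linear_nat F1 (push s (pull s F1)) (unit_R s F1)"
  by (rule unit_R_linear_nat[OF SY(1) _ _ F1(1)]) (use SY S1 in simp_all)

private lemma counit: "linear_nat (push t (pull t F2)) F2 (counit_L t F2)"
  by (rule counit_L_linear_nat[OF SY(2) F2(1)]) (use SY S2 in simp)

text \<open>Because these are equalities, the output of \<open>push_merge\<close> for
  \<open>X1\<close> is directly an input of \<open>push_split\<close> for \<open>X2\<close>.\<close>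

private lemma switch:
  "vob (push (t1 \<circ>\<^sub>F s) (pull s F1)) a = vob (push (t2 \<circ>\<^sub>F t) (pull t F2)) a"
  "gen (t1 \<circ>\<^sub>F s) (pull s F1) a = gen (t2 \<circ>\<^sub>F t) (pull t F2) a"
proof -
  have f: "is_functor (t1 \<circ>\<^sub>F s)" using is_functor_fcomp[OF SY(1) S1(2)] SY S1 by simp
  have e: "functor_eq (t1 \<circ>\<^sub>F s) (t2 \<circ>\<^sub>F t)" using Y by (simp add: finite_span_map_def)
  have "colim (diag (t1 \<circ>\<^sub>F s) (pull s F1) a) = colim (diag (t2 \<circ>\<^sub>F t) (pull t F2) a) \<and>
      gen (t1 \<circ>\<^sub>F s) (pull s F1) a = gen (t2 \<circ>\<^sub>F t) (pull t F2) a"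
    using diag_cong[OF f e, of "pull s F1" "pull t F2" a] leg_eqs SY by simp
  then show "vob (push (t1 \<circ>\<^sub>F s) (pull s F1)) a = vob (push (t2 \<circ>\<^sub>F t) (pull t F2)) a"
    "gen (t1 \<circ>\<^sub>F s) (pull s F1) a = gen (t2 \<circ>\<^sub>F t) (pull t F2) a" by (simp_all add: push_def)
qed

text \<open>The part of \<open>Lam2\<close> that follows the unit. It sends generators to
  generators, so the sum in \<open>Lam2\<close> comes from the unit alone.\<close>

private definition "R a = (\<lambda>x. push_map t2 (push t (pull t F2)) F2 (counit_L t F2) a
  (push_split t2 t (pull t F2) a (push_merge t1 s (pull s F1) a x)))"

private lemma Lam2_eq: "Lam2 X1 X2 Y F a = (\<lambda>x. R a (push_map t1 F1 (push s (pull s F1)) (unit_R s F1) a x))"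
  by (simp add: Lam2_def Let_def vcomp_def R_def fun_eq_iff)

private lemma R_lmap: "R a \<in> lmap (vob (push t1 (push s (pull s F1))) a) (vob (Lam X2 F) a)"
proof -
  have "push_merge t1 s (pull s F1) a \<in>
      lmap (vob (push t1 (push s (pull s F1))) a) (vob (push (t2 \<circ>\<^sub>F t) (pull t F2)) a)"
    using push_merge_lmap[OF S1(2) SY(1) _ sF1] SY S1 switch by simp
  note c1 = lmap_comp[OF this push_split_lmap[OF S2(2) SY(2) _ tF2]]
  have c2: "(\<lambda>x. push_split t2 t (pull t F2) a (push_merge t1 s (pull s F1) a x)) \<in>
      lmap (vob (push t1 (push s (pull s F1))) a) (vob (push t2 (push t (pull t F2))) a)"
    using c1 SY S2 by simp
  show ?thesis
    using lmap_comp[OF c2 push_map_lmap[OF S2(2) ptF2 F2 counit]] by (simp add: R_def Lam_def)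
qed

text \<open>Merging gives \<open>k t1(h) \<otimes> v\<close> at \<open>y\<close>; splitting rewrites
  this with an identity arrow at \<open>t(y)\<close>; the counit applies the functor to that
  identity and so leaves \<open>v\<close> unchanged.\<close>

private lemma R_gen:
  assumes x: "x \<in> Obj (apex X1)" "k \<in> Hom B (fob t1 x) a" and y: "y \<in> Obj (apex Y)"
    and h: "h \<in> Hom (apex X1) (fob s y) x" and v: "v \<in> carrier (vob F (fob s1 (fob s y)))"
  shows "R a (gen t1 (push s (pull s F1)) a (x, k) (gen s (pull s F1) x (y, h) v)) =
    gen t2 F2 a (fob t y, Cmp B k (far t1 h)) v"
proof -
  interpret B: category B using S1(8) by (simp add: finite_type_def groupoid_def)
  let ?k = "Cmp B k (far t1 h)"
  have ty: "fob t y \<in> Obj (apex X2)" using is_functorD(3)[OF SY(2), of y] SY y by simp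
  have k: "?k \<in> Hom B (fob t2 (fob t y)) a"
    using B.Cmp_Hom[OF _ x(2), of "far t1 h" "fob t1 (fob s y)"] is_functorD(4)[OF S1(2), of h "fob s y" x] h leg_eqs(2)[OF y] S1
    by simp
  have v': "v \<in> carrier (vob F (fob s2 (fob t y)))" using v leg_eqs(1)[OF y] by simp
  let ?i = "Idm (apex X2) (fob t y)"
  have i: "?i \<in> Hom (fcod t) (fob t y) (fob t y)"
    using category.Idm_Hom[OF is_functorD(2)[OF SY(2)], of "fob t y"] ty SY by simp
  have 1: "push_merge t1 s (pull s F1) a (gen t1 (push s (pull s F1)) a (x, k) (gen s (pull s F1) x (y, h) v))
      = gen (t2 \<circ>\<^sub>F t) (pull t F2) a (y, ?k) v"
    using push_merge_gen[OF S1(2) SY(1) _ sF1, of x k a y h v] x y h v SY S1 switch(2) by simp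
  have 2: "push_split t2 t (pull t F2) a (gen (t2 \<circ>\<^sub>F t) (pull t F2) a (y, ?k) v)
      = gen t2 (push t (pull t F2)) a (fob t y, ?k) (gen t (pull t F2) (fob t y) (y, ?i) v)"
    using push_split_gen[OF S2(2) SY(2) _ tF2, of y ?k a v] k y v' SY S2 by simp
  have gi: "gen t (pull t F2) (fob t y) (y, ?i) v \<in> carrier (vob (push t (pull t F2)) (fob t y))"
    by (rule gen_closed[OF SY(2) tF2 _ i]) (use y v' SY in simp_all)
  have 3: "push_map t2 (push t (pull t F2)) F2 (counit_L t F2) a
      (gen t2 (push t (pull t F2)) a (fob t y, ?k) (gen t (pull t F2) (fob t y) (y, ?i) v))
      = gen t2 F2 a (fob t y, ?k) (counit_L t F2 (fob t y) (gen t (pull t F2) (fob t y) (y, ?i) v))"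
    by (rule push_map_gen[OF S2(2) ptF2 F2 counit _ _ gi]) (use ty k S2 in simp_all)
  have 4: "counit_L t F2 (fob t y) (gen t (pull t F2) (fob t y) (y, ?i) v) = var F2 ?i v"
    by (rule counit_L_gen[OF SY(2) F2(1) _ _ i]) (use F2 SY S2 y v' in simp_all)
  have 5: "var F2 ?i v = v"
    using mfunctorD(4)[OF F2(1), of "fob t y" v] F2 S2 ty v' by simp
  show ?thesis unfolding R_def 1 2 3 4 5 ..
qed

lemma Lam2_lmap: "Lam2 X1 X2 Y F a \<in> lmap (vob (Lam X1 F) a) (vob (Lam X2 F) a)"
  using lmap_comp[OF push_map_lmap[OF S1(2) F1 psF1 unit] R_lmap] by (simp add: Lam2_eq Lam_def)

text \<open>The unit contributes \<open>g\<inverse> \<otimes> F(s1(g)) v\<close> for each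
  \<open>g : x \<rightarrow> s(y)\<close>, and \<open>R\<close> turns its arrow
  \<open>g\<inverse>\<close> into the factor \<open>t1(g\<inverse>)\<close> after \<open>k\<close>.
  The family \<open>S\<close> is left arbitrary so that an induced family can be inserted for a
  horizontal composite.\<close>

lemma Lam2_gen:
  assumes S: "covering (apex Y) S"
    and x: "x \<in> Obj (apex X1)" "k \<in> Hom B (fob (rleg X1) x) a" "v \<in> carrier (vob F (fob (lleg X1) x))"
  shows "Lam2 X1 X2 Y F a (gen (rleg X1) (pull (lleg X1) F) a (x, k) v) = finsum (vob (Lam X2 F) a)
    (\<lambda>(y, g). (1 / of_nat (star_card (apex Y) S y)) \<odot>\<^bsub>vob (Lam X2 F) a\<^esub>
      gen (rleg X2) (pull (lleg X2) F) a
        (fob (rleg Y) y, Cmp B k (far (rleg X1) (inv_arr (apex X1) g))) (var F (far (lleg X1) g) v))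
    (SIGMA y:S. Hom (apex X1) x (fob (lleg Y) y))"
proof -
  interpret X1: groupoid "apex X1" using S1 by (simp add: finite_type_def)
  let ?P = "vob (push s (pull s F1)) x" and ?Q = "vob (Lam X2 F) a"
  let ?T = "SIGMA y:S. Hom (apex X1) x (fob s y)"
  define w where "w y = (1 / of_nat (star_card (apex Y) S y) :: complex)" for y
  define \<psi> where "\<psi> y g = gen s (pull s F1) x (y, inv_arr (apex X1) g) (var F (far s1 g) v)" for y g
  define r where "r = (\<lambda>z. R a (gen t1 (push s (pull s F1)) a (x, k) z))"
  have P: "cmod ?P" using push_cmod[OF SY(1) sF1] .
  have Q: "cmod ?Q" using push_cmod[OF S2(2) F2] by (simp add: Lam_def)
  have r: "r \<in> lmap ?P ?Q"
    unfolding r_def by (rule lmap_comp[OF gen_lmap[OF S1(2) psF1] R_lmap]) (use x S1 in simp_all)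
  have SObj: "y \<in> Obj (apex Y)" if "y \<in> S" for y using S that by (auto simp: covering_def)
  have Fg: "var F (far s1 g) v \<in> carrier (vob F (fob s1 (fob s y)))" if "g \<in> Hom (apex X1) x (fob s y)" for g y
    using mfunctor_closed[OF F(1), of "far s1 g" "fob s1 x" "fob s1 (fob s y)" v] is_functorD(4)[OF S1(1), of g x "fob s y"] that F S1 x
    by simp
  have \<psi>: "\<psi> y g \<in> carrier ?P" if "y \<in> S" "g \<in> Hom (apex X1) x (fob s y)" for y g
    unfolding \<psi>_def
    by (rule gen_closed[OF SY(1) sF1]) (use that SObj X1.inv_arr(1) Fg SY S1 in simp_all)
  have w\<psi>: "w y \<odot>\<^bsub>?P\<^esub> \<psi> y g \<in> carrier ?P" if "y \<in> S" "g \<in> Hom (apex X1) x (fob s y)" for y g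
    using Module.module.smult_closed[OF P] \<psi>[OF that] by simp
  have r\<psi>: "r (w y \<odot>\<^bsub>?P\<^esub> \<psi> y g) = w y \<odot>\<^bsub>?Q\<^esub> gen t2 F2 a
        (fob t y, Cmp B k (far t1 (inv_arr (apex X1) g))) (var F (far s1 g) v)"
    if "y \<in> S" "g \<in> Hom (apex X1) x (fob s y)" for y g
    using lmap_smult[OF r \<psi>[OF that]] R_gen[OF x(1,2) SObj[OF that(1)] X1.inv_arr(1)[OF that(2)] Fg[OF that(2)]]
    by (simp add: r_def \<psi>_def)
  have "Lam2 X1 X2 Y F a (gen t1 F1 a (x, k) v) = r (unit_R s F1 x v)"
    using push_map_gen[OF S1(2) F1 psF1 unit, of x k a v] x S1 by (simp add: Lam2_eq r_def)
  also have "unit_R s F1 x v = finsum ?P (\<lambda>(y, g). w y \<odot>\<^bsub>?P\<^esub> \<psi> y g) ?T"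
    using unit_R_sum[OF SY(1) _ _ F1(1) _, of S v x] S x SY S1 F1 by (simp add: w_def \<psi>_def)
  also have "r (finsum ?P (\<lambda>(y, g). w y \<odot>\<^bsub>?P\<^esub> \<psi> y g) ?T)
      = finsum ?Q (\<lambda>i. r (case i of (y, g) \<Rightarrow> w y \<odot>\<^bsub>?P\<^esub> \<psi> y g)) ?T"
    by (rule lmap_finsum[OF P Q r]) (use w\<psi> in auto)
  also have "\<dots> = finsum ?Q (\<lambda>(y, g). w y \<odot>\<^bsub>?Q\<^esub> gen t2 F2 a
        (fob t y, Cmp B k (far t1 (inv_arr (apex X1) g))) (var F (far s1 g) v)) ?T"
  proof (rule abelian_monoid.finsum_cong'[OF abelian_group.axioms(1)[OF cmod_abelian_group[OF Q]] refl])
    show "r (case i of (y, g) \<Rightarrow> w y \<odot>\<^bsub>?P\<^esub> \<psi> y g) = (case i of (y, g) \<Rightarrow> w y \<odot>\<^bsub>?Q\<^esub> gen t2 F2 a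
        (fob t y, Cmp B k (far t1 (inv_arr (apex X1) g))) (var F (far s1 g) v))" if "i \<in> ?T" for i
      using that r\<psi> by auto
    show "(\<lambda>(y, g). w y \<odot>\<^bsub>?Q\<^esub> gen t2 F2 a (fob t y, Cmp B k (far t1 (inv_arr (apex X1) g))) (var F (far s1 g) v))
        \<in> ?T \<rightarrow> carrier ?Q"
      using r\<psi>[symmetric] lmap_closed[OF r w\<psi>] by auto
  qed
  finally show ?thesis by (simp add: w_def)
qed

lemma Lam2_gen_closed:
  assumes "y \<in> Obj (apex Y)" "g \<in> Hom (apex X1) x (fob (lleg Y) y)"
    and x: "x \<in> Obj (apex X1)" "k \<in> Hom B (fob (rleg X1) x) a" "v \<in> carrier (vob F (fob (lleg X1) x))"
  shows "fob (rleg Y) y \<in> Obj (apex X2)"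
    "Cmp B k (far (rleg X1) (inv_arr (apex X1) g)) \<in> Hom B (fob (rleg X2) (fob (rleg Y) y)) a"
    "var F (far (lleg X1) g) v \<in> carrier (vob F (fob (lleg X2) (fob (rleg Y) y)))"
    "gen (rleg X2) (pull (lleg X2) F) a (fob (rleg Y) y, Cmp B k (far (rleg X1) (inv_arr (apex X1) g)))
      (var F (far (lleg X1) g) v) \<in> carrier (vob (Lam X2 F) a)"
proof -
  interpret X1: groupoid "apex X1" using S1 by (simp add: finite_type_def)
  interpret B: category B using S1(8) by (simp add: finite_type_def groupoid_def)
  show 1: "fob t y \<in> Obj (apex X2)" using is_functorD(3)[OF SY(2), of y] SY assms by simp
  show 2: "Cmp B k (far t1 (inv_arr (apex X1) g)) \<in> Hom B (fob t2 (fob t y)) a"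
    using B.Cmp_Hom[OF _ x(2), of "far t1 (inv_arr (apex X1) g)" "fob t1 (fob s y)"]
      is_functorD(4)[OF S1(2), of "inv_arr (apex X1) g" "fob s y" x] X1.inv_arr(1)[OF assms(2)]
      leg_eqs(2)[OF assms(1)] S1 by simp
  show 3: "var F (far s1 g) v \<in> carrier (vob F (fob s2 (fob t y)))"
    using mfunctor_closed[OF F(1), of "far s1 g" "fob s1 x" "fob s1 (fob s y)" v] is_functorD(4)[OF S1(1), of g x "fob s y"]
      leg_eqs(1)[OF assms(1)] assms F S1 by simp
  show "gen t2 F2 a (fob t y, Cmp B k (far t1 (inv_arr (apex X1) g))) (var F (far s1 g) v) \<in> carrier (vob (Lam X2 F) a)"
    unfolding Lam_def by (rule gen_closed[OF S2(2) F2]) (use 1 2 3 S2 in simp_all)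
qed

text \<open>An arrow \<open>u\<close> composes with \<open>k\<close> from the left, whereas in the
  sum for \<open>Lam2\<close> only the right of \<open>k\<close> changes, so the two operations
  commute termwise. Naturality is what allows \<open>Lam2\<close> to be pushed forward along
  \<open>X1'\<close> in \<open>Lam_map\<close>.\<close>

lemma Lam2_linear_nat: "linear_nat (Lam X1 F) (Lam X2 F) (Lam2 X1 X2 Y F)"
  unfolding linear_nat_def
proof (intro conjI allI ballI)
  interpret X1: groupoid "apex X1" using S1 by (simp add: finite_type_def)
  interpret B: category B using S1(8) by (simp add: finite_type_def groupoid_def)
  show "Lam2 X1 X2 Y F a \<in> lmap (vob (Lam X1 F) a) (vob (Lam X2 F) a)" for a
    by (rule Lam2_lmap)
  obtain S where S: "covering (apex Y) S" using covering_exists[OF SY(9)] ..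
  have SObj: "y \<in> Obj (apex Y)" if "y \<in> S" for y using S that by (auto simp: covering_def)
  fix a b u z assume "u \<in> Hom (vdom (Lam X1 F)) a b" and z: "z \<in> carrier (vob (Lam X1 F) a)"
  then have u: "u \<in> Hom B a b" using S1 by (simp add: Lam_def)
  have u1: "u \<in> Hom (fcod t1) a b" and u2: "u \<in> Hom (fcod t2) a b" using u S1 S2 by simp_all
  have Q: "cmod (vob (Lam X2 F) c)" for c using push_cmod[OF S2(2) F2] by (simp add: Lam_def)
  have L2u: "var (Lam X2 F) u \<in> lmap (vob (Lam X2 F) a) (vob (Lam X2 F) b)"
    using push_var_lmap[OF S2(2) F2 u2] by (simp add: Lam_def)
  show "Lam2 X1 X2 Y F b (var (Lam X1 F) u z) = var (Lam X2 F) u (Lam2 X1 X2 Y F a z)"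
  proof (rule push_ext[OF S1(2) F1 Q _ _ _ z[unfolded Lam_def]])
    show "(\<lambda>z. Lam2 X1 X2 Y F b (var (Lam X1 F) u z)) \<in> lmap (vob (push t1 F1) a) (vob (Lam X2 F) b)"
      using lmap_comp[OF push_var_lmap[OF S1(2) F1 u1] Lam2_lmap[of b, unfolded Lam_def[of X1]]]
      by (simp add: Lam_def)
    show "(\<lambda>z. var (Lam X2 F) u (Lam2 X1 X2 Y F a z)) \<in> lmap (vob (push t1 F1) a) (vob (Lam X2 F) b)"
      using lmap_comp[OF Lam2_lmap[of a, unfolded Lam_def[of X1]] L2u] .
    fix x k v assume "x \<in> Obj (fdom t1)" "k \<in> Hom (fcod t1) (fob t1 x) a" "v \<in> carrier (vob F1 x)"
    then have x: "x \<in> Obj (apex X1)" "k \<in> Hom B (fob t1 x) a" "v \<in> carrier (vob F (fob s1 x))"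
      using S1 by simp_all
    note uk = B.Cmp_Hom[OF x(2) u]
    define c where "c y = (1 / of_nat (star_card (apex Y) S y) :: complex)" for y
    let ?T = "SIGMA y:S. Hom (apex X1) x (fob s y)"
    let ?g = "\<lambda>a k y g. gen t2 F2 a (fob t y, Cmp B k (far t1 (inv_arr (apex X1) g))) (var F (far s1 g) v)"
    have "Lam2 X1 X2 Y F b (var (Lam X1 F) u (gen t1 F1 a (x, k) v)) = Lam2 X1 X2 Y F b (gen t1 F1 b (x, Cmp B u k) v)"
      using push_var_gen[OF S1(2) F1 u1, of x k v] x S1 by (simp add: Lam_def)
    also have "\<dots> = finsum (vob (Lam X2 F) b) (\<lambda>(y, g). c y \<odot>\<^bsub>vob (Lam X2 F) b\<^esub> ?g b (Cmp B u k) y g) ?T"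
      using Lam2_gen[OF S x(1) uk x(3)] by (simp add: c_def)
    also have "\<dots> = finsum (vob (Lam X2 F) b) (\<lambda>i. var (Lam X2 F) u
        (case i of (y, g) \<Rightarrow> c y \<odot>\<^bsub>vob (Lam X2 F) a\<^esub> ?g a k y g)) ?T"
    proof (rule finsum_bij[OF Q bij_betw_id[unfolded id_def]])
      fix i assume "i \<in> ?T"
      then obtain y g where i: "i = (y, g)" "y \<in> Obj (apex Y)" "g \<in> Hom (apex X1) x (fob s y)"
        using SObj by auto
      note cl = Lam2_gen_closed[OF i(2,3) x]
      have t1g: "far t1 (inv_arr (apex X1) g) \<in> Hom B (fob t1 (fob s y)) (fob t1 x)"
        using is_functorD(4)[OF S1(2), of "inv_arr (apex X1) g"] X1.inv_arr(1)[OF i(3)] S1 by simp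
      have "var (Lam X2 F) u (?g a k y g) = ?g b (Cmp B u k) y g"
        using push_var_gen[OF S2(2) F2 u2, of "fob t y" _ "var F (far s1 g) v"] cl(1-3) S2
          B.Cmp_assoc[OF t1g x(2) u] by (simp add: Lam_def)
      then have eq: "var (Lam X2 F) u (c y \<odot>\<^bsub>vob (Lam X2 F) a\<^esub> ?g a k y g)
          = c y \<odot>\<^bsub>vob (Lam X2 F) b\<^esub> ?g b (Cmp B u k) y g"
        using lmap_smult[OF L2u cl(4)] by simp
      then show "(case i of (y, g) \<Rightarrow> c y \<odot>\<^bsub>vob (Lam X2 F) b\<^esub> ?g b (Cmp B u k) y g)
          = var (Lam X2 F) u (case i of (y, g) \<Rightarrow> c y \<odot>\<^bsub>vob (Lam X2 F) a\<^esub> ?g a k y g)"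
        using i by simp
      show "var (Lam X2 F) u (case i of (y, g) \<Rightarrow> c y \<odot>\<^bsub>vob (Lam X2 F) a\<^esub> ?g a k y g) \<in> carrier (vob (Lam X2 F) b)"
        using i lmap_closed[OF L2u] Module.module.smult_closed[OF Q, of "c y"] cl(4) by simp
    qed
    also have "\<dots> = var (Lam X2 F) u (finsum (vob (Lam X2 F) a)
        (\<lambda>(y, g). c y \<odot>\<^bsub>vob (Lam X2 F) a\<^esub> ?g a k y g) ?T)"
      by (rule lmap_finsum[OF Q Q L2u, symmetric])
        (use Lam2_gen_closed(4)[OF _ _ x] SObj Module.module.smult_closed[OF Q] in auto)
    also have "\<dots> = var (Lam X2 F) u (Lam2 X1 X2 Y F a (gen t1 F1 a (x, k) v))"
      using Lam2_gen[OF S x] by (simp add: c_def)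
    finally show "Lam2 X1 X2 Y F b (var (Lam X1 F) u (gen t1 F1 a (x, k) v))
        = var (Lam X2 F) u (Lam2 X1 X2 Y F a (gen t1 F1 a (x, k) v))" .
  qed
qed

end

section \<open>Weak pullbacks\<close>

context
  fixes f :: "('x, 'xm, 'a, 'am) fctr" and f' :: "('z, 'zm, 'a, 'am) fctr"
  assumes f: "is_functor f" and f': "is_functor f'" and cod: "fcod f' = fcod f"
begin

private abbreviation (input) "W \<equiv> wpb f f'"

lemma wpb_Obj: "(x, g, x') \<in> Obj (wpb f f') \<longleftrightarrow>
    x \<in> Obj (fdom f) \<and> x' \<in> Obj (fdom f') \<and> g \<in> Hom (fcod f) (fob f x) (fob f' x')"
  by (auto simp: wpb_def)

lemma wpb_Hom: "m \<in> Hom (wpb f f') (x1, g1, x1') (x2, g2, x2') \<longleftrightarrow>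
    (\<exists>h k. m = ((x1, g1, x1'), (h, k), (x2, g2, x2')) \<and>
      g1 \<in> Hom (fcod f) (fob f x1) (fob f' x1') \<and> g2 \<in> Hom (fcod f) (fob f x2) (fob f' x2') \<and>
      h \<in> Hom (fdom f) x1 x2 \<and> k \<in> Hom (fdom f') x1' x2' \<and>
      Cmp (fcod f) (far f' k) g1 = Cmp (fcod f) g2 (far f h))"
  by (auto simp: Hom_def[of "wpb f f'"]) (auto simp: wpb_def)

lemma wpb_simps:
  "Idm (wpb f f') (x, g, x') = ((x, g, x'), (Idm (fdom f) x, Idm (fdom f') x'), (x, g, x'))"
  "Cmp (wpb f f') (q, (h', k'), r) (p, (h, k), q') = (p, (Cmp (fdom f) h' h, Cmp (fdom f') k' k), r)"
  "Dom (wpb f f') (p, (h, k), q) = p" "Cod (wpb f f') (p, (h, k), q) = q"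
  by (simp_all add: wpb_def)

lemma wpb_Arr_Obj:
  assumes "m \<in> Arr (wpb f f')" shows "Dom (wpb f f') m \<in> Obj (wpb f f')" "Cod (wpb f f') m \<in> Obj (wpb f f')"
  using assms category.Hom_Obj[OF is_functorD(1)[OF f]] category.Hom_Obj[OF is_functorD(1)[OF f']]
  by (auto simp: wpb_def)

lemma category_wpb: "category (wpb f f')"
proof
  interpret A: category "fcod f" using is_functorD(2)[OF f] .
  interpret X: category "fdom f" using is_functorD(1)[OF f] .
  interpret Z: category "fdom f'" using is_functorD(1)[OF f'] .
  show "Dom W m \<in> Obj W" "Cod W m \<in> Obj W" if "m \<in> Arr W" for m
    using wpb_Arr_Obj[OF that] .
  show "Idm W p \<in> Hom W p p" if "p \<in> Obj W" for p
  proof -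
    obtain x g x' where p: "p = (x, g, x')" by (cases p)
    then have x: "x \<in> Obj (fdom f)" "x' \<in> Obj (fdom f')" "g \<in> Hom (fcod f) (fob f x) (fob f' x')"
      using that wpb_Obj by auto
    then show ?thesis
      unfolding p wpb_Hom wpb_simps
      using X.Idm_Hom Z.Idm_Hom is_functorD(5)[OF f] is_functorD(5)[OF f'] A.Idm_left[OF x(3)] A.Idm_right[OF x(3)] cod
      by simp
  qed
  show "Cmp W n m \<in> Hom W p r" if m: "m \<in> Hom W p q" and n: "n \<in> Hom W q r" for m n p q r
  proof -
    obtain x1 g1 x1' x2 g2 x2' x3 g3 x3' where p: "p = (x1, g1, x1')" and q: "q = (x2, g2, x2')"
      and r: "r = (x3, g3, x3')" by (cases p; cases q; cases r)
    obtain h k where m': "m = (p, (h, k), q)" and g1: "g1 \<in> Hom (fcod f) (fob f x1) (fob f' x1')"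
      and g2: "g2 \<in> Hom (fcod f) (fob f x2) (fob f' x2')"
      and h: "h \<in> Hom (fdom f) x1 x2" and k: "k \<in> Hom (fdom f') x1' x2'"
      and eq: "Cmp (fcod f) (far f' k) g1 = Cmp (fcod f) g2 (far f h)"
      using m unfolding p q wpb_Hom by auto
    obtain h' k' where n': "n = (q, (h', k'), r)" and g3: "g3 \<in> Hom (fcod f) (fob f x3) (fob f' x3')"
      and h': "h' \<in> Hom (fdom f) x2 x3" and k': "k' \<in> Hom (fdom f') x2' x3'"
      and eq': "Cmp (fcod f) (far f' k') g2 = Cmp (fcod f) g3 (far f h')"
      using n unfolding r q wpb_Hom by auto
    note fh = is_functorD(4)[OF f h] and fh' = is_functorD(4)[OF f h']
      and fk = is_functorD(4)[OF f' k, unfolded cod] and fk' = is_functorD(4)[OF f' k', unfolded cod]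
    have "Cmp (fcod f) (far f' (Cmp (fdom f') k' k)) g1 = Cmp (fcod f) (far f' k') (Cmp (fcod f) g2 (far f h))"
      using is_functorD(6)[OF f' k k'] A.Cmp_assoc[OF g1 fk fk'] eq cod by simp
    also have "\<dots> = Cmp (fcod f) g3 (far f (Cmp (fdom f) h' h))"
      using is_functorD(6)[OF f h h'] A.Cmp_assoc[OF fh g2 fk'] A.Cmp_assoc[OF fh fh' g3] eq' by simp
    finally show ?thesis
      unfolding m' n' wpb_simps unfolding p r wpb_Hom
      using g1 g3 X.Cmp_Hom[OF h h'] Z.Cmp_Hom[OF k k'] by simp
  qed
  fix m p q assume m: "m \<in> Hom W p q"
  obtain x1 g1 x1' x2 g2 x2' where p: "p = (x1, g1, x1')" and q: "q = (x2, g2, x2')"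
    by (cases p; cases q)
  obtain h k where m': "m = (p, (h, k), q)" and h: "h \<in> Hom (fdom f) x1 x2" and k: "k \<in> Hom (fdom f') x1' x2'"
    using m unfolding p q wpb_Hom by auto
  show "Cmp W (Idm W q) m = m" "Cmp W m (Idm W p) = m"
    using h k X.Idm_left Z.Idm_left X.Idm_right Z.Idm_right by (simp_all add: m' p q wpb_simps)
  fix n l r s assume n: "n \<in> Hom W q r" and l: "l \<in> Hom W r s"
  obtain x3 g3 x3' x4 g4 x4' where r: "r = (x3, g3, x3')" and s: "s = (x4, g4, x4')"
    by (cases r; cases s)
  obtain h' k' where n': "n = (q, (h', k'), r)" and h': "h' \<in> Hom (fdom f) x2 x3" and k': "k' \<in> Hom (fdom f') x2' x3'"
    using n unfolding r q wpb_Hom by auto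
  obtain h'' k'' where l': "l = (r, (h'', k''), s)" and h'': "h'' \<in> Hom (fdom f) x3 x4"
    and k'': "k'' \<in> Hom (fdom f') x3' x4'"
    using l unfolding r s wpb_Hom by auto
  show "Cmp W l (Cmp W n m) = Cmp W (Cmp W l n) m"
    unfolding m' n' l' wpb_simps using X.Cmp_assoc[OF h h' h''] Z.Cmp_assoc[OF k k' k''] by simp
qed

lemma groupoid_wpb:
  assumes "groupoid (fdom f)" "groupoid (fdom f')" "groupoid (fcod f)"
  shows "groupoid (wpb f f')"
proof -
  interpret W: category W by (rule category_wpb)
  interpret A: groupoid "fcod f" by fact
  interpret X: groupoid "fdom f" by fact
  interpret Z: groupoid "fdom f'" by fact
  have gZ: "groupoid (fcod f')" using assms(3) cod by simp
  have "invertible_arr W m" if m: "m \<in> Arr W" for m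
  proof -
    obtain x1 g1 x1' x2 g2 x2' where pq: "Dom W m = (x1, g1, x1')" "Cod W m = (x2, g2, x2')"
      by (cases "Dom W m"; cases "Cod W m")
    then have "m \<in> Hom W (x1, g1, x1') (x2, g2, x2')" using m by (simp add: Hom_def)
    then obtain h k where m': "m = ((x1, g1, x1'), (h, k), (x2, g2, x2'))"
      and g1: "g1 \<in> Hom (fcod f) (fob f x1) (fob f' x1')" and g2: "g2 \<in> Hom (fcod f) (fob f x2) (fob f' x2')"
      and h: "h \<in> Hom (fdom f) x1 x2" and k: "k \<in> Hom (fdom f') x1' x2'"
      and eq: "Cmp (fcod f) (far f' k) g1 = Cmp (fcod f) g2 (far f h)"
      unfolding wpb_Hom by auto
    note fh = is_functorD(4)[OF f h] and fk = is_functorD(4)[OF f' k, unfolded cod]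
    let ?n = "((x2, g2, x2'), (inv_arr (fdom f) h, inv_arr (fdom f') k), (x1, g1, x1'))"
    \<comment> \<open>The square for the inverse pair is the given one,
      \<open>f'(k) g1 = g2 f(h)\<close>, with \<open>f'(k)\<close> and \<open>f(h)\<close> moved to
      the opposite sides.\<close>
    have "Cmp (fcod f) (inv_arr (fcod f) (far f' k)) g2
        = Cmp (fcod f) (inv_arr (fcod f) (far f' k)) (Cmp (fcod f) (Cmp (fcod f) g2 (far f h)) (inv_arr (fcod f) (far f h)))"
      using A.Cmp_inv_cancel(1)[OF fh g2] by simp
    also have "\<dots> = Cmp (fcod f) g1 (inv_arr (fcod f) (far f h))"
      using A.Cmp_assoc[OF A.inv_arr(1)[OF fh] g1 fk] A.Cmp_inv_cancel(3)[OF fk A.Cmp_Hom[OF A.inv_arr(1)[OF fh] g1]] eq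
      by simp
    finally have "?n \<in> Hom W (x2, g2, x2') (x1, g1, x1')"
      unfolding wpb_Hom
      using g1 g2 X.inv_arr(1)[OF h] Z.inv_arr(1)[OF k] functor_inv_arr[OF f assms(1,3) h]
        functor_inv_arr[OF f' assms(2) gZ k] cod by simp
    then have "is_inverse W m ?n"
      using m X.inv_arr[OF h] Z.inv_arr[OF k] pq unfolding is_inverse_def by (simp add: m' wpb_simps)
    then show ?thesis unfolding invertible_arr_def by (rule exI)
  qed
  then show ?thesis by unfold_locales
qed

text \<open>The commuting square \<open>f'(k) g = q f(h)\<close> can be solved for \<open>q\<close>
  because \<open>f(h)\<close> is invertible. Hence an arrow out of \<open>(x, g, x')\<close> amounts
  to an arbitrary pair of arrows out of \<open>x\<close> and \<open>x'\<close>.\<close>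

lemma wpb_lift:
  assumes "groupoid (fcod f)" and g: "g \<in> Hom (fcod f) (fob f x) (fob f' x')" and h: "h \<in> Hom (fdom f) x y" and k: "k \<in> Hom (fdom f') x' y'"
  shows "((x, g, x'), (h, k), (y, q, y')) \<in> Hom (wpb f f') (x, g, x') (y, q, y') \<longleftrightarrow>
    q = Cmp (fcod f) (Cmp (fcod f) (far f' k) g) (inv_arr (fcod f) (far f h))"
    "Cmp (fcod f) (Cmp (fcod f) (far f' k) g) (inv_arr (fcod f) (far f h)) \<in> Hom (fcod f) (fob f y) (fob f' y')"
proof -
  interpret A: groupoid "fcod f" by fact
  note fh = is_functorD(4)[OF f h] and fk = is_functorD(4)[OF f' k, unfolded cod]
  note kg = A.Cmp_Hom[OF g fk]
  show 1: "Cmp (fcod f) (Cmp (fcod f) (far f' k) g) (inv_arr (fcod f) (far f h)) \<in> Hom (fcod f) (fob f y) (fob f' y')"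
    using A.Cmp_Hom[OF A.inv_arr(1)[OF fh] kg] .
  show "((x, g, x'), (h, k), (y, q, y')) \<in> Hom (wpb f f') (x, g, x') (y, q, y') \<longleftrightarrow>
    q = Cmp (fcod f) (Cmp (fcod f) (far f' k) g) (inv_arr (fcod f) (far f h))"
    unfolding wpb_Hom using 1 g h k A.Cmp_inv_cancel(1)[OF fh] A.Cmp_inv_cancel(2)[OF fh kg] by auto
qed

definition wpb_cover :: "'x set \<Rightarrow> 'z set \<Rightarrow> ('x \<times> 'am \<times> 'z) set" where
  "wpb_cover S S' = {(x, g, x'). x \<in> S \<and> x' \<in> S' \<and> g \<in> Hom (fcod f) (fob f x) (fob f' x')}"

section \<open>Covering families of a weak pullback\<close>

context
  fixes S :: "'x set" and S' :: "'z set"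
  assumes X: "finite_type (fdom f)" and Z: "finite_type (fdom f')" and A: "finite_type (fcod f)"
    and S: "covering (fdom f) S" and S': "covering (fdom f') S'"
begin

private lemma groupoids: "groupoid (fdom f)" "groupoid (fdom f')" "groupoid (fcod f)"
  using X Z A by (simp_all add: finite_type_def)

text \<open>Arrows from \<open>x\<close> into \<open>S\<close> and from \<open>x'\<close> into
  \<open>S'\<close> lift by \<open>wpb_lift\<close> to an arrow out of \<open>(x, g, x')\<close>,
  and its target lies in the family.\<close>

lemma covering_wpb: "covering (wpb f f') (wpb_cover S S')"
  unfolding covering_def
proof (intro conjI ballI)
  have fin: "finite S" "finite S'" and SO: "S \<subseteq> Obj (fdom f)" "S' \<subseteq> Obj (fdom f')"
    using S S' by (auto simp: covering_def)
  have "wpb_cover S S' \<subseteq> (\<Union>x\<in>S. \<Union>x'\<in>S'. (\<lambda>g. (x, g, x')) ` Hom (fcod f) (fob f x) (fob f' x'))"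
    by (auto simp: wpb_cover_def)
  moreover have "finite \<dots>" using fin A by (simp add: finite_type_def)
  ultimately show "finite (wpb_cover S S')" by (rule finite_subset)
  show "wpb_cover S S' \<subseteq> Obj (wpb f f')" using SO wpb_Obj by (auto simp: wpb_cover_def)
  fix w assume w: "w \<in> Obj (wpb f f')"
  obtain x g x' where w': "w = (x, g, x')" by (cases w)
  then have x: "x \<in> Obj (fdom f)" "x' \<in> Obj (fdom f')" and g: "g \<in> Hom (fcod f) (fob f x) (fob f' x')"
    using w wpb_Obj by auto
  obtain y h where y: "y \<in> S" and h: "h \<in> Hom (fdom f) x y" using S x unfolding covering_def by blast
  obtain y' k where y': "y' \<in> S'" and k: "k \<in> Hom (fdom f') x' y'" using S' x unfolding covering_def by blast
  show "\<exists>s\<in>wpb_cover S S'. Hom (wpb f f') w s \<noteq> {}"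
    using wpb_lift[OF groupoids(3) g h k] y y' unfolding w' by (fastforce simp: wpb_cover_def)
qed

lemma finite_type_wpb: "finite_type (wpb f f')"
proof (rule groupoid.finite_typeI[OF groupoid_wpb[OF groupoids] _ covering_wpb])
  fix p q :: "'x \<times> 'am \<times> 'z"
  obtain x1 g1 x1' x2 g2 x2' where p: "p = (x1, g1, x1')" and q: "q = (x2, g2, x2')"
    by (cases p; cases q)
  have "Hom W p q \<subseteq> (\<lambda>hk. (p, hk, q)) ` (Hom (fdom f) x1 x2 \<times> Hom (fdom f') x1' x2')"
    unfolding p q using wpb_Hom by blast
  moreover have "finite \<dots>" using X Z by (simp add: finite_type_def)
  ultimately show "finite (Hom W p q)" by (rule finite_subset)
qed

text \<open>By \<open>wpb_lift\<close> the arrows into the family correspond to pairs of an arrow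
  from \<open>x\<close> into \<open>S\<close> and one from \<open>x'\<close> into \<open>S'\<close>.
  The count does not depend on \<open>g\<close>, which is why the weights factor.\<close>

lemma star_card_wpb:
  assumes w: "(x, g, x') \<in> Obj (wpb f f')"
  shows "star_card (wpb f f') (wpb_cover S S') (x, g, x') = star_card (fdom f) S x * star_card (fdom f') S' x'"
proof -
  have g: "g \<in> Hom (fcod f) (fob f x) (fob f' x')" using w wpb_Obj by simp
  let ?A = "{m \<in> Arr W. Dom W m = (x, g, x') \<and> Cod W m \<in> wpb_cover S S'}"
  let ?B = "{h \<in> Arr (fdom f). Dom (fdom f) h = x \<and> Cod (fdom f) h \<in> S}"
  let ?C = "{k \<in> Arr (fdom f'). Dom (fdom f') k = x' \<and> Cod (fdom f') k \<in> S'}"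
  let ?\<iota> = "\<lambda>(h, k). ((x, g, x'), (h, k),
      (Cod (fdom f) h, Cmp (fcod f) (Cmp (fcod f) (far f' k) g) (inv_arr (fcod f) (far f h)), Cod (fdom f') k))"
  have "bij_betw (\<lambda>(p, hk, q). hk) ?A (?B \<times> ?C)"
  proof (rule bij_betw_byWitness[where f' = ?\<iota>])
    have A: "\<exists>h k y y'. m = ((x, g, x'), (h, k), (y, Cmp (fcod f) (Cmp (fcod f) (far f' k) g) (inv_arr (fcod f) (far f h)), y')) \<and>
        h \<in> Hom (fdom f) x y \<and> k \<in> Hom (fdom f') x' y' \<and> y \<in> S \<and> y' \<in> S'" if m: "m \<in> ?A" for m
    proof -
      obtain y q y' where q: "Cod W m = (y, q, y')" by (cases "Cod W m")
      then have mh: "m \<in> Hom W (x, g, x') (y, q, y')" using m by (simp add: Hom_def)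
      then obtain h k where hk: "m = ((x, g, x'), (h, k), (y, q, y'))" "h \<in> Hom (fdom f) x y" "k \<in> Hom (fdom f') x' y'"
        unfolding wpb_Hom by auto
      then show ?thesis using wpb_lift(1)[OF groupoids(3) g hk(2,3)] mh m q by (auto simp: wpb_cover_def)
    qed
    show "\<forall>m\<in>?A. ?\<iota> ((\<lambda>(p, hk, q). hk) m) = m"
    proof
      fix m assume "m \<in> ?A"
      from A[OF this] obtain h k y y' where
        "m = ((x, g, x'), (h, k), (y, Cmp (fcod f) (Cmp (fcod f) (far f' k) g) (inv_arr (fcod f) (far f h)), y'))"
        "h \<in> Hom (fdom f) x y" "k \<in> Hom (fdom f') x' y'" by blast
      then show "?\<iota> ((\<lambda>(p, hk, q). hk) m) = m"
        using HomD(3)[of h "fdom f"] HomD(3)[of k "fdom f'"] by simp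
    qed
    show "(\<lambda>(p, hk, q). hk) ` ?A \<subseteq> ?B \<times> ?C"
    proof
      fix hk assume "hk \<in> (\<lambda>(p, hk, q). hk) ` ?A"
      then obtain m where m: "m \<in> ?A" "hk = (\<lambda>(p, hk, q). hk) m" by blast
      show "hk \<in> ?B \<times> ?C" using A[OF m(1)] m(2) by (auto simp: Hom_def)
    qed
    show "?\<iota> ` (?B \<times> ?C) \<subseteq> ?A"
    proof (rule image_subsetI)
      fix hk assume "hk \<in> ?B \<times> ?C"
      then obtain h k where hk: "hk = (h, k)" "Cod (fdom f) h \<in> S" "Cod (fdom f') k \<in> S'"
        and h: "h \<in> Hom (fdom f) x (Cod (fdom f) h)" and k: "k \<in> Hom (fdom f') x' (Cod (fdom f') k)"
        by (auto simp: Hom_def)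
      let ?q = "Cmp (fcod f) (Cmp (fcod f) (far f' k) g) (inv_arr (fcod f) (far f h))"
      have "((x, g, x'), (h, k), (Cod (fdom f) h, ?q, Cod (fdom f') k))
          \<in> Hom W (x, g, x') (Cod (fdom f) h, ?q, Cod (fdom f') k)"
        using wpb_lift(1)[OF groupoids(3) g h k] by simp
      from HomD[OF this] show "?\<iota> hk \<in> ?A"
        using wpb_lift(2)[OF groupoids(3) g h k] hk by (simp add: wpb_cover_def)
    qed
  qed auto
  then have "card ?A = card ?B * card ?C" by (simp add: bij_betw_same_card card_cartesian_product)
  then show ?thesis by (simp add: star_card_def)
qed

end

section \<open>Functors between weak pullbacks and composition of spans\<close>

lemma wpb_left_functor: "is_functor (wpb_left f f')"
  unfolding is_functor_def
proof (intro conjI ballI allI)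
  show "category (fdom (wpb_left f f'))" "category (fcod (wpb_left f f'))"
    using category_wpb is_functorD(1)[OF f] by (simp_all add: wpb_left_def)
qed (auto simp: wpb_left_def wpb_Obj wpb_Hom wpb_simps)

lemma wpb_right_functor: "is_functor (wpb_right f f')"
  unfolding is_functor_def
proof (intro conjI ballI allI)
  show "category (fdom (wpb_right f f'))" "category (fcod (wpb_right f f'))"
    using category_wpb is_functorD(1)[OF f'] by (simp_all add: wpb_right_def)
qed (auto simp: wpb_right_def wpb_Obj wpb_Hom wpb_simps)

end

lemma wpb_legs_simps [simp]:
  "fdom (wpb_left f f') = wpb f f'" "fcod (wpb_left f f') = fdom f" "fob (wpb_left f f') (x, g, x') = x"
  "far (wpb_left f f') (p, (h, k), q) = h"
  "fdom (wpb_right f f') = wpb f f'" "fcod (wpb_right f f') = fdom f'" "fob (wpb_right f f') (x, g, x') = x'"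
  "far (wpb_right f f') (p, (h, k), q) = k"
  by (simp_all add: wpb_left_def wpb_right_def)

lemma wpb_map_simps [simp]:
  "fdom (wpb_map W W' p p') = W" "fcod (wpb_map W W' p p') = W'"
  "fob (wpb_map W W' p p') (y, g, y') = (fob p y, g, fob p' y')"
  "far (wpb_map W W' p p') ((y1, f1, y1'), (h, k), (y2, f2, y2')) =
     ((fob p y1, f1, fob p' y1'), (far p h, far p' k), (fob p y2, f2, fob p' y2'))"
  by (simp_all add: wpb_map_def)

text \<open>The weak pullback of the source is taken along \<open>e\<close> and \<open>e'\<close>,
  which agree with \<open>f p\<close> and \<open>f' p'\<close> only up to \<open>functor_eq\<close>.
  This covers both legs of a horizontal composite: for the left leg the agreement is by definition,
  for the right leg it is strict commutativity.\<close>

lemma wpb_map_functor: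
  assumes e: "is_functor e" and e': "is_functor e'" and ecod: "fcod e' = fcod e"
    and f: "is_functor f" and f': "is_functor f'" and fcod: "fcod f' = fcod f"
    and p: "is_functor p" and p': "is_functor p'" and pcod: "fcod p = fdom f" "fcod p' = fdom f'"
    and eq: "functor_eq e (f \<circ>\<^sub>F p)" "functor_eq e' (f' \<circ>\<^sub>F p')"
  shows "is_functor (wpb_map (wpb e e') (wpb f f') p p')"
  unfolding is_functor_def
proof (intro conjI ballI allI)
  let ?M = "wpb_map (wpb e e') (wpb f f') p p'"
  have doms: "fdom p = fdom e" "fdom p' = fdom e'" "fcod e = fcod f"
    and ob: "y \<in> Obj (fdom e) \<Longrightarrow> fob e y = fob f (fob p y)" "y' \<in> Obj (fdom e') \<Longrightarrow> fob e' y' = fob f' (fob p' y')"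
    and ar: "h \<in> Arr (fdom e) \<Longrightarrow> far e h = far f (far p h)" "k \<in> Arr (fdom e') \<Longrightarrow> far e' k = far f' (far p' k)"
    for y y' h k
    using eq by (auto simp: functor_eq_def)
  note pD = is_functorD[OF p] and p'D = is_functorD[OF p']
  show "category (fdom ?M)" "category (fcod ?M)"
    using category_wpb[OF e e' ecod] category_wpb[OF f f' fcod] by simp_all
  show "fob ?M w \<in> Obj (fcod ?M)"
    if "w \<in> Obj (fdom ?M)" for w
    using that pD(3) p'D(3) pcod doms ob by (cases w) (auto simp: wpb_Obj[OF e e' ecod] wpb_Obj[OF f f' fcod])
  show "far ?M (Idm (fdom ?M) w) =
      Idm (fcod ?M) (fob ?M w)"
    if "w \<in> Obj (fdom ?M)" for w
    using that pD(5) p'D(5) pcod doms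
    by (cases w) (auto simp: wpb_Obj[OF e e' ecod] wpb_simps[OF e e' ecod] wpb_simps[OF f f' fcod])
  fix v w m assume "m \<in> Hom (fdom ?M) v w"
  then have m: "m \<in> Hom (wpb e e') v w" by simp
  obtain x g x' y q y' where v: "v = (x, g, x')" and w: "w = (y, q, y')" by (cases v; cases w)
  obtain h k where m': "m = (v, (h, k), w)" and g: "g \<in> Hom (fcod e) (fob e x) (fob e' x')"
    and q: "q \<in> Hom (fcod e) (fob e y) (fob e' y')"
    and h: "h \<in> Hom (fdom e) x y" and k: "k \<in> Hom (fdom e') x' y'"
    and sq: "Cmp (fcod e) (far e' k) g = Cmp (fcod e) q (far e h)"
    using m unfolding v w wpb_Hom[OF e e' ecod] by auto
  note xy = category.Hom_Obj[OF is_functorD(1)[OF e] h] category.Hom_Obj[OF is_functorD(1)[OF e'] k]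
  show "far ?M m \<in> Hom (fcod ?M)
      (fob ?M v) (fob ?M w)"
    using g q sq pD(4)[of h x y] p'D(4)[of k x' y'] h k ob xy ar(1)[OF HomD(1)[OF h]] ar(2)[OF HomD(1)[OF k]] doms pcod
    by (simp add: m' v w wpb_Hom[OF f f' fcod])
  fix r n assume "n \<in> Hom (fdom ?M) w r"
  then have n: "n \<in> Hom (wpb e e') w r" by simp
  obtain z l z' where r: "r = (z, l, z')" by (cases r)
  obtain h' k' where n': "n = (w, (h', k'), r)" and h': "h' \<in> Hom (fdom e) y z" and k': "k' \<in> Hom (fdom e') y' z'"
    using n unfolding w r wpb_Hom[OF e e' ecod] by auto
  show "far ?M (Cmp (fdom ?M) n m) =
      Cmp (fcod ?M) (far ?M n)
        (far ?M m)"
    using pD(6)[of h x y h' z] p'D(6)[of k x' y' k' z'] h k h' k' doms pcod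
    by (simp add: m' n' v w r wpb_simps[OF e e' ecod] wpb_simps[OF f f' fcod])
qed

lemma span_comp_simps:
  "lleg (X' \<circ>\<^sub>S X) = lleg X \<circ>\<^sub>F wpb_left (rleg X) (lleg X')"
  "rleg (X' \<circ>\<^sub>S X) = rleg X' \<circ>\<^sub>F wpb_right (rleg X) (lleg X')"
  "apex (X' \<circ>\<^sub>S X) = wpb (rleg X) (lleg X')"
  by (simp_all add: span_comp_def apex_def)

lemma finite_span_comp:
  assumes X: "finite_span A B X" and X': "finite_span B C X'"
  shows "finite_span A C (X' \<circ>\<^sub>S X)"
proof -
  note XD = finite_spanD[OF X] and X'D = finite_spanD[OF X']
  have cod: "fcod (lleg X') = fcod (rleg X)" using XD X'D by simp
  obtain S where S: "covering (apex X) S" using covering_exists[OF XD(9)] ..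
  obtain S' where S': "covering (apex X') S'" using covering_exists[OF X'D(9)] ..
  have "finite_type (wpb (rleg X) (lleg X'))"
    using finite_type_wpb[OF XD(2) X'D(1) cod, of S S'] S S' XD X'D by simp
  then show ?thesis
    unfolding finite_span_def span_comp_simps
    using is_functor_fcomp[OF wpb_left_functor[OF XD(2) X'D(1) cod] XD(1)]
      is_functor_fcomp[OF wpb_right_functor[OF XD(2) X'D(1) cod] X'D(2)] XD X'D by simp
qed

lemma span_map_hcomp_simps:
  "lleg (span_map_hcomp X1 X2 X1' X2' Y' Y) = wpb_map (wpb (rleg X1 \<circ>\<^sub>F lleg Y) (lleg X1' \<circ>\<^sub>F lleg Y'))
     (wpb (rleg X1) (lleg X1')) (lleg Y) (lleg Y')"
  "rleg (span_map_hcomp X1 X2 X1' X2' Y' Y) = wpb_map (wpb (rleg X1 \<circ>\<^sub>F lleg Y) (lleg X1' \<circ>\<^sub>F lleg Y'))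
     (wpb (rleg X2) (lleg X2')) (rleg Y) (rleg Y')"
  "apex (span_map_hcomp X1 X2 X1' X2' Y' Y) = wpb (rleg X1 \<circ>\<^sub>F lleg Y) (lleg X1' \<circ>\<^sub>F lleg Y')"
  by (simp_all add: span_map_hcomp_def Let_def span_comp_simps apex_def[of "\<lparr>lleg = _, rleg = _\<rparr>"])

lemma functor_eq_refl: "functor_eq F F"
  by (simp add: functor_eq_def)

text \<open>The legs of the composite leave middle arrows alone and act componentwise, so its left
  and right squares reduce to the left square of \<open>Y\<close> and the right square of
  \<open>Y'\<close>. The other two squares, over the middle groupoid, put the right leg into the
  weak pullback for \<open>X2\<close> and \<open>X2'\<close>.\<close>

lemma finite_span_map_hcomp:
  assumes X1: "finite_span A B X1" and X2: "finite_span A B X2"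
    and X1': "finite_span B C X1'" and X2': "finite_span B C X2'"
    and Y: "finite_span_map X1 X2 Y" and Y': "finite_span_map X1' X2' Y'"
  shows "finite_span_map (X1' \<circ>\<^sub>S X1) (X2' \<circ>\<^sub>S X2) (span_map_hcomp X1 X2 X1' X2' Y' Y)"
proof -
  note X1D = finite_spanD[OF X1] and X2D = finite_spanD[OF X2]
    and X1'D = finite_spanD[OF X1'] and X2'D = finite_spanD[OF X2']
  have Ys: "finite_span (apex X1) (apex X2) Y" "finite_span (apex X1') (apex X2') Y'"
    and Yeq: "functor_eq (lleg X1 \<circ>\<^sub>F lleg Y) (lleg X2 \<circ>\<^sub>F rleg Y)" "functor_eq (rleg X1 \<circ>\<^sub>F lleg Y) (rleg X2 \<circ>\<^sub>F rleg Y)"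
    and Y'eq: "functor_eq (lleg X1' \<circ>\<^sub>F lleg Y') (lleg X2' \<circ>\<^sub>F rleg Y')" "functor_eq (rleg X1' \<circ>\<^sub>F lleg Y') (rleg X2' \<circ>\<^sub>F rleg Y')"
    using Y Y' by (simp_all add: finite_span_map_def)
  note YD = finite_spanD[OF Ys(1)] and Y'D = finite_spanD[OF Ys(2)]
  define e where "e = rleg X1 \<circ>\<^sub>F lleg Y"
  define e' where "e' = lleg X1' \<circ>\<^sub>F lleg Y'"
  have e: "is_functor e" "fdom e = apex Y" "fcod e = B"
    using is_functor_fcomp[OF YD(1) X1D(2)] YD X1D by (simp_all add: e_def)
  have e': "is_functor e'" "fdom e' = apex Y'" "fcod e' = B"
    using is_functor_fcomp[OF Y'D(1) X1'D(1)] Y'D X1'D by (simp_all add: e'_def)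
  have cod: "fcod (lleg X1') = fcod (rleg X1)" "fcod (lleg X2') = fcod (rleg X2)" "fcod e' = fcod e"
    using X1D X2D X1'D X2'D e e' by simp_all
  obtain S where S: "covering (apex Y) S" using covering_exists[OF YD(9)] ..
  obtain S' where S': "covering (apex Y') S'" using covering_exists[OF Y'D(9)] ..
  have W: "finite_type (wpb e e')"
    using finite_type_wpb[OF e(1) e'(1) cod(3), of S S'] S S' YD Y'D X1D e e' by simp
  have l: "is_functor (wpb_map (wpb e e') (wpb (rleg X1) (lleg X1')) (lleg Y) (lleg Y'))"
    by (rule wpb_map_functor[OF e(1) e'(1) cod(3) X1D(2) X1'D(1) cod(1) YD(1) Y'D(1)])
      (use YD Y'D X1D X1'D in \<open>simp_all add: e_def e'_def functor_eq_refl\<close>)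
  have r: "is_functor (wpb_map (wpb e e') (wpb (rleg X2) (lleg X2')) (rleg Y) (rleg Y'))"
    by (rule wpb_map_functor[OF e(1) e'(1) cod(3) X2D(2) X2'D(1) cod(2) YD(2) Y'D(2)])
      (use YD Y'D X2D X2'D Yeq Y'eq in \<open>simp_all add: e_def e'_def\<close>)
  have H: "finite_span (wpb (rleg X1) (lleg X1')) (wpb (rleg X2) (lleg X2')) (span_map_hcomp X1 X2 X1' X2' Y' Y)"
    using l r W finite_spanD(9)[OF finite_span_comp[OF X1 X1']] finite_spanD(9)[OF finite_span_comp[OF X2 X2']]
    by (simp add: finite_span_def span_map_hcomp_simps span_comp_simps e_def e'_def)
  have arr: "\<exists>x g x' h k y q y'. m = ((x, g, x'), (h, k), (y, q, y')) \<and> h \<in> Arr (apex Y) \<and> k \<in> Arr (apex Y')"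
    if "m \<in> Arr (wpb e e')" for m
  proof -
    obtain x g x' y q y' where "Dom (wpb e e') m = (x, g, x')" "Cod (wpb e e') m = (y, q, y')"
      by (cases "Dom (wpb e e') m"; cases "Cod (wpb e e') m")
    then have "m \<in> Hom (wpb e e') (x, g, x') (y, q, y')" using that by (simp add: Hom_def)
    then obtain h k where "m = ((x, g, x'), (h, k), (y, q, y'))" "h \<in> Hom (fdom e) x y" "k \<in> Hom (fdom e') x' y'"
      unfolding wpb_Hom[OF e(1) e'(1) cod(3)] by auto
    then show ?thesis using HomD(1)[of h] HomD(1)[of k] e e' by auto
  qed
  have obj: "\<exists>y q y'. w = (y, q, y') \<and> y \<in> Obj (apex Y) \<and> y' \<in> Obj (apex Y')" if "w \<in> Obj (wpb e e')" for w
    using that wpb_Obj[OF e(1) e'(1) cod(3)] e e' by (cases w) simp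
  have ob: "y \<in> Obj (apex Y) \<Longrightarrow> fob (lleg X1) (fob (lleg Y) y) = fob (lleg X2) (fob (rleg Y) y)"
    "y' \<in> Obj (apex Y') \<Longrightarrow> fob (rleg X1') (fob (lleg Y') y') = fob (rleg X2') (fob (rleg Y') y')"
    and ar: "h \<in> Arr (apex Y) \<Longrightarrow> far (lleg X1) (far (lleg Y) h) = far (lleg X2) (far (rleg Y) h)"
    "k \<in> Arr (apex Y') \<Longrightarrow> far (rleg X1') (far (lleg Y') k) = far (rleg X2') (far (rleg Y') k)" for y y' h k
    using Yeq(1) Y'eq(2) YD Y'D by (auto simp: functor_eq_def)
  have "functor_eq (lleg (X1' \<circ>\<^sub>S X1) \<circ>\<^sub>F lleg (span_map_hcomp X1 X2 X1' X2' Y' Y))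
      (lleg (X2' \<circ>\<^sub>S X2) \<circ>\<^sub>F rleg (span_map_hcomp X1 X2 X1' X2' Y' Y))"
    unfolding functor_eq_def span_comp_simps span_map_hcomp_simps e_def[symmetric] e'_def[symmetric]
    using X1D X2D by (auto dest!: obj arr simp: ob ar)
  moreover have "functor_eq (rleg (X1' \<circ>\<^sub>S X1) \<circ>\<^sub>F lleg (span_map_hcomp X1 X2 X1' X2' Y' Y))
      (rleg (X2' \<circ>\<^sub>S X2) \<circ>\<^sub>F rleg (span_map_hcomp X1 X2 X1' X2' Y' Y))"
    unfolding functor_eq_def span_comp_simps span_map_hcomp_simps e_def[symmetric] e'_def[symmetric]
    using X1'D X2'D by (auto dest!: obj arr simp: ob ar)
  ultimately show ?thesis using H by (simp add: finite_span_map_def span_comp_simps(3))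
qed

section \<open>The comparison isomorphism and interchange\<close>

text \<open>An equality of records, so passing between iterated and composite pullback involves no
  comparison map.\<close>

lemma pull_pull: "pull g (pull f F) = pull (f \<circ>\<^sub>F g) F"
  by (simp add: pull_def fcomp_def)

section \<open>The comparison map on generators and its injectivity\<close>

context
  fixes A :: "('a, 'am) cat" and B :: "('b, 'bm) cat" and C :: "('c, 'cm) cat"
    and X :: "('x, 'xm, 'a, 'am, 'b, 'bm) span" and X' :: "('z, 'zm, 'b, 'bm, 'c, 'cm) span"
    and F :: "('a, 'am, 'v) vfunctor"
  assumes X: "finite_span A B X" and X': "finite_span B C X'" and F: "mfunctor F" "vdom F = A"
begin

private abbreviation (input) "tX \<equiv> rleg X"
private abbreviation (input) "sX' \<equiv> lleg X'"
private abbreviation (input) "tX' \<equiv> rleg X'"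
private abbreviation (input) "pL \<equiv> wpb_left (rleg X) (lleg X')"
private abbreviation (input) "pR \<equiv> wpb_right (rleg X) (lleg X')"
private abbreviation (input) "sF \<equiv> pull (lleg X) F"

private lemmas XD = finite_spanD[OF X]
private lemmas X'D = finite_spanD[OF X']

private lemma cod: "fcod sX' = fcod tX"
  using XD X'D by simp

private lemmas L_functor = wpb_left_functor[OF XD(2) X'D(1) cod]
private lemmas R_functor = wpb_right_functor[OF XD(2) X'D(1) cod]
private lemmas W_Hom = wpb_Hom[OF XD(2) X'D(1) cod, unfolded XD X'D]
private lemmas W_Obj = wpb_Obj[OF XD(2) X'D(1) cod, unfolded XD X'D]

private lemma cats: "category B" "category (apex X)" "category (apex X')" "category C"
  using XD(8,9) X'D(8,9) by (simp_all add: finite_type_def groupoid_def)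

private lemmas sF = pull_lleg[OF X F]

private lemma LG: "mfunctor (pull pL sF)" "vdom (pull pL sF) = fdom pR"
  using pull_mfunctor[OF L_functor sF(1)] sF by simp_all

private lemma tG: "mfunctor (push tX sF)" "vdom (push tX sF) = fcod sX'"
  using push_mfunctor[OF XD(2) sF] cod by simp_all

private lemma stG: "mfunctor (pull sX' (push tX sF))" "vdom (pull sX' (push tX sF)) = fdom tX'"
  using pull_mfunctor[OF X'D(1) tG(1)] tG X'D by simp_all

private lemma RLG: "mfunctor (push pR (pull pL sF))" "vdom (push pR (pull pL sF)) = fdom tX'"
  using push_mfunctor[OF R_functor LG] X'D by simp_all

private lemma tR: "is_functor (tX' \<circ>\<^sub>F pR)"
  using is_functor_fcomp[OF R_functor X'D(2)] X'D by simp

private lemma s'_functor: "k \<in> Hom (apex X') x y \<Longrightarrow> far sX' k \<in> Hom B (fob sX' x) (fob sX' y)"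
  using is_functorD(4)[OF X'D(1), of k x y] X'D by simp

private lemma t_functor: "h \<in> Hom (apex X) x y \<Longrightarrow> far tX h \<in> Hom B (fob tX x) (fob tX y)"
  using is_functorD(4)[OF XD(2), of h x y] XD by simp

text \<open>The cocone condition is the commuting square of an arrow \<open>(h, l)\<close> of the
  weak pullback: \<open>s'(k) q t(h) = s'(k) s'(l) g = s'(k l) g\<close>, after which
  \<open>h\<close> is moved across the tensor sign.\<close>

private lemma gamma:
  shows gamma_lmap: "gamma tX sX' sF z \<in> lmap (vob (push pR (pull pL sF)) z) (vob (push tX sF) (fob sX' z))"
    and gamma_gen: "(x, g, x') \<in> Obj (wpb tX sX') \<Longrightarrow> k \<in> Hom (apex X') x' z \<Longrightarrow> v \<in> carrier (vob sF x) \<Longrightarrow>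
      gamma tX sX' sF z (gen pR (pull pL sF) z ((x, g, x'), k) v) = gen tX sF (fob sX' z) (x, Cmp B (far sX' k) g) v"
proof -
  interpret B: category B by (rule cats)
  define U where "U = (\<lambda>((x, g, x' :: 'z), k) v. gen tX sF (fob sX' z) (x, Cmp B (far sX' k) g) v)"
  have eq: "gamma tX sX' sF z = colim_desc (diag pR (pull pL sF) z) (vob (push tX sF) (fob sX' z)) U"
    by (simp add: gamma_def U_def XD)
  note W = push_cmod[OF XD(2) sF, of "fob sX' z"]
  have 1: "U (w, k) \<in> lmap (vob (pull pL sF) w) (vob (push tX sF) (fob sX' z))"
    if w: "w \<in> Obj (fdom pR)" and k: "k \<in> Hom (fcod pR) (fob pR w) z" for w k
  proof -
    obtain x g x' where w': "w = (x, g, x')" by (cases w)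
    have x: "x \<in> Obj (apex X)" "g \<in> Hom B (fob tX x) (fob sX' x')" and k': "k \<in> Hom (apex X') x' z"
      using w k X'D by (simp_all add: w' W_Obj)
    show ?thesis
      using gen_lmap[OF XD(2) sF, of x "Cmp B (far sX' k) g" "fob sX' z"] x B.Cmp_Hom[OF x(2) s'_functor[OF k']] XD
      by (simp add: U_def w')
  qed
  have 2: "U (w', k) (var (pull pL sF) m v) = U (w, Cmp (fcod pR) k (far pR m)) v"
    if m: "m \<in> Hom (fdom pR) w w'" and k: "k \<in> Hom (fcod pR) (fob pR w') z" and v: "v \<in> carrier (vob (pull pL sF) w)"
    for w w' m k v
  proof -
    obtain x g x' y q y' where w: "w = (x, g, x')" "w' = (y, q, y')" by (cases w; cases w')
    obtain h l where m': "m = (w, (h, l), w')" and g: "g \<in> Hom B (fob tX x) (fob sX' x')"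
      and q: "q \<in> Hom B (fob tX y) (fob sX' y')" and h: "h \<in> Hom (apex X) x y" and l: "l \<in> Hom (apex X') x' y'"
      and sq: "Cmp B (far sX' l) g = Cmp B q (far tX h)"
      using m unfolding w by (auto simp: W_Hom)
    have k': "k \<in> Hom (apex X') y' z" using k X'D by (simp add: w)
    have "Cmp B (Cmp B (far sX' k) q) (far tX h) = Cmp B (far sX' (Cmp (apex X') k l)) g"
      using B.Cmp_assoc[OF t_functor[OF h] q s'_functor[OF k']] B.Cmp_assoc[OF g s'_functor[OF l] s'_functor[OF k']]
        is_functorD(6)[OF X'D(1), of l x' y' k z] l k' sq X'D by simp
    then show ?thesis
      using gen_rel[OF XD(2) sF, of h x y "Cmp B (far sX' k) q" "fob sX' z" v] h v B.Cmp_Hom[OF q s'_functor[OF k']] XD X'D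
      by (simp add: U_def w m')
  qed
  show "gamma tX sX' sF z \<in> lmap (vob (push pR (pull pL sF)) z) (vob (push tX sF) (fob sX' z))"
    unfolding eq by (rule push_desc(1)[OF R_functor LG W 1 2])
  show "gamma tX sX' sF z (gen pR (pull pL sF) z ((x, g, x'), k) v) = gen tX sF (fob sX' z) (x, Cmp B (far sX' k) g) v"
    if "(x, g, x') \<in> Obj (wpb tX sX')" "k \<in> Hom (apex X') x' z" "v \<in> carrier (vob sF x)"
    unfolding eq using push_desc(2)[OF R_functor LG W 1 2, where b = "(x, g, x')" and k = k and v = v] that X'D
    by (simp add: U_def)
qed

text \<open>On generators both sides reduce to \<open>s'(u k) g = s'(u) (s'(k) g)\<close>.
  Naturality is what allows \<open>gamma\<close> to be pushed forward in
  \<open>beta\<close>.\<close>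

private lemma gamma_linear_nat: "linear_nat (push pR (pull pL sF)) (pull sX' (push tX sF)) (gamma tX sX' sF)"
  unfolding linear_nat_def
proof (intro conjI allI ballI)
  interpret B: category B by (rule cats)
  interpret Z: category "apex X'" by (rule cats)
  show "gamma tX sX' sF z \<in> lmap (vob (push pR (pull pL sF)) z) (vob (pull sX' (push tX sF)) z)" for z
    using gamma_lmap by simp
  fix z z' u \<zeta> assume "u \<in> Hom (vdom (push pR (pull pL sF))) z z'" and \<zeta>: "\<zeta> \<in> carrier (vob (push pR (pull pL sF)) z)"
  then have u: "u \<in> Hom (apex X') z z'" using X'D by simp
  have u': "u \<in> Hom (fcod pR) z z'" using u X'D by simp
  have su: "far sX' u \<in> Hom (fcod tX) (fob sX' z) (fob sX' z')" using s'_functor[OF u] XD by simp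
  show "gamma tX sX' sF z' (var (push pR (pull pL sF)) u \<zeta>) = var (pull sX' (push tX sF)) u (gamma tX sX' sF z \<zeta>)"
  proof (rule push_ext[OF R_functor LG push_cmod[OF XD(2) sF] _ _ _ \<zeta>])
    show "(\<lambda>\<zeta>. gamma tX sX' sF z' (var (push pR (pull pL sF)) u \<zeta>)) \<in> lmap (vob (push pR (pull pL sF)) z) (vob (push tX sF) (fob sX' z'))"
      by (rule lmap_comp[OF push_var_lmap[OF R_functor LG u'] gamma_lmap])
    show "(\<lambda>\<zeta>. var (pull sX' (push tX sF)) u (gamma tX sX' sF z \<zeta>)) \<in> lmap (vob (push pR (pull pL sF)) z) (vob (push tX sF) (fob sX' z'))"
      using lmap_comp[OF gamma_lmap push_var_lmap[OF XD(2) sF su]] by simp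
    fix w k v assume w: "w \<in> Obj (fdom pR)" and k: "k \<in> Hom (fcod pR) (fob pR w) z" and v: "v \<in> carrier (vob (pull pL sF) w)"
    obtain x g x' where w': "w = (x, g, x')" by (cases w)
    have x: "x \<in> Obj (apex X)" "(x, g, x') \<in> Obj (wpb tX sX')" "v \<in> carrier (vob sF x)"
      and g: "g \<in> Hom B (fob tX x) (fob sX' x')" and k': "k \<in> Hom (apex X') x' z"
      using w k v X'D by (simp_all add: w' W_Obj)
    have "gamma tX sX' sF z' (var (push pR (pull pL sF)) u (gen pR (pull pL sF) z (w, k) v))
        = gen tX sF (fob sX' z') (x, Cmp B (far sX' (Cmp (apex X') u k)) g) v"
      using push_var_gen[OF R_functor LG u' w k v] gamma_gen[OF x(2) Z.Cmp_Hom[OF k' u] x(3)] X'D by (simp add: w')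
    also have "Cmp B (far sX' (Cmp (apex X') u k)) g = Cmp B (far sX' u) (Cmp B (far sX' k) g)"
      using is_functorD(6)[OF X'D(1), of k x' z u z'] k' u X'D
        B.Cmp_assoc[OF g s'_functor[OF k'] s'_functor[OF u]] by simp
    also have "gen tX sF (fob sX' z') (x, \<dots>) v = var (push tX sF) (far sX' u) (gen tX sF (fob sX' z) (x, Cmp B (far sX' k) g) v)"
      using push_var_gen[OF XD(2) sF su, of x "Cmp B (far sX' k) g" v] x B.Cmp_Hom[OF g s'_functor[OF k']] XD by simp
    finally show "gamma tX sX' sF z' (var (push pR (pull pL sF)) u (gen pR (pull pL sF) z (w, k) v))
        = var (pull sX' (push tX sF)) u (gamma tX sX' sF z (gen pR (pull pL sF) z (w, k) v))"
      using gamma_gen[OF x(2) k' x(3)] by (simp add: w')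
  qed
qed

lemma Lam_comp: "Lam (X' \<circ>\<^sub>S X) F = push (rleg X' \<circ>\<^sub>F wpb_right (rleg X) (lleg X'))
    (pull (wpb_left (rleg X) (lleg X')) (pull (lleg X) F))"
  by (simp add: Lam_def span_comp_simps pull_pull)

lemma beta_lmap: "beta X X' F a \<in> lmap (vob (Lam (X' \<circ>\<^sub>S X) F) a) (vob (Lam X' (Lam X F)) a)"
  using lmap_comp[OF push_split_lmap[OF X'D(2) R_functor _ LG] push_map_lmap[OF X'D(2) RLG stG gamma_linear_nat]] X'D
  unfolding Lam_comp by (simp add: beta_def Let_def vcomp_def Lam_def)

text \<open>Splitting places an identity arrow at \<open>x'\<close>, and \<open>gamma\<close> turns
  it into \<open>s'(1) g = g\<close>. On generators \<open>beta\<close> thus merely moves the middle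
  arrow of the index into the inner tensor.\<close>

lemma beta_gen:
  assumes w: "(x, g, x') \<in> Obj (wpb (rleg X) (lleg X'))" and k: "k \<in> Hom C (fob (rleg X') x') a"
    and v: "v \<in> carrier (vob F (fob (lleg X) x))"
  shows "beta X X' F a (gen (rleg (X' \<circ>\<^sub>S X)) (pull (lleg (X' \<circ>\<^sub>S X)) F) a ((x, g, x'), k) v) =
    gen (rleg X') (pull (lleg X') (Lam X F)) a (x', k)
      (gen (rleg X) (pull (lleg X) F) (fob (lleg X') x') (x, g) v)"
proof -
  interpret B: category B by (rule cats)
  interpret Z: category "apex X'" by (rule cats)
  have x: "x \<in> Obj (apex X)" "x' \<in> Obj (apex X')" and g: "g \<in> Hom B (fob tX x) (fob sX' x')"
    using w by (simp_all add: W_Obj)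
  let ?i = "Idm (apex X') x'"
  have i: "?i \<in> Hom (fcod pR) x' x'" using Z.Idm_Hom[OF x(2)] X'D by simp
  have cl: "gen pR (pull pL sF) x' ((x, g, x'), ?i) v \<in> carrier (vob (push pR (pull pL sF)) x')"
    by (rule gen_closed[OF R_functor LG]) (use w i v in simp_all)
  have "push_split tX' pR (pull pL sF) a (gen (tX' \<circ>\<^sub>F pR) (pull pL sF) a ((x, g, x'), k) v) =
      gen tX' (push pR (pull pL sF)) a (x', k) (gen pR (pull pL sF) x' ((x, g, x'), ?i) v)"
    using push_split_gen[OF X'D(2) R_functor _ LG, of "(x, g, x')" k a v] w k v X'D by simp
  moreover have "push_map tX' (push pR (pull pL sF)) (pull sX' (push tX sF)) (gamma tX sX' sF) a
      (gen tX' (push pR (pull pL sF)) a (x', k) (gen pR (pull pL sF) x' ((x, g, x'), ?i) v))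
      = gen tX' (pull sX' (push tX sF)) a (x', k) (gamma tX sX' sF x' (gen pR (pull pL sF) x' ((x, g, x'), ?i) v))"
    by (rule push_map_gen[OF X'D(2) RLG stG gamma_linear_nat _ _ cl]) (use x k X'D in simp_all)
  moreover have "gamma tX sX' sF x' (gen pR (pull pL sF) x' ((x, g, x'), ?i) v) = gen tX sF (fob sX' x') (x, g) v"
    using gamma_gen[OF w, of ?i x' v] v i is_functorD(5)[OF X'D(1), of x'] x B.Idm_left[OF g] X'D by simp
  ultimately show ?thesis
    by (simp add: beta_def Let_def vcomp_def Lam_def span_comp_simps pull_pull)
qed

text \<open>Injectivity of \<open>\<beta>\<close> is all that is needed of its invertibility: the left inverse sends
  \<open>k \<otimes> (g \<otimes> v)\<close> at \<open>x'\<close> and \<open>x\<close> to \<open>k \<otimes> v\<close> at \<open>(x, g, x')\<close>.\<close>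

lemma beta_inj: "inj_on (beta X X' F a) (carrier (vob (Lam (X' \<circ>\<^sub>S X) F) a))"
proof -
  interpret B: category B by (rule cats)
  interpret X: category "apex X" by (rule cats)
  interpret Z: category "apex X'" by (rule cats)
  interpret C: category C by (rule cats)
  let ?P = "vob (Lam (X' \<circ>\<^sub>S X) F) a"
  let ?gen = "gen (tX' \<circ>\<^sub>F pR) (pull pL sF) a"
  have LG': "mfunctor (pull pL sF)" "vdom (pull pL sF) = fdom (tX' \<circ>\<^sub>F pR)" using LG by simp_all
  have P: "cmod ?P" using push_cmod[OF tR LG'] by (simp add: Lam_comp)
  define u where "u x' k = (\<lambda>(x, g) v. ?gen ((x, g, x'), k) v)" for x' k
  define U where "U = (\<lambda>(x', k). colim_desc (diag tX sF (fob sX' x')) ?P (u x' k))"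
  \<comment> \<open>The relation of an arrow \<open>(h, l)\<close> of the weak pullback. Both cocone
    conditions for the left inverse are special cases: the inner one \<open>u2\<close> takes
    \<open>l\<close> to be an identity, the outer one \<open>U2\<close> takes \<open>h\<close> to be
    an identity.\<close>
  have rel: "?gen ((x, g, x'), Cmp C k (far tX' l)) v = ?gen ((y, q, y'), k) (var sF h v)"
    if g: "g \<in> Hom B (fob tX x) (fob sX' x')" and q: "q \<in> Hom B (fob tX y) (fob sX' y')"
      and h: "h \<in> Hom (apex X) x y" and l: "l \<in> Hom (apex X') x' y'"
      and sq: "Cmp B (far sX' l) g = Cmp B q (far tX h)" and k: "k \<in> Hom C (fob tX' y') a" and v: "v \<in> carrier (vob sF x)"
    for x g x' y q y' h l k v
    using gen_rel[OF tR LG', of "((x, g, x'), (h, l), (y, q, y'))" "(x, g, x')" "(y, q, y')" k a v] that X'D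
    by (simp add: W_Hom)
  have u1: "u x' k (x, g) \<in> lmap (vob sF x) ?P"
    if "x' \<in> Obj (fdom tX')" "k \<in> Hom (fcod tX') (fob tX' x') a" "x \<in> Obj (fdom tX)" "g \<in> Hom (fcod tX) (fob tX x) (fob sX' x')"
    for x' k x g
    using gen_lmap[OF tR LG', of "(x, g, x')" k a] that XD X'D by (simp add: Lam_comp u_def W_Obj)
  have u2: "u x' k (y, g) (var sF h v) = u x' k (x, Cmp (fcod tX) g (far tX h)) v"
    if x': "x' \<in> Obj (fdom tX')" and k: "k \<in> Hom (fcod tX') (fob tX' x') a" and "h \<in> Hom (fdom tX) x y"
      and "g \<in> Hom (fcod tX) (fob tX y) (fob sX' x')" and v: "v \<in> carrier (vob sF x)" for x' k x y h g v
  proof -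
    have h: "h \<in> Hom (apex X) x y" and g: "g \<in> Hom B (fob tX y) (fob sX' x')" and x'': "x' \<in> Obj (apex X')"
      and k': "k \<in> Hom C (fob tX' x') a"
      using that XD X'D by simp_all
    note gh = B.Cmp_Hom[OF t_functor[OF h] g]
    have id: "far sX' (Idm (apex X') x') = Idm B (fob sX' x')" "far tX' (Idm (apex X') x') = Idm C (fob tX' x')"
      using is_functorD(5)[OF X'D(1), of x'] is_functorD(5)[OF X'D(2), of x'] x'' X'D by simp_all
    show ?thesis
      using rel[OF gh g h Z.Idm_Hom[OF x''] _ k' v] id B.Idm_left[OF gh] C.Idm_right[OF k'] XD by (simp add: u_def)
  qed
  have U1: "U (x', k) \<in> lmap (vob (pull sX' (push tX sF)) x') ?P"
    if "x' \<in> Obj (fdom tX')" "k \<in> Hom (fcod tX') (fob tX' x') a" for x' k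
    using push_desc(1)[OF XD(2) sF P u1[OF that] u2[OF that]] by (simp add: U_def)
  have Ugen: "U (x', k) (gen tX sF (fob sX' x') (x, g) v) = ?gen ((x, g, x'), k) v"
    if "x' \<in> Obj (fdom tX')" "k \<in> Hom (fcod tX') (fob tX' x') a" "x \<in> Obj (fdom tX)"
      "g \<in> Hom (fcod tX) (fob tX x) (fob sX' x')" "v \<in> carrier (vob sF x)" for x' k x g v
    using push_desc(2)[OF XD(2) sF P u1[OF that(1,2)] u2[OF that(1,2)] that(3-5)] by (simp add: U_def u_def)
  have U2: "U (y', k) (var (pull sX' (push tX sF)) l \<zeta>) = U (x', Cmp (fcod tX') k (far tX' l)) \<zeta>"
    if "l \<in> Hom (fdom tX') x' y'" "k \<in> Hom (fcod tX') (fob tX' y') a" and "\<zeta> \<in> carrier (vob (pull sX' (push tX sF)) x')"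
    for x' y' l k \<zeta>
  proof -
    have l: "l \<in> Hom (apex X') x' y'" and k: "k \<in> Hom C (fob tX' y') a" and \<zeta>: "\<zeta> \<in> carrier (vob (push tX sF) (fob sX' x'))"
      using that X'D by simp_all
    note xy = Z.Hom_Obj[OF l]
    have tl: "far tX' l \<in> Hom C (fob tX' x') (fob tX' y')"
      using is_functorD(4)[OF X'D(2), of l x' y'] l X'D by simp
    note kl = C.Cmp_Hom[OF tl k]
    have sl: "far sX' l \<in> Hom (fcod tX) (fob sX' x') (fob sX' y')" using s'_functor[OF l] XD by simp
    have Uy: "U (y', k) \<in> lmap (vob (push tX sF) (fob sX' y')) ?P" using U1[of y' k] k xy X'D by simp
    have Ux: "U (x', Cmp C k (far tX' l)) \<in> lmap (vob (push tX sF) (fob sX' x')) ?P" using U1[of x'] kl xy X'D by simp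
    have "U (y', k) (var (push tX sF) (far sX' l) \<zeta>) = U (x', Cmp C k (far tX' l)) \<zeta>"
    proof (rule push_ext[OF XD(2) sF P lmap_comp[OF push_var_lmap[OF XD(2) sF sl] Uy] Ux _ \<zeta>])
      fix x g v assume x: "x \<in> Obj (fdom tX)" "g \<in> Hom (fcod tX) (fob tX x) (fob sX' x')" "v \<in> carrier (vob sF x)"
      then have g: "g \<in> Hom B (fob tX x) (fob sX' x')" and x'': "x \<in> Obj (apex X)" using XD by simp_all
      note lg = B.Cmp_Hom[OF g s'_functor[OF l]]
      have "U (y', k) (var (push tX sF) (far sX' l) (gen tX sF (fob sX' x') (x, g) v)) = ?gen ((x, Cmp B (far sX' l) g, y'), k) v"
        using push_var_gen[OF XD(2) sF sl x] Ugen[of y' k x "Cmp B (far sX' l) g" v] lg x k xy XD X'D by simp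
      moreover have "var sF (Idm (apex X) x) v = v" using mfunctorD(4)[OF sF(1)] sF(2) x XD by simp
      moreover have "far tX (Idm (apex X) x) = Idm B (fob tX x)" using is_functorD(5)[OF XD(2) x(1)] XD by simp
      ultimately show "U (y', k) (var (push tX sF) (far sX' l) (gen tX sF (fob sX' x') (x, g) v))
          = U (x', Cmp C k (far tX' l)) (gen tX sF (fob sX' x') (x, g) v)"
        using rel[OF g lg X.Idm_Hom[OF x''] l _ k x(3)] B.Idm_right[OF lg] Ugen[of x' _ x g v] kl x xy X'D by simp
    qed
    then show ?thesis using X'D by simp
  qed
  define \<delta> where "\<delta> = colim_desc (diag tX' (pull sX' (push tX sF)) a) ?P U"
  have \<delta>_lmap: "\<delta> \<in> lmap (vob (Lam X' (Lam X F)) a) ?P"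
    unfolding \<delta>_def Lam_def[of X'] Lam_def[of X] by (rule push_desc(1)[OF X'D(2) stG P U1 U2])
  have \<delta>_gen: "\<delta> (gen tX' (pull sX' (push tX sF)) a (x', k) \<zeta>) = U (x', k) \<zeta>"
    if "x' \<in> Obj (fdom tX')" "k \<in> Hom (fcod tX') (fob tX' x') a" "\<zeta> \<in> carrier (vob (pull sX' (push tX sF)) x')" for x' k \<zeta>
    unfolding \<delta>_def by (rule push_desc(2)[OF X'D(2) stG P U1 U2 that])
  have "\<delta> (beta X X' F a \<zeta>) = \<zeta>" if "\<zeta> \<in> carrier ?P" for \<zeta>
  proof (rule push_ext[OF tR LG' P])
    show "\<zeta> \<in> carrier (vob (push (tX' \<circ>\<^sub>F pR) (pull pL sF)) a)" using that by (simp add: Lam_comp)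
    show "(\<lambda>\<zeta>. \<delta> (beta X X' F a \<zeta>)) \<in> lmap (vob (push (tX' \<circ>\<^sub>F pR) (pull pL sF)) a) ?P"
      using lmap_comp[OF beta_lmap \<delta>_lmap] by (simp add: Lam_comp)
    show "(\<lambda>\<zeta>. \<zeta>) \<in> lmap (vob (push (tX' \<circ>\<^sub>F pR) (pull pL sF)) a) ?P"
      by (rule lmapI) (simp_all add: Lam_comp)
    fix w k v assume w: "w \<in> Obj (fdom (tX' \<circ>\<^sub>F pR))" and k: "k \<in> Hom (fcod (tX' \<circ>\<^sub>F pR)) (fob (tX' \<circ>\<^sub>F pR) w) a"
      and v: "v \<in> carrier (vob (pull pL sF) w)"
    obtain x g x' where w': "w = (x, g, x')" by (cases w)
    have wO: "(x, g, x') \<in> Obj (wpb tX sX')" and x: "x \<in> Obj (apex X)" "x' \<in> Obj (apex X')"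
      and g: "g \<in> Hom B (fob tX x) (fob sX' x')" and k': "k \<in> Hom C (fob tX' x') a" and v': "v \<in> carrier (vob F (fob (lleg X) x))"
      using w k v X'D by (simp_all add: w' W_Obj)
    have cl: "gen tX sF (fob sX' x') (x, g) v \<in> carrier (vob (pull sX' (push tX sF)) x')"
      using gen_closed[OF XD(2) sF, of x g "fob sX' x'" v] x g v' XD by simp
    have "beta X X' F a (?gen (w, k) v) = gen tX' (pull sX' (push tX sF)) a (x', k) (gen tX sF (fob sX' x') (x, g) v)"
      using beta_gen[OF wO k' v'] unfolding w' Lam_def span_comp_simps pull_pull .
    also have "\<delta> \<dots> = U (x', k) (gen tX sF (fob sX' x') (x, g) v)"
      by (rule \<delta>_gen[OF _ _ cl]) (use x k' X'D in simp_all)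
    also have "\<dots> = ?gen (w, k) v"
      unfolding w' by (rule Ugen) (use x g k' v' XD X'D in simp_all)
    finally show "\<delta> (beta X X' F a (?gen (w, k) v)) = ?gen (w, k) v" .
  qed
  then show ?thesis by (rule inj_on_inverseI)
qed

end

section \<open>The interchange law\<close>

context
  fixes A1 :: "('a1, 'am1) cat" and A2 :: "('a2, 'am2) cat" and A3 :: "('a3, 'am3) cat"
    and X1 :: "('x1, 'xm1, 'a1, 'am1, 'a2, 'am2) span"
    and X2 :: "('x2, 'xm2, 'a1, 'am1, 'a2, 'am2) span"
    and X1' :: "('z1, 'zm1, 'a2, 'am2, 'a3, 'am3) span"
    and X2' :: "('z2, 'zm2, 'a2, 'am2, 'a3, 'am3) span"
    and Y :: "('y, 'ym, 'x1, 'xm1, 'x2, 'xm2) span"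
    and Y' :: "('u, 'um, 'z1, 'zm1, 'z2, 'zm2) span"
    and F :: "('a1, 'am1, 'v) vfunctor"
  assumes X1: "finite_span A1 A2 X1" and X2: "finite_span A1 A2 X2"
    and X1': "finite_span A2 A3 X1'" and X2': "finite_span A2 A3 X2'"
    and Y: "finite_span_map X1 X2 Y" and Y': "finite_span_map X1' X2' Y'"
    and F: "mfunctor F" "vdom F = A1"
begin

private abbreviation (input) "H \<equiv> span_map_hcomp X1 X2 X1' X2' Y' Y"
private abbreviation (input) "e \<equiv> rleg X1 \<circ>\<^sub>F lleg Y"
private abbreviation (input) "e' \<equiv> lleg X1' \<circ>\<^sub>F lleg Y'"

private lemmas X1D = finite_spanD[OF X1]
private lemmas X2D = finite_spanD[OF X2]
private lemmas X1'D = finite_spanD[OF X1']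
private lemmas X2'D = finite_spanD[OF X2']

private lemma Y_span: "finite_span (apex X1) (apex X2) Y" "finite_span (apex X1') (apex X2') Y'"
  using Y Y' by (simp_all add: finite_span_map_def)

private lemmas YD = finite_spanD[OF Y_span(1)]
private lemmas Y'D = finite_spanD[OF Y_span(2)]

private lemma eqs:
  "y \<in> Obj (apex Y) \<Longrightarrow> fob (lleg X1) (fob (lleg Y) y) = fob (lleg X2) (fob (rleg Y) y)"
  "y \<in> Obj (apex Y) \<Longrightarrow> fob (rleg X1) (fob (lleg Y) y) = fob (rleg X2) (fob (rleg Y) y)"
  "y' \<in> Obj (apex Y') \<Longrightarrow> fob (lleg X1') (fob (lleg Y') y') = fob (lleg X2') (fob (rleg Y') y')"
  "y' \<in> Obj (apex Y') \<Longrightarrow> fob (rleg X1') (fob (lleg Y') y') = fob (rleg X2') (fob (rleg Y') y')"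
  using Y Y' YD Y'D by (auto simp: finite_span_map_def functor_eq_def)

private lemmas H = finite_span_map_hcomp[OF X1 X2 X1' X2' Y Y']
private lemmas C1 = finite_span_comp[OF X1 X1']
private lemmas C2 = finite_span_comp[OF X2 X2']
private lemmas LX1 = Lam_mfunctor[OF X1 F]
private lemmas LX2 = Lam_mfunctor[OF X2 F]

private lemma e: "is_functor e" "is_functor e'" "fcod e' = fcod e" "fcod e = A2" "fdom e = apex Y" "fdom e' = apex Y'"
  using is_functor_fcomp[OF YD(1) X1D(2)] is_functor_fcomp[OF Y'D(1) X1'D(1)] YD X1D Y'D X1'D by simp_all

private lemma cod1: "fcod (lleg X1') = fcod (rleg X1)"
  using X1D X1'D by simp

lemma Lam_map_lmap:
  "Lam_map X1' (Lam X1 F) (Lam X2 F) (Lam2 X1 X2 Y F) a \<in> lmap (vob (Lam X1' (Lam X1 F)) a) (vob (Lam X1' (Lam X2 F)) a)"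
proof -
  note p1 = pull_lleg[OF X1' LX1] and p2 = pull_lleg[OF X1' LX2]
  show ?thesis
    using push_map_lmap[OF X1'D(2) p1 p2 linear_nat_pull[OF X1'D(1) Lam2_linear_nat[OF X1 X2 Y F]]] LX1 X1'D
    by (simp add: Lam_map_def Lam_def[of X1'])
qed

lemma Lam_map_gen:
  assumes "x' \<in> Obj (apex X1')" "k \<in> Hom A3 (fob (rleg X1') x') a" "\<zeta> \<in> carrier (vob (Lam X1 F) (fob (lleg X1') x'))"
  shows "Lam_map X1' (Lam X1 F) (Lam X2 F) (Lam2 X1 X2 Y F) a (gen (rleg X1') (pull (lleg X1') (Lam X1 F)) a (x', k) \<zeta>) =
    gen (rleg X1') (pull (lleg X1') (Lam X2 F)) a (x', k) (Lam2 X1 X2 Y F (fob (lleg X1') x') \<zeta>)"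
proof -
  note p1 = pull_lleg[OF X1' LX1] and p2 = pull_lleg[OF X1' LX2]
  show ?thesis
    using push_map_gen[OF X1'D(2) p1 p2 linear_nat_pull[OF X1'D(1) Lam2_linear_nat[OF X1 X2 Y F]], of x' k a \<zeta>]
      assms LX1 X1'D
    by (simp add: Lam_map_def)
qed

text \<open>Both sides of the interchange expand into sums of the elements
  \<open>k t'(g')\<inverse> \<otimes> (s'(g') f t(g)\<inverse> \<otimes> F(s(g)) v)\<close>. On the left the sum runs over a covering family of
  \<open>Y' \<circ> Y\<close>, on the right over covering families of \<open>Y\<close> and \<open>Y'\<close>; the middle arrow of
  \<open>(y, q, y')\<close> is determined by \<open>g\<close> and \<open>g'\<close>, and the weights multiply.\<close>

lemma interchange_gen:
  assumes w: "(x, f, x') \<in> Obj (wpb (rleg X1) (lleg X1'))" and k: "k \<in> Hom A3 (fob (rleg X1') x') a"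
    and v: "v \<in> carrier (vob F (fob (lleg X1) x))"
  defines "\<zeta> \<equiv> gen (rleg (X1' \<circ>\<^sub>S X1)) (pull (lleg (X1' \<circ>\<^sub>S X1)) F) a ((x, f, x'), k) v"
  shows "beta X2 X2' F a (Lam2 (X1' \<circ>\<^sub>S X1) (X2' \<circ>\<^sub>S X2) H F a \<zeta>) =
    Lam2 X1' X2' Y' (Lam X2 F) a (Lam_map X1' (Lam X1 F) (Lam X2 F) (Lam2 X1 X2 Y F) a (beta X1 X1' F a \<zeta>))"
proof -
  interpret A2: groupoid A2 using X1D by (simp add: finite_type_def)
  interpret A3: category A3 using X1'D by (simp add: finite_type_def groupoid_def)
  interpret gX1: groupoid "apex X1" using X1D by (simp add: finite_type_def)
  interpret gX1': groupoid "apex X1'" using X1'D by (simp add: finite_type_def)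
  let ?Q = "vob (Lam X2' (Lam X2 F)) a"
  let ?W = "wpb (rleg X1) (lleg X1')"
  have gW: "groupoid ?W" using finite_spanD(9)[OF C1] by (simp add: finite_type_def span_comp_simps)
  have fin: "finite (Hom (apex X1) p q)" "finite (Hom (apex X1') p' q')" for p q p' q'
    using X1D X1'D by (simp_all add: finite_type_def)
  have x: "x \<in> Obj (apex X1)" "x' \<in> Obj (apex X1')" and f: "f \<in> Hom A2 (fob (rleg X1) x) (fob (lleg X1') x')"
    using w X1D X1'D by (simp_all add: wpb_Obj[OF X1D(2) X1'D(1) cod1])
  obtain S where S: "covering (apex Y) S" using covering_exists[OF YD(9)] ..
  obtain S' where S': "covering (apex Y') S'" using covering_exists[OF Y'D(9)] ..
  have SObj: "y \<in> Obj (apex Y)" if "y \<in> S" for y using S that by (auto simp: covering_def)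
  have S'Obj: "y' \<in> Obj (apex Y')" if "y' \<in> S'" for y' using S' that by (auto simp: covering_def)
  have finS: "finite S" "finite S'" using S S' by (simp_all add: covering_def)
  define T where "T = (SIGMA y:S. Hom (apex X1) x (fob (lleg Y) y))"
  define T' where "T' = (SIGMA y':S'. Hom (apex X1') x' (fob (lleg Y') y'))"
  define c where "c y = (1 / of_nat (star_card (apex Y) S y) :: complex)" for y
  define c' where "c' y' = (1 / of_nat (star_card (apex Y') S' y') :: complex)" for y'
  have finT: "finite T" "finite T'" using finS fin by (simp_all add: T_def T'_def)
  have Q: "cmod ?Q" by (rule Lam_cmod[OF X2' LX2])
  interpret Q: Module.module "class_ring :: complex ring" ?Q by (rule Q)
  \<comment> \<open>The middle arrow forced on the target of the pair \<open>(g, g')\<close> out of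
    \<open>(x, f, x')\<close>, as in \<open>wpb_lift\<close>.\<close>
  define q where "q g g' = Cmp A2 (Cmp A2 (far (lleg X1') g') f) (inv_arr A2 (far (rleg X1) g))" for g g'
  define \<Phi> where "\<Phi> = (\<lambda>((y, g), (y', g')). gen (rleg X2') (pull (lleg X2') (Lam X2 F)) a
    (fob (rleg Y') y', Cmp A3 k (far (rleg X1') (inv_arr (apex X1') g')))
    (gen (rleg X2) (pull (lleg X2) F) (fob (lleg X2') (fob (rleg Y') y')) (fob (rleg Y) y, q g g') (var F (far (lleg X1) g) v)))"

  let ?P = "vob (Lam X2 F) (fob (lleg X1') x')"
  define \<xi> where "\<xi> = (\<lambda>(y, g). gen (rleg X2) (pull (lleg X2) F) (fob (lleg X1') x')
    (fob (rleg Y) y, Cmp A2 f (far (rleg X1) (inv_arr (apex X1) g))) (var F (far (lleg X1) g) v))"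
  have P: "cmod ?P" by (rule Lam_cmod[OF X2 F])
  have \<xi>_cl: "\<xi> i \<in> carrier ?P" if "i \<in> T" for i
    using that Lam2_gen_closed(4)[OF X1 X2 Y F _ _ x(1) f v] SObj by (auto simp: T_def \<xi>_def)
  \<comment> \<open>With \<open>k\<close> and \<open>x'\<close> fixed, the outer transformation
    becomes a linear map of the inner element, so the sum over \<open>T\<close> can be taken out of
    it.\<close>
  define \<Theta> where "\<Theta> z = Lam2 X1' X2' Y' (Lam X2 F) a (gen (rleg X1') (pull (lleg X1') (Lam X2 F)) a (x', k) z)" for z
  have \<Theta>_lmap: "\<Theta> \<in> lmap ?P ?Q"
  proof -
    note p2 = pull_lleg[OF X1' LX2]
    have "gen (rleg X1') (pull (lleg X1') (Lam X2 F)) a (x', k) \<in> lmap ?P (vob (Lam X1' (Lam X2 F)) a)"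
      using gen_lmap[OF X1'D(2) p2, of x' k a] x k X1'D by (simp add: Lam_def[of X1'])
    then show ?thesis
      unfolding \<Theta>_def by (rule lmap_comp[OF _ Lam2_lmap[OF X1' X2' Y' LX2]])
  qed
  \<comment> \<open>The transformation of \<open>Y'\<close> is taken at the functor
    \<open>Lam X2 F\<close>, so \<open>g'\<close> acts on the inner generator by composing its arrow
    \<open>f t1(g)\<inverse>\<close> with \<open>s1'(g')\<close>; reassociating gives the middle
    arrow \<open>q g g'\<close>.\<close>
  have \<Phi>_eq: "gen (rleg X2') (pull (lleg X2') (Lam X2 F)) a
      (fob (rleg Y') y', Cmp A3 k (far (rleg X1') (inv_arr (apex X1') g')))
      (var (Lam X2 F) (far (lleg X1') g') (\<xi> (y, g))) = \<Phi> ((y, g), (y', g'))"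
    and \<Phi>_cl: "\<Phi> ((y, g), (y', g')) \<in> carrier ?Q"
    if i: "(y, g) \<in> T" "(y', g') \<in> T'" for y g y' g'
  proof -
    have y: "y \<in> Obj (apex Y)" "y' \<in> Obj (apex Y')" and g: "g \<in> Hom (apex X1) x (fob (lleg Y) y)"
      and g': "g' \<in> Hom (apex X1') x' (fob (lleg Y') y')"
      using i SObj S'Obj by (auto simp: T_def T'_def)
    note cl = Lam2_gen_closed[OF X1 X2 Y F y(1) g x(1) f v]
    have sg': "far (lleg X1') g' \<in> Hom A2 (fob (lleg X1') x') (fob (lleg X1') (fob (lleg Y') y'))"
      using is_functorD(4)[OF X1'D(1), of g' x' "fob (lleg Y') y'"] g' X1'D by simp
    have tg: "far (rleg X1) g \<in> Hom A2 (fob (rleg X1) x) (fob (rleg X1) (fob (lleg Y) y))"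
      using is_functorD(4)[OF X1D(2), of g x "fob (lleg Y) y"] g X1D by simp
    have inv: "far (rleg X1) (inv_arr (apex X1) g) = inv_arr A2 (far (rleg X1) g)"
      using functor_inv_arr[OF X1D(2), of g x "fob (lleg Y) y"] g gX1.groupoid_axioms A2.groupoid_axioms X1D by simp
    note p = pull_lleg[OF X2 F]
    have "var (Lam X2 F) (far (lleg X1') g') (\<xi> (y, g)) = gen (rleg X2) (pull (lleg X2) F) (fob (lleg X1') (fob (lleg Y') y'))
      (fob (rleg Y) y, Cmp A2 (far (lleg X1') g') (Cmp A2 f (far (rleg X1) (inv_arr (apex X1) g)))) (var F (far (lleg X1) g) v)"
      using push_var_gen[OF X2D(2) p, of "far (lleg X1') g'" "fob (lleg X1') x'" "fob (lleg X1') (fob (lleg Y') y')"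
          "fob (rleg Y) y" "Cmp A2 f (far (rleg X1) (inv_arr (apex X1) g))" "var F (far (lleg X1) g) v"] sg' cl(1-3) X2D
      by (simp add: \<xi>_def Lam_def)
    also have "Cmp A2 (far (lleg X1') g') (Cmp A2 f (far (rleg X1) (inv_arr (apex X1) g))) = q g g'"
      unfolding q_def inv using A2.Cmp_assoc[OF A2.inv_arr(1)[OF tg] f sg'] .
    finally have var: "var (Lam X2 F) (far (lleg X1') g') (\<xi> (y, g)) =
      gen (rleg X2) (pull (lleg X2) F) (fob (lleg X2') (fob (rleg Y') y')) (fob (rleg Y) y, q g g') (var F (far (lleg X1) g) v)"
      using eqs(3)[OF y(2)] by simp
    then show eq: "gen (rleg X2') (pull (lleg X2') (Lam X2 F)) a
      (fob (rleg Y') y', Cmp A3 k (far (rleg X1') (inv_arr (apex X1') g')))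
      (var (Lam X2 F) (far (lleg X1') g') (\<xi> (y, g))) = \<Phi> ((y, g), (y', g'))"
      by (simp add: \<Phi>_def)
    show "\<Phi> ((y, g), (y', g')) \<in> carrier ?Q"
      using Lam2_gen_closed(4)[OF X1' X2' Y' LX2 y(2) g' x(2) k \<xi>_cl[OF i(1)]] eq by simp
  qed
  have \<Theta>_\<xi>: "\<Theta> (\<xi> i) = finsum ?Q (\<lambda>i'. c' (fst i') \<odot>\<^bsub>?Q\<^esub> \<Phi> (i, i')) T'" if i: "i \<in> T" for i
  proof -
    have "\<Theta> (\<xi> i) = finsum ?Q (\<lambda>(y', g'). c' y' \<odot>\<^bsub>?Q\<^esub> gen (rleg X2') (pull (lleg X2') (Lam X2 F)) a
      (fob (rleg Y') y', Cmp A3 k (far (rleg X1') (inv_arr (apex X1') g')))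
      (var (Lam X2 F) (far (lleg X1') g') (\<xi> i))) T'"
      using Lam2_gen[OF X1' X2' Y' LX2 S' x(2) k \<xi>_cl[OF i]] by (simp add: \<Theta>_def T'_def c'_def)
    also have "\<dots> = finsum ?Q (\<lambda>i'. c' (fst i') \<odot>\<^bsub>?Q\<^esub> \<Phi> (i, i')) T'"
    proof (rule Q.finsum_cong')
      obtain y g where yg: "i = (y, g)" by (cases i)
      fix i' assume "i' \<in> T'"
      then show "(case i' of (y', g') \<Rightarrow> c' y' \<odot>\<^bsub>?Q\<^esub> gen (rleg X2') (pull (lleg X2') (Lam X2 F)) a
          (fob (rleg Y') y', Cmp A3 k (far (rleg X1') (inv_arr (apex X1') g')))
          (var (Lam X2 F) (far (lleg X1') g') (\<xi> i))) = c' (fst i') \<odot>\<^bsub>?Q\<^esub> \<Phi> (i, i')"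
        using \<Phi>_eq i yg by (cases i') simp
    next
      show "(\<lambda>i'. c' (fst i') \<odot>\<^bsub>?Q\<^esub> \<Phi> (i, i')) \<in> T' \<rightarrow> carrier ?Q"
        using \<Phi>_cl i Q.smult_closed by (cases i) auto
    qed simp
    finally show ?thesis .
  qed
  have \<zeta>1: "gen (rleg X1) (pull (lleg X1) F) (fob (lleg X1') x') (x, f) v \<in> carrier (vob (Lam X1 F) (fob (lleg X1') x'))"
    using gen_closed[OF X1D(2) pull_lleg[OF X1 F], of x f "fob (lleg X1') x'" v] x f v X1D by (simp add: Lam_def)
  have "Lam2 X1' X2' Y' (Lam X2 F) a (Lam_map X1' (Lam X1 F) (Lam X2 F) (Lam2 X1 X2 Y F) a (beta X1 X1' F a \<zeta>))
      = \<Theta> (finsum ?P (\<lambda>i. c (fst i) \<odot>\<^bsub>?P\<^esub> \<xi> i) T)"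
    unfolding \<zeta>_def beta_gen[OF X1 X1' F w k v] Lam_map_gen[OF x(2) k \<zeta>1] \<Theta>_def
    using Lam2_gen[OF X1 X2 Y F S x(1) f v] by (simp add: T_def c_def \<xi>_def case_prod_unfold)
  also have "\<dots> = finsum ?Q (\<lambda>i. \<Theta> (c (fst i) \<odot>\<^bsub>?P\<^esub> \<xi> i)) T"
    by (rule lmap_finsum[OF P Q \<Theta>_lmap]) (use \<xi>_cl Module.module.smult_closed[OF P] in simp)
  also have "\<dots> = finsum ?Q (\<lambda>i. finsum ?Q (\<lambda>i'. (c (fst i) * c' (fst i')) \<odot>\<^bsub>?Q\<^esub> \<Phi> (i, i')) T') T"
  proof (rule Q.finsum_cong')
    show "(\<lambda>i. finsum ?Q (\<lambda>i'. (c (fst i) * c' (fst i')) \<odot>\<^bsub>?Q\<^esub> \<Phi> (i, i')) T') \<in> T \<rightarrow> carrier ?Q"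
      using \<Phi>_cl Q.smult_closed by (auto intro!: Q.finsum_closed)
    fix i assume i: "i \<in> T"
    have cl: "c' (fst i') \<odot>\<^bsub>?Q\<^esub> \<Phi> (i, i') \<in> carrier ?Q" "\<Phi> (i, i') \<in> carrier ?Q" if "i' \<in> T'" for i'
      using i that \<Phi>_cl Q.smult_closed by (cases i; cases i'; simp)+
    have "\<Theta> (c (fst i) \<odot>\<^bsub>?P\<^esub> \<xi> i) = c (fst i) \<odot>\<^bsub>?Q\<^esub> finsum ?Q (\<lambda>i'. c' (fst i') \<odot>\<^bsub>?Q\<^esub> \<Phi> (i, i')) T'"
      using lmap_smult[OF \<Theta>_lmap \<xi>_cl[OF i]] \<Theta>_\<xi>[OF i] by simp
    also have "\<dots> = finsum ?Q (\<lambda>i'. c (fst i) \<odot>\<^bsub>?Q\<^esub> (c' (fst i') \<odot>\<^bsub>?Q\<^esub> \<Phi> (i, i'))) T'"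
      by (rule Q.finsum_smult_ldistr[OF finT(2)]) (use cl in auto)
    also have "\<dots> = finsum ?Q (\<lambda>i'. (c (fst i) * c' (fst i')) \<odot>\<^bsub>?Q\<^esub> \<Phi> (i, i')) T'"
      by (rule Q.finsum_cong') (use cl Q.smult_closed Q.smult_assoc1[simplified] in auto)
    finally show "\<Theta> (c (fst i) \<odot>\<^bsub>?P\<^esub> \<xi> i) = finsum ?Q (\<lambda>i'. (c (fst i) * c' (fst i')) \<odot>\<^bsub>?Q\<^esub> \<Phi> (i, i')) T'" .
  qed simp
  also have "\<dots> = finsum ?Q (\<lambda>(i, i'). (c (fst i) * c' (fst i')) \<odot>\<^bsub>?Q\<^esub> \<Phi> (i, i')) (SIGMA i:T. T')"
    by (rule finsum_Sigma[OF Q finT(1)]) (use finT(2) \<Phi>_cl Q.smult_closed in auto)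
  finally have right: "Lam2 X1' X2' Y' (Lam X2 F) a
      (Lam_map X1' (Lam X1 F) (Lam X2 F) (Lam2 X1 X2 Y F) a (beta X1 X1' F a \<zeta>))
      = finsum ?Q (\<lambda>(i, i'). (c (fst i) * c' (fst i')) \<odot>\<^bsub>?Q\<^esub> \<Phi> (i, i')) (SIGMA i:T. T')" .

  \<comment> \<open>For the composite the sum is taken over the family induced by the same
    \<open>S\<close> and \<open>S'\<close> as on the other side.\<close>
  let ?SW = "wpb_cover e e' S S'"
  have SW: "covering (apex H) ?SW"
    using covering_wpb[OF e(1-3)] S S' YD Y'D X1D e by (simp add: span_map_hcomp_simps)
  let ?TW = "SIGMA w:?SW. Hom (apex (X1' \<circ>\<^sub>S X1)) (x, f, x') (fob (lleg H) w)"
  let ?D = "vob (Lam (X2' \<circ>\<^sub>S X2) F) a"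
  define \<chi> where "\<chi> = (\<lambda>(w, m). gen (rleg (X2' \<circ>\<^sub>S X2)) (pull (lleg (X2' \<circ>\<^sub>S X2)) F) a
    (fob (rleg H) w, Cmp A3 k (far (rleg (X1' \<circ>\<^sub>S X1)) (inv_arr (apex (X1' \<circ>\<^sub>S X1)) m))) (var F (far (lleg (X1' \<circ>\<^sub>S X1)) m) v))"
  define cW where "cW w = (1 / of_nat (star_card (apex H) ?SW w) :: complex)" for w
  have xW: "(x, f, x') \<in> Obj (apex (X1' \<circ>\<^sub>S X1))" "k \<in> Hom A3 (fob (rleg (X1' \<circ>\<^sub>S X1)) (x, f, x')) a"
    "v \<in> carrier (vob F (fob (lleg (X1' \<circ>\<^sub>S X1)) (x, f, x')))"
    using w k v by (simp_all add: span_comp_simps)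
  have D: "cmod ?D" by (rule Lam_cmod[OF C2 F])
  have \<chi>_cl: "\<chi> i \<in> carrier ?D" if "i \<in> ?TW" for i
    using that Lam2_gen_closed(4)[OF C1 C2 H F _ _ xW] SW by (auto simp: \<chi>_def covering_def)
  have left: "beta X2 X2' F a (Lam2 (X1' \<circ>\<^sub>S X1) (X2' \<circ>\<^sub>S X2) H F a \<zeta>)
      = finsum ?Q (\<lambda>i. beta X2 X2' F a (cW (fst i) \<odot>\<^bsub>?D\<^esub> \<chi> i)) ?TW"
  proof -
    have "Lam2 (X1' \<circ>\<^sub>S X1) (X2' \<circ>\<^sub>S X2) H F a \<zeta> = finsum ?D (\<lambda>i. cW (fst i) \<odot>\<^bsub>?D\<^esub> \<chi> i) ?TW"
      unfolding \<zeta>_def using Lam2_gen[OF C1 C2 H F SW xW] by (simp add: cW_def \<chi>_def case_prod_unfold)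
    then show ?thesis
      using lmap_finsum[OF D Q beta_lmap[OF X2 X2' F], of ?TW "\<lambda>i. cW (fst i) \<odot>\<^bsub>?D\<^esub> \<chi> i"]
        \<chi>_cl Module.module.smult_closed[OF D] by simp
  qed

  \<comment> \<open>The reindexing behind the interchange. Its inverse forgets the middle arrows and
    loses nothing, because \<open>lift\<close> shows that they are determined by \<open>g\<close>
    and \<open>g'\<close>.\<close>
  define \<Psi> where "\<Psi> = (\<lambda>((y, g), (y', g')). ((y, q g g', y'), ((x, f, x'), (g, g'), (fob (lleg Y) y, q g g', fob (lleg Y') y'))))"
  have lift: "((x, f, x'), (g, g'), (z, r, z')) \<in> Hom ?W (x, f, x') (z, r, z') \<longleftrightarrow> r = q g g'"
    "q g g' \<in> Hom A2 (fob (rleg X1) z) (fob (lleg X1') z')"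
    if "g \<in> Hom (apex X1) x z" "g' \<in> Hom (apex X1') x' z'" for g g' z z' r
  proof -
    have "groupoid (fcod (rleg X1))" "f \<in> Hom (fcod (rleg X1)) (fob (rleg X1) x) (fob (lleg X1') x')"
      "g \<in> Hom (fdom (rleg X1)) x z" "g' \<in> Hom (fdom (lleg X1')) x' z'"
      using that f A2.groupoid_axioms X1D X1'D by simp_all
    note l = wpb_lift[OF X1D(2) X1'D(1) cod1 this]
    show "((x, f, x'), (g, g'), (z, r, z')) \<in> Hom ?W (x, f, x') (z, r, z') \<longleftrightarrow> r = q g g'"
      using l(1)[of r] X1D by (simp add: q_def)
    show "q g g' \<in> Hom A2 (fob (rleg X1) z) (fob (lleg X1') z')"
      using l(2) X1D by (simp add: q_def)
  qed
  have "finsum ?Q (\<lambda>(i, i'). (c (fst i) * c' (fst i')) \<odot>\<^bsub>?Q\<^esub> \<Phi> (i, i')) (SIGMA i:T. T')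
      = finsum ?Q (\<lambda>i. beta X2 X2' F a (cW (fst i) \<odot>\<^bsub>?D\<^esub> \<chi> i)) ?TW"
  proof (rule finsum_bij[OF Q])
    show "bij_betw \<Psi> (SIGMA i:T. T') ?TW"
    proof (rule bij_betw_byWitness[where f' = "\<lambda>((y, r, y'), (p, (g, g'), p')). ((y, g), (y', g'))"])
      show "\<forall>j\<in>SIGMA i:T. T'. (\<lambda>((y, r, y'), (p, (g, g'), p')). ((y, g), (y', g'))) (\<Psi> j) = j"
        by (auto simp: \<Psi>_def)
      have TW: "\<exists>y y' g g'. j = ((y, q g g', y'), ((x, f, x'), (g, g'), (fob (lleg Y) y, q g g', fob (lleg Y') y'))) \<and>
          (y, g) \<in> T \<and> (y', g') \<in> T'" if "j \<in> ?TW" for j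
      proof -
        obtain y r y' m where j: "j = ((y, r, y'), m)" by (cases j) auto
        have m: "m \<in> Hom ?W (x, f, x') (fob (lleg Y) y, r, fob (lleg Y') y')" and y: "y \<in> S" "y' \<in> S'"
          using that by (auto simp: j span_comp_simps span_map_hcomp_simps wpb_cover_def[OF e(1-3)])
        then obtain g g' where m': "m = ((x, f, x'), (g, g'), (fob (lleg Y) y, r, fob (lleg Y') y'))"
          and g: "g \<in> Hom (apex X1) x (fob (lleg Y) y)" "g' \<in> Hom (apex X1') x' (fob (lleg Y') y')"
          using X1D X1'D by (auto simp: wpb_Hom[OF X1D(2) X1'D(1) cod1])
        then have "r = q g g'" using lift(1)[OF g] m by simp
        then show ?thesis using j m' y g by (auto simp: T_def T'_def)
      qed
      show "\<forall>j\<in>?TW. \<Psi> ((\<lambda>((y, r, y'), (p, (g, g'), p')). ((y, g), (y', g'))) j) = j"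
      proof
        fix j assume "j \<in> ?TW"
        from TW[OF this] show "\<Psi> ((\<lambda>((y, r, y'), (p, (g, g'), p')). ((y, g), (y', g'))) j) = j"
          by (auto simp: \<Psi>_def)
      qed
      show "(\<lambda>((y, r, y'), (p, (g, g'), p')). ((y, g), (y', g'))) ` ?TW \<subseteq> (SIGMA i:T. T')"
      proof
        fix i assume "i \<in> (\<lambda>((y, r, y'), (p, (g, g'), p')). ((y, g), (y', g'))) ` ?TW"
        then obtain j where j: "j \<in> ?TW" "i = (\<lambda>((y, r, y'), (p, (g, g'), p')). ((y, g), (y', g'))) j" by blast
        show "i \<in> (SIGMA i:T. T')" using TW[OF j(1)] j(2) by auto
      qed
      show "\<Psi> ` (SIGMA i:T. T') \<subseteq> ?TW"
      proof
        fix j assume "j \<in> \<Psi> ` (SIGMA i:T. T')"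
        then obtain y g y' g' where j: "j = \<Psi> ((y, g), (y', g'))" and y: "y \<in> S" "y' \<in> S'"
          and g: "g \<in> Hom (apex X1) x (fob (lleg Y) y)" "g' \<in> Hom (apex X1') x' (fob (lleg Y') y')"
          by (auto simp: T_def T'_def)
        show "j \<in> ?TW"
          using lift[OF g] y X1D by (simp add: j \<Psi>_def span_comp_simps span_map_hcomp_simps wpb_cover_def[OF e(1-3)])
      qed
    qed
    show "beta X2 X2' F a (cW (fst j) \<odot>\<^bsub>?D\<^esub> \<chi> j) \<in> carrier ?Q" if "j \<in> ?TW" for j
      using lmap_closed[OF beta_lmap[OF X2 X2' F]] Module.module.smult_closed[OF D] \<chi>_cl[OF that] by simp
    fix j assume "j \<in> (SIGMA i:T. T')"
    then obtain y g y' g' where j: "j = ((y, g), (y', g'))" and jT: "(y, g) \<in> T" "(y', g') \<in> T'" and yS: "y \<in> S" "y' \<in> S'"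
      and g: "g \<in> Hom (apex X1) x (fob (lleg Y) y)" and g': "g' \<in> Hom (apex X1') x' (fob (lleg Y') y')"
      by (auto simp: T_def T'_def)
    note y = SObj[OF yS(1)] S'Obj[OF yS(2)]
    let ?m = "((x, f, x'), (g, g'), (fob (lleg Y) y, q g g', fob (lleg Y') y'))"
    have m: "?m \<in> Hom ?W (x, f, x') (fob (lleg Y) y, q g g', fob (lleg Y') y')" using lift(1)[OF g g'] by simp
    have qH: "q g g' \<in> Hom A2 (fob (rleg X1) (fob (lleg Y) y)) (fob (lleg X1') (fob (lleg Y') y'))"
      by (rule lift(2)[OF g g'])
    \<comment> \<open>Weights multiply because the star of \<open>(y, q g g', y')\<close> in the
      induced family is the product of the stars of \<open>y\<close> and \<open>y'\<close>.\<close>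
    have weight: "cW (y, q g g', y') = c y * c' y'"
    proof -
      have "(y, q g g', y') \<in> Obj (wpb e e')"
        using qH y e by (simp add: wpb_Obj[OF e(1-3)])
      then have "star_card (wpb e e') ?SW (y, q g g', y') = star_card (apex Y) S y * star_card (apex Y') S' y'"
        using star_card_wpb[OF e(1-3), of S S' y "q g g'" y'] S S' YD Y'D X1D e by simp
      then show ?thesis by (simp add: cW_def c_def c'_def span_map_hcomp_simps)
    qed
    \<comment> \<open>The projection to the second component is a functor of groupoids, so it
      carries the inverse of \<open>?m\<close> to the inverse of \<open>g'\<close>.\<close>
    have inv: "far (wpb_right (rleg X1) (lleg X1')) (inv_arr ?W ?m) = inv_arr (apex X1') g'"
      using functor_inv_arr[OF wpb_right_functor[OF X1D(2) X1'D(1) cod1], of ?m] m gW gX1'.groupoid_axioms X1'D by simp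
    note cl = Lam2_gen_closed[OF X1 X2 Y F y(1) g x(1) f v]
    have w2: "(fob (rleg Y) y, q g g', fob (rleg Y') y') \<in> Obj (wpb (rleg X2) (lleg X2'))"
      using qH cl(1) is_functorD(3)[OF Y'D(2), of y'] y eqs(2)[OF y(1)] eqs(3)[OF y(2)] X2D X2'D Y'D
      by (simp add: wpb_Obj[OF X2D(2) X2'D(1)])
    have k2: "Cmp A3 k (far (rleg X1') (inv_arr (apex X1') g')) \<in> Hom A3 (fob (rleg X2') (fob (rleg Y') y')) a"
      using Lam2_gen_closed(2)[OF X1' X2' Y' LX2 y(2) g' x(2) k \<xi>_cl[OF jT(1)]] .
    have "beta X2 X2' F a (\<chi> (\<Psi> j)) = \<Phi> j"
      using beta_gen[OF X2 X2' F w2 k2 cl(3)] inv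
      by (simp add: \<chi>_def \<Psi>_def \<Phi>_def j span_comp_simps span_map_hcomp_simps)
    moreover have "\<Psi> j \<in> ?TW"
      using m yS qH X1D by (simp add: j \<Psi>_def span_comp_simps span_map_hcomp_simps wpb_cover_def[OF e(1-3)])
    ultimately show "(case j of (i, i') \<Rightarrow> (c (fst i) * c' (fst i')) \<odot>\<^bsub>?Q\<^esub> \<Phi> (i, i'))
        = beta X2 X2' F a (cW (fst (\<Psi> j)) \<odot>\<^bsub>?D\<^esub> \<chi> (\<Psi> j))"
      using lmap_smult[OF beta_lmap[OF X2 X2' F] \<chi>_cl[of "\<Psi> j"]] weight by (simp add: j \<Psi>_def)
  qed
  then show ?thesis using left right by simp
qed

text \<open>Both sides are composites of linear maps, so agreement on the generators
  \<open>k \<otimes> v\<close> extends to the whole carrier.\<close>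

lemma interchange:
  assumes "z \<in> carrier (vob (Lam (X1' \<circ>\<^sub>S X1) F) a)"
  shows "beta X2 X2' F a (Lam2 (X1' \<circ>\<^sub>S X1) (X2' \<circ>\<^sub>S X2) H F a z) =
    Lam2 X1' X2' Y' (Lam X2 F) a (Lam_map X1' (Lam X1 F) (Lam X2 F) (Lam2 X1 X2 Y F) a (beta X1 X1' F a z))"
proof -
  note C1D = finite_spanD[OF C1]
  let ?G = "pull (lleg (X1' \<circ>\<^sub>S X1)) F"
  note G = pull_lleg[OF C1 F]
  note Q = Lam_cmod[OF X2' LX2, of a]
  note l1 = lmap_comp[OF Lam2_lmap[OF C1 C2 H F] beta_lmap[OF X2 X2' F], of a, unfolded Lam_def[of "X1' \<circ>\<^sub>S X1"]]
  note l2 = lmap_comp[OF lmap_comp[OF beta_lmap[OF X1 X1' F] Lam_map_lmap] Lam2_lmap[OF X1' X2' Y' LX2], of a,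
      unfolded Lam_def[of "X1' \<circ>\<^sub>S X1"]]
  show ?thesis
  proof (rule push_ext[OF C1D(2) G Q l1 l2 _ assms[unfolded Lam_def]])
    fix w k v assume w: "w \<in> Obj (fdom (rleg (X1' \<circ>\<^sub>S X1)))" and k: "k \<in> Hom (fcod (rleg (X1' \<circ>\<^sub>S X1))) (fob (rleg (X1' \<circ>\<^sub>S X1)) w) a"
      and v: "v \<in> carrier (vob ?G w)"
    obtain x f x' where w': "w = (x, f, x')" by (cases w)
    show "beta X2 X2' F a (Lam2 (X1' \<circ>\<^sub>S X1) (X2' \<circ>\<^sub>S X2) H F a (gen (rleg (X1' \<circ>\<^sub>S X1)) ?G a (w, k) v)) =
      Lam2 X1' X2' Y' (Lam X2 F) a (Lam_map X1' (Lam X1 F) (Lam X2 F) (Lam2 X1 X2 Y F) a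
        (beta X1 X1' F a (gen (rleg (X1' \<circ>\<^sub>S X1)) ?G a (w, k) v)))"
      unfolding w' by (rule interchange_gen) (use w k v X1'D in \<open>simp_all add: w' span_comp_simps\<close>)
  qed
qed

end

theorem lemma6p1p4:
  fixes A1 :: "('a1, 'am1) cat" and A2 :: "('a2, 'am2) cat" and A3 :: "('a3, 'am3) cat"
    and X1 :: "('x1, 'xm1, 'a1, 'am1, 'a2, 'am2) span"
    and X2 :: "('x2, 'xm2, 'a1, 'am1, 'a2, 'am2) span"
    and X1' :: "('z1, 'zm1, 'a2, 'am2, 'a3, 'am3) span"
    and X2' :: "('z2, 'zm2, 'a2, 'am2, 'a3, 'am3) span"
    and Y :: "('y, 'ym, 'x1, 'xm1, 'x2, 'xm2) span"
    and Y' :: "('u, 'um, 'z1, 'zm1, 'z2, 'zm2) span"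
    and F :: "('a1, 'am1, 'v) vfunctor"
  assumes "is_span A1 A2 X1" and "is_span A1 A2 X2"
    and "is_span A2 A3 X1'" and "is_span A2 A3 X2'"
    and "is_span_map X1 X2 Y" and "is_span_map X1' X2' Y'"
    and "F \<in> vfunctors A1"
  shows "nat_eq (Lam (X1' \<circ>\<^sub>S X1) F)
    (Lam2 (X1' \<circ>\<^sub>S X1) (X2' \<circ>\<^sub>S X2) (span_map_hcomp X1 X2 X1' X2' Y' Y) F)
    (nat_inv (Lam (X2' \<circ>\<^sub>S X2) F) (beta X2 X2' F)
       \<cdot>\<^sub>v hcomp (Lam2 X1' X2' Y') (Lam_map X1') (Lam X1) (Lam X2) (Lam2 X1 X2 Y) F
       \<cdot>\<^sub>v beta X1 X1' F)"
  unfolding nat_eq_def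
proof (intro ballI)
  fix a z assume z: "z \<in> carrier (vob (Lam (X1' \<circ>\<^sub>S X1) F) a)"
  note X = assms(1-4)[THEN is_span_finite_span]
  note Y = assms(5,6)[THEN is_span_map_finite_span_map]
  have F: "mfunctor F" "vdom F = A1"
    using vfunctors_mfunctor[OF assms(7)] assms(7) by (simp_all add: vfunctors_def)
  let ?H = "span_map_hcomp X1 X2 X1' X2' Y' Y"
  have cl: "Lam2 (X1' \<circ>\<^sub>S X1) (X2' \<circ>\<^sub>S X2) ?H F a z \<in> carrier (vob (Lam (X2' \<circ>\<^sub>S X2) F) a)"
    using lmap_closed[OF Lam2_lmap[OF finite_span_comp[OF X(1,3)] finite_span_comp[OF X(2,4)]
        finite_span_map_hcomp[OF X(1-4) Y] F] z] .
  show "Lam2 (X1' \<circ>\<^sub>S X1) (X2' \<circ>\<^sub>S X2) ?H F a z = (nat_inv (Lam (X2' \<circ>\<^sub>S X2) F) (beta X2 X2' F)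
       \<cdot>\<^sub>v hcomp (Lam2 X1' X2' Y') (Lam_map X1') (Lam X1) (Lam X2) (Lam2 X1 X2 Y) F
       \<cdot>\<^sub>v beta X1 X1' F) a z"
    \<comment> \<open>\<open>nat_inv\<close> chooses preimages within the carrier. By
      \<open>interchange\<close> the element to be inverted is the image under \<open>beta\<close>
      of the left-hand side, which lies in that carrier by \<open>cl\<close>, so injectivity returns
      exactly this element.\<close>
    using inv_into_f_f[OF beta_inj[OF X(2,4) F] cl]
    by (simp add: vcomp_def nat_inv_def hcomp_def interchange[OF X Y F z, symmetric])
qed

end
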